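(* Fix an integer $d\ge 2$. For $n\ge d+1$, let $T_n$ be a random $d$-dimensional determinantal hypertree on the vertex set $[n]=\{1,\dots,n\}$ (defined in the context below). Then there is a constant $c_d$ (depending only on $d$) such that \[\lim_{n\to\infty}\frac{\log|H_{d-1}(T_n,\mathbb{Z})|}{\binom{n}{d}}=c_d\quad\text{in probability}.\] Moreover, \[\frac12\log\left(\frac{d+1}{e}\right)\le c_d\le \frac12\log(d+1).\]
   Context: A $d$-dimensional hypertree on the vertex set $[n]$ is a $d$-dimensional simplicial complex $S$ on $[n]$ such that (a) $S$ has complete $(d-1)$-skeleton (every subset of $[n]$ of size at most $d$ is a face); (b) $S$ has exactly $\binom{n-1}{d}$ faces of dimension $d$; (c) the homology group $H_{d-1}(S,\mathbb{Z})$ is finite. By Kalai's formula, $\sum_S |H_{d-1}(S,\mathbb{Z})|^2=n^{\binom{n-2}{d}}$, the sum over all $d$-dimensional hypertrees on $[n]$. A determinantal hypertree $T_n$ is a random $d$-dimensional hypertree on $[n]$ with $\mathbb{P}(T_n=S)=|H_{d-1}(S,\mathbb{Z})|^2/n^{\binom{n-2}{d}}$ for each $d$-dimensional hypertree $S$ on $[n]$. Here $\log$ is the natural logarithm. *)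

theory Defs
  imports "HOL-Algebra.Free_Abelian_Groups" "HOL-Probability.Probability_Mass_Function"
begin

section \<open>Simplicial homology with integer coefficients\<close>

text \<open>Faces are finite sets of vertices; the empty set counts as a face (of dimension -1).\<close>

definition simplicial_complex_on :: "nat \<Rightarrow> nat set set \<Rightarrow> bool" where
  "simplicial_complex_on n K \<longleftrightarrow>
     K \<subseteq> Pow {1..n} \<and> {} \<in> K \<and> (\<forall>s\<in>K. \<forall>t. t \<subseteq> s \<longrightarrow> t \<in> K)"

definition faces :: "nat set set \<Rightarrow> nat \<Rightarrow> nat set set" where
  "faces K k = {s \<in> K. finite s \<and> card s = k + 1}"

definition simplicial_chain_group :: "nat set set \<Rightarrow> nat \<Rightarrow> (nat set \<Rightarrow>\<^sub>0 int) monoid" where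
  "simplicial_chain_group K k = free_Abelian_group (faces K k)"

text \<open>
  Every simplex is oriented by the increasing order of its vertices
  \<open>v\<^sub>0 < \<dots> < v\<^sub>k\<close>, so the sign attached to the facet omitting \<open>v\<^sub>i\<close> is the \<open>i\<close>-th power
  of -1, where \<open>i\<close> is the number of vertices preceding \<open>v\<^sub>i\<close>.
\<close>

definition simplex_boundary :: "nat set \<Rightarrow> nat set \<Rightarrow>\<^sub>0 int" where
  "simplex_boundary s = (\<Sum>v\<in>s. frag_cmul ((-1) ^ card {w \<in> s. w < v}) (frag_of (s - {v})))"

text \<open>The homology is unreduced: the boundary of a 0-chain is 0.\<close>

definition simplicial_boundary :: "nat \<Rightarrow> (nat set \<Rightarrow>\<^sub>0 int) \<Rightarrow> nat set \<Rightarrow>\<^sub>0 int" where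
  "simplicial_boundary k c = (if k = 0 then 0 else frag_extend simplex_boundary c)"

definition simplicial_cycles :: "nat set set \<Rightarrow> nat \<Rightarrow> (nat set \<Rightarrow>\<^sub>0 int) set" where
  "simplicial_cycles K k = {c \<in> carrier (simplicial_chain_group K k). simplicial_boundary k c = 0}"

definition simplicial_boundaries :: "nat set set \<Rightarrow> nat \<Rightarrow> (nat set \<Rightarrow>\<^sub>0 int) set" where
  "simplicial_boundaries K k =
     simplicial_boundary (k + 1) ` carrier (simplicial_chain_group K (k + 1))"

definition simplicial_homology :: "nat set set \<Rightarrow> nat \<Rightarrow> (nat set \<Rightarrow>\<^sub>0 int) set monoid" where
  "simplicial_homology K k =
     (simplicial_chain_group K k)\<lparr>carrier := simplicial_cycles K k\<rparr> Mod simplicial_boundaries K k"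

lemma simplicial_boundary_boundary:
  assumes "finite s"
  shows "frag_extend simplex_boundary (simplex_boundary s) = 0"
proof -
  define t where "t v w = frag_cmul ((-1) ^ card {u \<in> s. u < v} * (-1) ^ card {u \<in> s - {v}. u < w})
      (frag_of (s - {v} - {w}))" for v w
  define D where "D = {(v, w). v \<in> s \<and> w \<in> s \<and> v \<noteq> w}"
  have "D \<subseteq> s \<times> s" by (auto simp: D_def)
  then have D: "finite D" using assms finite_subset by blast
  have D_eq: "D = Sigma s (\<lambda>v. s - {v})" by (auto simp: D_def)
  have "frag_extend simplex_boundary (simplex_boundary s) = (\<Sum>v\<in>s. \<Sum>w\<in>s-{v}. t v w)"
    using assms
    by (simp add: simplex_boundary_def frag_extend_sum frag_extend_cmul frag_cmul_sum t_def)
  also have "\<dots> = (\<Sum>(v,w)\<in>D. t v w)"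
    unfolding D_eq using assms by (subst sum.Sigma) auto
  finally have eq: "frag_extend simplex_boundary (simplex_boundary s) = (\<Sum>(v,w)\<in>D. t v w)" .
  have anti: "t v w + t w v = 0" if "v < w" "v \<in> s" "w \<in> s" for v w
  proof -
    have "{u \<in> s - {w}. u < v} = {u \<in> s. u < v}" using that by auto
    moreover have "{u \<in> s. u < w} = insert v {u \<in> s - {v}. u < w}" using that by auto
    then have "card {u \<in> s. u < w} = Suc (card {u \<in> s - {v}. u < w})" using assms by simp
    moreover have "s - {w} - {v} = s - {v} - {w}" by auto
    ultimately show ?thesis
      by (simp add: t_def mult.commute flip: frag_cmul_distrib)
  qed
  have split: "D = {(v,w)\<in>D. v < w} \<union> {(v,w)\<in>D. w < v}" by (auto simp: D_def)
  have "(\<Sum>(v,w)\<in>D. t v w) = (\<Sum>(v,w)\<in>{(v,w)\<in>D. v < w}. t v w) + (\<Sum>(v,w)\<in>{(v,w)\<in>D. w < v}. t v w)"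
    by (subst split, rule sum.union_disjoint) (auto intro: finite_subset[OF _ D])
  also have "(\<Sum>(v,w)\<in>{(v,w)\<in>D. w < v}. t v w) = (\<Sum>(v,w)\<in>{(v,w)\<in>D. v < w}. t w v)"
    by (rule sum.reindex_bij_witness[of _ prod.swap prod.swap]) (auto simp: D_def)
  finally show ?thesis
    using anti by (simp add: eq D_def case_prod_unfold flip: sum.distrib)
qed

lemma simplicial_boundaries_subset_cycles:
  assumes "\<And>s t. s \<in> K \<Longrightarrow> t \<subseteq> s \<Longrightarrow> t \<in> K"
  shows "simplicial_boundaries K k \<subseteq> simplicial_cycles K k"
proof
  fix b assume "b \<in> simplicial_boundaries K k"
  then obtain c where c: "Poly_Mapping.keys c \<subseteq> faces K (k + 1)"
    and b: "b = frag_extend simplex_boundary c"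
    by (auto simp: simplicial_boundaries_def simplicial_boundary_def simplicial_chain_group_def)
  have "Poly_Mapping.keys b \<subseteq> faces K k \<and> frag_extend simplex_boundary b = 0"
    unfolding b using c
  proof (induction c rule: frag_induction)
    case (one s)
    then have s: "finite s" "card s = k + 2" "s \<in> K" by (auto simp: faces_def)
    have "Poly_Mapping.keys (frag_cmul a (frag_of (s - {v}))) \<subseteq> faces K k" if "v \<in> s" for a v
      using s that assms[of s "s - {v}"] keys_cmul[of a "frag_of (s - {v})"]
      by (auto simp: faces_def card_Diff_singleton)
    then have "Poly_Mapping.keys (simplex_boundary s) \<subseteq> faces K k"
      unfolding simplex_boundary_def
      using keys_sum[of "\<lambda>v. frag_cmul ((-1) ^ card {w \<in> s. w < v}) (frag_of (s - {v}))" s]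
      by blast
    with s show ?case by (simp add: simplicial_boundary_boundary)
  next
    case (diff a b)
    then show ?case
      using keys_diff[of "frag_extend simplex_boundary a" "frag_extend simplex_boundary b"]
      by (auto simp: frag_extend_diff)
  qed auto
  then show "b \<in> simplicial_cycles K k"
    by (auto simp: simplicial_cycles_def simplicial_boundary_def simplicial_chain_group_def)
qed

section \<open>Hypertrees\<close>

definition hypertree :: "nat \<Rightarrow> nat \<Rightarrow> nat set set \<Rightarrow> bool" where
  "hypertree d n S \<longleftrightarrow>
     simplicial_complex_on n S \<and>
     (\<forall>s\<in>S. card s \<le> d + 1) \<and> (\<exists>s\<in>S. card s = d + 1) \<and>
     (\<forall>s. s \<subseteq> {1..n} \<and> card s \<le> d \<longrightarrow> s \<in> S) \<and>
     card (faces S d) = (n - 1) choose d \<and>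
     finite (carrier (simplicial_homology S (d - 1)))"

text \<open>
  A random hypertree is represented by its law. That the prescribed weights on the hypertrees add
  up to 1, so that such a law exists (and is then unique), is Kalai's formula.
\<close>

definition determinantal_hypertree :: "nat \<Rightarrow> nat \<Rightarrow> nat set set pmf \<Rightarrow> bool" where
  "determinantal_hypertree d n T \<longleftrightarrow>
     set_pmf T \<subseteq> {S. hypertree d n S} \<and>
     (\<forall>S. hypertree d n S \<longrightarrow>
        pmf T S = real (Coset.order (simplicial_homology S (d - 1))) ^ 2 / real n ^ ((n - 2) choose d))"

end

theory Submission
  imports Defs "Jordan_Normal_Form.Schur_Decomposition" "HOL-Analysis.Analysis"
begin

text \<open>
  Let \<open>G\<close> be the Gram matrix of the boundaries of the \<open>d\<close>-simplices on \<open>[n]\<close>. Since \<open>G\<^sup>2 = n G\<close>, the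
  minors \<open>det (G / n)\<^sub>T\<close> over the sets \<open>T\<close> of rank many simplices are the weights of a determinantal
  probability measure with kernel \<open>G / n\<close>. For a hypertree with top faces \<open>T\<close>, the number
  \<open>det G\<^sub>T\<close> equals, up to a deterministic factor whose logarithm is of lower order, the square of the
  order of the homology group. One only has to show that the order is at most the absolute value of
  an integer determinant: both families of weights sum to 1, so equality follows.

  The moments of the spectrum of \<open>G\<^sub>T\<close> are traces of powers, that is, sums over closed walks of
  simplices weighted with inclusion probabilities, which are minors of the kernel. Grouping
  the walks by order type makes the expected traces a finite sum of terms of order at most
  \<open>n\<^sup>d\<close>, so they converge after normalization; unlinked pairs of walks are uncorrelated, which bounds
  the variances. The \<open>j\<close>-th moment is at most \<open>C\<^sup>j j!\<close>, so re-expanding \<open>exp (- s \<lambda>)\<close> in short steps and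
  approximating in powers of \<open>exp (- \<lambda>)\<close> gives convergence of the averages of \<open>ln (\<lambda> + \<epsilon>)\<close>.

  The singularity of the logarithm at 0 is controlled by the identity that expresses the mean of
  \<open>det (G\<^sub>T + \<epsilon>) / det G\<^sub>T\<close> as an explicit sum of products of binomial coefficients; it is at most
  \<open>exp (2 k sqrt (\<epsilon> / (d + 1)))\<close>, where \<open>k\<close> is the rank. The lower bound for the limit counts the
  sets \<open>T\<close>, and the upper bound is the inequality of arithmetic and geometric means for the
  eigenvalues of \<open>G\<^sub>T\<close>.
\<close>

section \<open>Principal minors\<close>

text \<open>The logarithm is the obstacle: convergence of all moments says nothing about eigenvalues
  near 0, and a few extremely small ones could dominate the log-determinant. What helps is that the
  weights themselves contain det G_T. It cancels the denominator of det (G_T + \<epsilon>) / det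
  G_T, so the mean of this ratio is a plain sum of shifted minors, linear in the minors of G and
  hence computable exactly. Markov's inequality then shows that the regularization costs only O(sqrt
  \<epsilon>) per eigenvalue. The lower bound has the same origin: a total weight 1 spread over at
  most (e n / (d + 1))^rank sets leaves exponentially little mass on sets whose determinant is much
  below ((d + 1) / e)^rank. The eigenvalues get no bound uniform in n, only moments of factorial
  growth; these control Taylor expansions of a fixed positive radius, hence the short steps. The
  deterministic factor between det G_T and the squared order is n to the power (n-2 choose d-1). It
  comes from a basis of the cycles by boundaries of cones with apex n, whose Gram matrix is the
  identity plus the Gram matrix one dimension lower.\<close>

definition pdet :: "'a set \<Rightarrow> ('a \<Rightarrow> 'a \<Rightarrow> 'b) \<Rightarrow> 'b::comm_ring_1" where
  "pdet E G = (\<Sum>p | p permutes E. of_int (sign p) * (\<Prod>i\<in>E. G i (p i)))"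

lemma pdet_cong:
  assumes "\<And>i j. i \<in> E \<Longrightarrow> j \<in> E \<Longrightarrow> G i j = G' i j"
  shows "pdet E G = pdet E G'"
  unfolding pdet_def using assms
  by (intro sum.cong refl arg_cong2[where f="(*)"] prod.cong) (auto simp: permutes_in_image)

lemma pdet_empty [simp]: "pdet {} G = 1"
  by (simp add: pdet_def)

lemma pdet_image:
  assumes "finite E" "inj_on h E"
  shows "pdet (h ` E) G = pdet E (\<lambda>i j. G (h i) (h j))"
proof -
  have bij: "bij_betw (map_permutation E h) {p. p permutes E} {p. p permutes h ` E}"
  proof -
    have eq: "map_permutation E h = (\<lambda>\<pi> x. if x \<in> h ` E then h (\<pi> (inv_into E h x)) else x)"
      by (rule ext, rule ext) (simp only: map_permutation_def restrict_id_def o_def)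
    show ?thesis unfolding eq
      by (rule bij_betw_permutations) (use assms in \<open>simp add: bij_betw_def\<close>)
  qed
  have "pdet (h ` E) G = (\<Sum>p | p permutes E. of_int (sign (map_permutation E h p)) *
      (\<Prod>i\<in>h ` E. G i (map_permutation E h p i)))"
    unfolding pdet_def by (rule sum.reindex_bij_betw[OF bij, symmetric])
  also have "\<dots> = pdet E (\<lambda>i j. G (h i) (h j))"
    unfolding pdet_def
  proof (intro sum.cong refl arg_cong2[where f="(*)"])
    fix p assume p: "p \<in> {p. p permutes E}"
    show "of_int (sign (map_permutation E h p)) = of_int (sign p)"
      using p assms by (simp add: sign_map_permutation)
    show "(\<Prod>i\<in>h ` E. G i (map_permutation E h p i)) = (\<Prod>i\<in>E. G (h i) (h (p i)))"
      using assms p by (simp add: prod.reindex map_permutation_apply)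
  qed
  finally show ?thesis .
qed

lemma pdet_eq_det:
  "pdet {0..<m} G = det (mat m m (\<lambda>(i, j). G i j))"
  by (simp add: pdet_def det_def permutes_in_image)

lemma pdet_of_real:
  "pdet E (\<lambda>i j. of_real (G i j)) = of_real (pdet E G)"
  by (simp add: pdet_def)

lemma pdet_of_int:
  "pdet E (\<lambda>i j. of_int (G i j)) = of_int (pdet E G)"
  by (simp add: pdet_def)

text \<open>Multiply out the product over the rows; \<open>F\<close> is the set of rows that use the
  entry of \<open>G\<close>. A row of \<open>E - F\<close> contributes only if \<open>p\<close>
  fixes it, so only permutations of \<open>F\<close> survive.\<close>

lemma pdet_add_diag:
  assumes "finite E"
  shows "pdet E (\<lambda>i j. G i j + (if i = j then c else 0)) = (\<Sum>F\<in>Pow E. c ^ card (E - F) * pdet F G)"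
proof -
  have perm: "{p. p permutes E \<and> (\<forall>i\<in>E-F. p i = i)} = {p. p permutes F}" if "F \<subseteq> E" for F
    using that by (auto intro: permutes_subset permutes_superset simp: permutes_not_in)
  have "pdet E (\<lambda>i j. G i j + (if i = j then c else 0)) =
     (\<Sum>p | p permutes E. \<Sum>F\<in>Pow E. of_int (sign p) *
       ((\<Prod>i\<in>F. G i (p i)) * (\<Prod>i\<in>E-F. if i = p i then c else 0)))"
    unfolding pdet_def prod_add[OF assms] by (simp add: sum_distrib_left)
  also have "\<dots> = (\<Sum>F\<in>Pow E. \<Sum>p | p permutes E. of_int (sign p) *
       ((\<Prod>i\<in>F. G i (p i)) * (\<Prod>i\<in>E-F. if i = p i then c else 0)))"
    by (rule sum.swap)
  also have "\<dots> = (\<Sum>F\<in>Pow E. c ^ card (E - F) * pdet F G)"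
  proof (rule sum.cong[OF refl])
    fix F assume F: "F \<in> Pow E"
    then have F': "F \<subseteq> E" by simp
    have "(\<Sum>p | p permutes E. of_int (sign p) *
       ((\<Prod>i\<in>F. G i (p i)) * (\<Prod>i\<in>E-F. if i = p i then c else 0))) =
       (\<Sum>p | p permutes E \<and> (\<forall>i\<in>E-F. p i = i). of_int (sign p) *
       ((\<Prod>i\<in>F. G i (p i)) * c ^ card (E - F)))"
    proof (rule sum.mono_neutral_cong_right)
      show "finite {p. p permutes E}" using assms by (rule finite_permutations)
      show "\<forall>p\<in>{p. p permutes E} - {p. p permutes E \<and> (\<forall>i\<in>E-F. p i = i)}. of_int (sign p) *
       ((\<Prod>i\<in>F. G i (p i)) * (\<Prod>i\<in>E-F. if i = p i then c else 0)) = 0"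
      proof
        fix p assume "p \<in> {p. p permutes E} - {p. p permutes E \<and> (\<forall>i\<in>E-F. p i = i)}"
        then obtain i where "i \<in> E - F" "i \<noteq> p i" by auto
        then have "\<exists>i\<in>E-F. (if i = p i then c else 0) = 0" by auto
        then have "(\<Prod>i\<in>E-F. if i = p i then c else 0) = 0"
          by (intro prod_zero) (use assms in auto)
        then show "of_int (sign p) *
       ((\<Prod>i\<in>F. G i (p i)) * (\<Prod>i\<in>E-F. if i = p i then c else 0)) = 0" by simp
      qed
    next
      fix p assume "p \<in> {p. p permutes E \<and> (\<forall>i\<in>E-F. p i = i)}"
      then have "(\<Prod>i\<in>E-F. if i = p i then c else 0) = (\<Prod>i\<in>E-F. c)"
        by (intro prod.cong) auto
      then show "of_int (sign p) * ((\<Prod>i\<in>F. G i (p i)) * (\<Prod>i\<in>E-F. if i = p i then c else 0)) =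
         of_int (sign p) * ((\<Prod>i\<in>F. G i (p i)) * c ^ card (E - F))" by simp
    qed auto
    also have "\<dots> = c ^ card (E - F) * pdet F G"
      unfolding perm[OF F'] pdet_def by (simp add: sum_distrib_left algebra_simps)
    finally show "(\<Sum>p | p permutes E. of_int (sign p) *
       ((\<Prod>i\<in>F. G i (p i)) * (\<Prod>i\<in>E-F. if i = p i then c else 0))) = c ^ card (E - F) * pdet F G" .
  qed
  finally show ?thesis .
qed

section \<open>Replaced columns and the expansion of bordered minors\<close>

definition repcol :: "('a \<Rightarrow> 'a \<Rightarrow> 'b) \<Rightarrow> 'a \<Rightarrow> ('a \<Rightarrow> 'b) \<Rightarrow> 'a \<Rightarrow> 'a \<Rightarrow> 'b" where
  "repcol G b u i j = (if j = b then u i else G i j)"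

text \<open>A permutation meets column \<open>b\<close> exactly once, in row
  \<open>Hilbert_Choice.inv p b\<close>; isolating this factor displays the linearity in the
  inserted column.\<close>

lemma pdet_repcol_linear:
  assumes "finite E" "b \<in> E"
  shows "pdet E (repcol G b u) =
    (\<Sum>p | p permutes E. of_int (sign p) * (u (Hilbert_Choice.inv p b) * (\<Prod>i\<in>E-{Hilbert_Choice.inv p b}. G i (p i))))"
  unfolding pdet_def
proof (intro sum.cong refl arg_cong2[where f="(*)"])
  fix p assume "p \<in> {p. p permutes E}"
  then have p: "p permutes E" by simp
  have in_E: "Hilbert_Choice.inv p b \<in> E" using permutes_in_image[OF permutes_inv[OF p]] assms by simp
  have "(\<Prod>i\<in>E. repcol G b u i (p i)) = repcol G b u (Hilbert_Choice.inv p b) (p (Hilbert_Choice.inv p b)) *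
      (\<Prod>i\<in>E-{Hilbert_Choice.inv p b}. repcol G b u i (p i))"
    by (rule prod.remove[OF assms(1) in_E])
  also have "p (Hilbert_Choice.inv p b) = b" using p permutes_inverses(1) by metis
  also have "(\<Prod>i\<in>E-{Hilbert_Choice.inv p b}. repcol G b u i (p i)) = (\<Prod>i\<in>E-{Hilbert_Choice.inv p b}. G i (p i))"
    using p by (intro prod.cong) (auto simp: repcol_def permutes_inverses)
  finally show "(\<Prod>i\<in>E. repcol G b u i (p i)) = u (Hilbert_Choice.inv p b) * (\<Prod>i\<in>E-{Hilbert_Choice.inv p b}. G i (p i))"
    by (simp add: repcol_def)
qed

lemma pdet_repcol_sum:
  assumes "finite E" "b \<in> E"
  shows "(\<Sum>f\<in>V. c f * pdet E (repcol G b (u f))) = pdet E (repcol G b (\<lambda>i. \<Sum>f\<in>V. c f * u f i))"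
proof -
  have "(\<Sum>f\<in>V. c f * pdet E (repcol G b (u f))) = (\<Sum>f\<in>V. \<Sum>p | p permutes E.
      of_int (sign p) * (c f * u f (Hilbert_Choice.inv p b) * (\<Prod>i\<in>E-{Hilbert_Choice.inv p b}. G i (p i))))"
    unfolding pdet_repcol_linear[OF assms] by (simp add: sum_distrib_left algebra_simps)
  also have "\<dots> = (\<Sum>p | p permutes E. \<Sum>f\<in>V.
      of_int (sign p) * (c f * u f (Hilbert_Choice.inv p b) * (\<Prod>i\<in>E-{Hilbert_Choice.inv p b}. G i (p i))))"
    by (rule sum.swap)
  also have "\<dots> = pdet E (repcol G b (\<lambda>i. \<Sum>f\<in>V. c f * u f i))"
    unfolding pdet_repcol_linear[OF assms] by (simp add: sum_distrib_left sum_distrib_right)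
  finally show ?thesis .
qed

text \<open>Composition with the transposition of the two columns flips every sign and keeps every
  product, so the minor equals its own negative.\<close>

lemma pdet_identical_columns:
  assumes "finite E" "b \<in> E" "c \<in> E" "b \<noteq> c" "\<And>i. i \<in> E \<Longrightarrow> G i b = G i c"
  shows "pdet E G = (0 :: 'b :: {comm_ring_1, ring_char_0, idom})"
proof -
  have tr: "Transposition.transpose b c permutes E" using assms by (simp add: permutes_swap_id)
  have "pdet E G = (\<Sum>p | p permutes E. of_int (sign (Transposition.transpose b c \<circ> p)) * (\<Prod>i\<in>E. G i ((Transposition.transpose b c \<circ> p) i)))"
    unfolding pdet_def
    by (rule setum_permutations_compose_left[OF tr])
  also have "\<dots> = (\<Sum>p | p permutes E. - (of_int (sign p) * (\<Prod>i\<in>E. G i (p i))))"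
  proof (intro sum.cong refl)
    fix p assume "p \<in> {p. p permutes E}"
    then have p: "p permutes E" by simp
    have "sign (Transposition.transpose b c \<circ> p) = - sign p"
      using sign_compose[OF permutation_swap_id, of p b c] p assms
      by (simp add: permutes_imp_permutation[OF assms(1)] sign_swap_id)
    moreover have "(\<Prod>i\<in>E. G i ((Transposition.transpose b c \<circ> p) i)) = (\<Prod>i\<in>E. G i (p i))"
      using assms by (intro prod.cong) (auto simp: Transposition.transpose_def)
    ultimately show "of_int (sign (Transposition.transpose b c \<circ> p)) * (\<Prod>i\<in>E. G i ((Transposition.transpose b c \<circ> p) i))
        = - (of_int (sign p) * (\<Prod>i\<in>E. G i (p i)))" by simp
  qed
  also have "\<dots> = - pdet E G" by (simp add: pdet_def sum_negf)
  finally show ?thesis by simp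
qed

text \<open>Expansion along row \<open>a\<close>, sorted by the column \<open>b\<close> used there.
  For \<open>b\<close> in \<open>E\<close>, undoing the transposition of \<open>a\<close> and
  \<open>b\<close> leaves a permutation of \<open>E\<close>; the row that used column
  \<open>a\<close> now points to column \<open>b\<close>, whence the replaced column, and the
  transposition supplies the minus sign.\<close>

lemma pdet_insert:
  assumes "finite E" "a \<notin> E"
  shows "pdet (insert a E) G = G a a * pdet E G - (\<Sum>b\<in>E. G a b * pdet E (repcol G b (\<lambda>i. G i a)))"
proof -
  define t where "t p = of_int (sign p) * (\<Prod>i\<in>insert a E. G i (p i))" for p
  have "pdet (insert a E) G = (\<Sum>b\<in>insert a E. \<Sum>q | q permutes E. t (Transposition.transpose a b \<circ> q))"
    unfolding pdet_def t_def[symmetric] by (rule sum_over_permutations_insert[OF assms])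
  also have "\<dots> = (\<Sum>q | q permutes E. t (Transposition.transpose a a \<circ> q)) + (\<Sum>b\<in>E. \<Sum>q | q permutes E. t (Transposition.transpose a b \<circ> q))"
    using assms by simp
  also have "(\<Sum>q | q permutes E. t (Transposition.transpose a a \<circ> q)) = G a a * pdet E G"
  proof -
    have "t (Transposition.transpose a a \<circ> q) = G a a * (of_int (sign q) * (\<Prod>i\<in>E. G i (q i)))" if "q permutes E" for q
      using that assms by (simp add: t_def permutes_not_in)
    then show ?thesis by (simp add: pdet_def sum_distrib_left)
  qed
  also have "(\<Sum>b\<in>E. \<Sum>q | q permutes E. t (Transposition.transpose a b \<circ> q)) = (\<Sum>b\<in>E. - (G a b * pdet E (repcol G b (\<lambda>i. G i a))))"
  proof (intro sum.cong refl)
    fix b assume b: "b \<in> E"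
    have "t (Transposition.transpose a b \<circ> q) = - (G a b * (of_int (sign q) * (\<Prod>i\<in>E. repcol G b (\<lambda>i. G i a) i (q i))))"
      if q: "q permutes E" for q
    proof -
      have "a \<noteq> b" using b assms by auto
      have "sign (Transposition.transpose a b \<circ> q) = - sign q"
        using sign_compose[OF permutation_swap_id, of q a b] q assms \<open>a \<noteq> b\<close>
        by (simp add: permutes_imp_permutation[OF assms(1)] sign_swap_id)
      moreover have "(Transposition.transpose a b \<circ> q) a = b" using q assms by (simp add: permutes_not_in)
      moreover have "(\<Prod>i\<in>E. G i ((Transposition.transpose a b \<circ> q) i)) = (\<Prod>i\<in>E. repcol G b (\<lambda>i. G i a) i (q i))"
      proof (rule prod.cong[OF refl])
        fix i assume "i \<in> E"
        then have "q i \<noteq> a" using q assms permutes_in_image by metis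
        then show "G i ((Transposition.transpose a b \<circ> q) i) = repcol G b (\<lambda>i. G i a) i (q i)"
          by (auto simp: repcol_def Transposition.transpose_def)
      qed
      ultimately show ?thesis using assms by (simp add: t_def)
    qed
    then show "(\<Sum>q | q permutes E. t (Transposition.transpose a b \<circ> q)) = - (G a b * pdet E (repcol G b (\<lambda>i. G i a)))"
      by (simp add: pdet_def sum_distrib_left sum_negf)
  qed
  finally show ?thesis by (simp add: sum_negf)
qed

text \<open>Because of the vanishing block, a contributing permutation maps \<open>E\<close> into
  itself, by finiteness onto itself, and therefore splits into a permutation of \<open>E\<close> and
  one of \<open>F\<close>.\<close>

lemma pdet_block:
  fixes G :: "'a \<Rightarrow> 'a \<Rightarrow> 'b::comm_ring_1"
  assumes "finite E" "finite F" "E \<inter> F = {}"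
    and zero: "\<And>i j. i \<in> E \<Longrightarrow> j \<in> F \<Longrightarrow> G i j = 0"
  shows "pdet (E \<union> F) G = pdet E G * pdet F G"
proof -
  define t where "t p = of_int (sign p) * (\<Prod>i\<in>E\<union>F. G i (p i))" for p
  define S where "S = (\<lambda>(p, q). p \<circ> q) ` ({p. p permutes E} \<times> {q. q permutes F})"
  have appl: "(p \<circ> q) i = (if i \<in> E then p i else q i)"
    if "p permutes E" "q permutes F" for p q i
  proof (cases "i \<in> F")
    case True
    then have "q i \<in> F" using that permutes_in_image by metis
    then have "q i \<notin> E" using assms(3) by auto
    with True show ?thesis using that assms(3) by (auto simp: permutes_not_in[OF that(1)])
  next
    case False
    then show ?thesis using that by (auto simp: permutes_not_in)
  qed
  have inj: "inj_on (\<lambda>(p, q). p \<circ> q) ({p. p permutes E} \<times> {q. q permutes F})"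
  proof (rule inj_onI, clarsimp)
    fix p q p' q' assume *: "p permutes E" "q permutes F" "p' permutes E" "q' permutes F" "p \<circ> q = p' \<circ> q'"
    have "(p \<circ> q) i = (p' \<circ> q') i" for i using *(5) by simp
    then have eq: "(if i \<in> E then p i else q i) = (if i \<in> E then p' i else q' i)" for i
      using appl[OF *(1,2)] appl[OF *(3,4)] by simp
    have "p i = p' i" for i using eq[of i] *(1,3) by (cases "i \<in> E") (auto simp: permutes_not_in)
    moreover have "q i = q' i" for i
      using eq[of i] *(2,4) assms(3) by (cases "i \<in> E") (auto simp: permutes_not_in disjoint_iff)
    ultimately show "p = p' \<and> q = q'" by auto
  qed
  have "pdet (E \<union> F) G = (\<Sum>p\<in>S. t p)"
    unfolding pdet_def t_def[symmetric]
  proof (rule sum.mono_neutral_right)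
    show "finite {p. p permutes E \<union> F}" using assms by (simp add: finite_permutations)
    show "S \<subseteq> {p. p permutes E \<union> F}"
      by (auto simp: S_def intro!: permutes_compose intro: permutes_subset)
    show "\<forall>p\<in>{p. p permutes E \<union> F} - S. t p = 0"
    proof
      fix p assume "p \<in> {p. p permutes E \<union> F} - S"
      then have p: "p permutes E \<union> F" "p \<notin> S" by auto
      show "t p = 0"
      proof (cases "\<exists>i\<in>E. p i \<in> F")
        case True
        then have "\<exists>i\<in>E\<union>F. G i (p i) = 0" using zero by auto
        then have "(\<Prod>i\<in>E\<union>F. G i (p i)) = 0" by (intro prod_zero) (use assms in auto)
        then show ?thesis by (simp add: t_def)
      next
        case False
        then have "p ` E \<subseteq> E" using permutes_in_image[OF p(1)] by blast
        moreover have injp: "inj p" using p(1) permutes_inj by blast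
        ultimately have pE: "p ` E = E" using assms(1) by (simp add: endo_inj_surj inj_on_subset)
        have "p ` (E \<union> F) = E \<union> F" using p(1) by (rule permutes_image)
        moreover have F_eq: "F = (E \<union> F) - E" using assms(3) by auto
        ultimately have pF: "p ` F = F"
          using image_set_diff[OF injp, of "E \<union> F" E] pE by simp
        define p1 where "p1 i = (if i \<in> E then p i else i)" for i
        define p2 where "p2 i = (if i \<in> F then p i else i)" for i
        have bE: "bij_betw p E E" and bF: "bij_betw p F F"
          using pE pF injp by (auto simp: bij_betw_def intro: inj_on_subset)
        have "bij_betw p1 E E = bij_betw p E E" by (rule bij_betw_cong) (simp add: p1_def)
        then have p1: "p1 permutes E"
          using bE by (intro bij_imp_permutes) (simp_all add: p1_def)
        have "bij_betw p2 F F = bij_betw p F F" by (rule bij_betw_cong) (simp add: p2_def)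
        then have p2: "p2 permutes F"
          using bF by (intro bij_imp_permutes) (simp_all add: p2_def)
        have "p = p1 \<circ> p2"
        proof
          fix i
          show "p i = (p1 \<circ> p2) i"
            unfolding appl[OF p1 p2] using p(1) by (auto simp: p1_def p2_def permutes_not_in)
        qed
        then have "p \<in> S" using p1 p2 by (auto simp: S_def)
        with p show ?thesis by simp
      qed
    qed
  qed
  also have "\<dots> = (\<Sum>(p,q)\<in>{p. p permutes E} \<times> {q. q permutes F}. t (p \<circ> q))"
    unfolding S_def by (subst sum.reindex[OF inj]) (simp add: case_prod_unfold)
  also have "\<dots> = (\<Sum>(p,q)\<in>{p. p permutes E} \<times> {q. q permutes F}.
      (of_int (sign p) * (\<Prod>i\<in>E. G i (p i))) * (of_int (sign q) * (\<Prod>i\<in>F. G i (q i))))"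
  proof (intro sum.cong refl, clarify)
    fix p q assume pq: "p permutes E" "q permutes F"
    have "sign (p \<circ> q) = sign p * sign q"
      using pq assms by (intro sign_compose) (auto intro: permutes_imp_permutation)
    moreover have "(\<Prod>i\<in>E\<union>F. G i ((p \<circ> q) i)) = (\<Prod>i\<in>E. G i ((p \<circ> q) i)) * (\<Prod>i\<in>F. G i ((p \<circ> q) i))"
      using assms by (intro prod.union_disjoint) auto
    moreover have "(\<Prod>i\<in>E. G i ((p \<circ> q) i)) = (\<Prod>i\<in>E. G i (p i))"
      unfolding appl[OF pq] by simp
    moreover have "(\<Prod>i\<in>F. G i ((p \<circ> q) i)) = (\<Prod>i\<in>F. G i (q i))"
      unfolding appl[OF pq] using assms(3) by (intro prod.cong) auto
    ultimately show "t (p \<circ> q) = (of_int (sign p) * (\<Prod>i\<in>E. G i (p i))) * (of_int (sign q) * (\<Prod>i\<in>F. G i (q i)))"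
      by (simp add: t_def algebra_simps)
  qed
  also have "\<dots> = pdet E G * pdet F G"
    unfolding pdet_def sum_product sum.cartesian_product by simp
  finally show ?thesis .
qed

section \<open>Scaled projection matrices\<close>

lemma repcol_self [simp]: "repcol G b (\<lambda>i. G i b) = G"
  by (intro ext) (simp add: repcol_def)

lemma card_supersets_of_card:
  assumes "finite V" "F \<subseteq> V" "card F \<le> m"
  shows "card {T. F \<subseteq> T \<and> T \<subseteq> V \<and> card T = m} = (card V - card F) choose (m - card F)"
proof -
  have fin: "finite F" using assms finite_subset by blast
  have "bij_betw (\<lambda>X. F \<union> X) {X. X \<subseteq> V - F \<and> card X = m - card F} {T. F \<subseteq> T \<and> T \<subseteq> V \<and> card T = m}"
  proof (rule bij_betw_byWitness[where f' = "\<lambda>T. T - F"])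
    show "(\<union>) F ` {X. X \<subseteq> V - F \<and> card X = m - card F} \<subseteq> {T. F \<subseteq> T \<and> T \<subseteq> V \<and> card T = m}"
    proof clarsimp
      fix X assume X: "X \<subseteq> V - F" "card X = m - card F"
      then have "card (F \<union> X) = card F + card X"
        using fin assms(1) by (intro card_Un_disjoint) (auto intro: finite_subset)
      then show "F \<subseteq> V \<and> X \<subseteq> V \<and> card (F \<union> X) = m" using X assms by auto
    qed
    show "(\<lambda>T. T - F) ` {T. F \<subseteq> T \<and> T \<subseteq> V \<and> card T = m} \<subseteq> {X. X \<subseteq> V - F \<and> card X = m - card F}"
      using fin by (auto simp: card_Diff_subset)
  qed auto
  then have "card {T. F \<subseteq> T \<and> T \<subseteq> V \<and> card T = m} = card {X. X \<subseteq> V - F \<and> card X = m - card F}"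
    by (rule bij_betw_same_card[symmetric])
  also have "\<dots> = card (V - F) choose (m - card F)"
    using assms by (intro n_subsets) auto
  finally show ?thesis using assms fin by (simp add: card_Diff_subset)
qed

text \<open>\<open>square\<close> and \<open>trace\<close> say that \<open>G / \<nu>\<close> is
  idempotent with trace \<open>k\<close>, a projection of rank \<open>k\<close>;
  \<open>pdet_nonneg\<close> turns its minors into probabilities. The index set is abstract because
  the locale serves twice: for the top-dimensional simplices on \<open>n\<close> vertices, and one
  dimension lower on \<open>n - 1\<close> vertices.\<close>

locale projection_kernel =
  fixes V :: "'a set" and G :: "'a \<Rightarrow> 'a \<Rightarrow> real" and \<nu> :: real and k :: nat
  assumes finite_V: "finite V"
    and square: "\<And>e f. e \<in> V \<Longrightarrow> f \<in> V \<Longrightarrow> (\<Sum>g\<in>V. G e g * G g f) = \<nu> * G e f"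
    and trace: "(\<Sum>e\<in>V. G e e) = \<nu> * real k"
    and \<nu>_pos: "\<nu> > 0"
    and pdet_nonneg: "\<And>E. E \<subseteq> V \<Longrightarrow> pdet E G \<ge> 0"
begin

text \<open>Sum \<open>pdet_insert\<close> over \<open>f\<close>: the diagonal terms give the trace
  \<open>\<nu> * k\<close>, and in each of the \<open>card E\<close> correction terms
  \<open>square\<close> turns the replaced column into \<open>\<nu>\<close> times the original
  one.\<close>

lemma sum_pdet_insert:
  assumes E: "E \<subseteq> V"
  shows "(\<Sum>f\<in>V-E. pdet (insert f E) G) = \<nu> * (real k - real (card E)) * pdet E G"
proof -
  have fin: "finite E" using E finite_V finite_subset by blast
  \<comment> \<open>The right-hand side of \<open>pdet_insert\<close>, read for \<open>f\<close> in
    \<open>E\<close> as well. There it vanishes: the replaced column repeats column \<open>f\<close>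
    unless \<open>b = f\<close>, and the term \<open>b = f\<close> cancels the diagonal one. So the
    sum may run over all of \<open>V\<close>, as \<open>trace\<close> and \<open>square\<close>
    require.\<close>
  define R where "R f = G f f * pdet E G - (\<Sum>b\<in>E. G f b * pdet E (repcol G b (\<lambda>i. G i f)))" for f
  have "R f = 0" if f: "f \<in> E" for f
  proof -
    have "pdet E (repcol G b (\<lambda>i. G i f)) = 0" if "b \<in> E - {f}" for b
      by (rule pdet_identical_columns[OF fin, of b f]) (use that f in \<open>auto simp: repcol_def\<close>)
    then have "(\<Sum>b\<in>E. G f b * pdet E (repcol G b (\<lambda>i. G i f))) = G f f * pdet E G"
      using sum.remove[OF fin f, of "\<lambda>b. G f b * pdet E (repcol G b (\<lambda>i. G i f))"] by simp
    then show ?thesis by (simp add: R_def)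
  qed
  then have "(\<Sum>f\<in>V-E. R f) = (\<Sum>f\<in>V. R f)"
    using E finite_V by (intro sum.mono_neutral_left) auto
  moreover have "(\<Sum>f\<in>V-E. pdet (insert f E) G) = (\<Sum>f\<in>V-E. R f)"
    unfolding R_def by (intro sum.cong refl pdet_insert fin) auto
  moreover have "(\<Sum>f\<in>V. R f) = \<nu> * real k * pdet E G
      - (\<Sum>b\<in>E. \<Sum>f\<in>V. G f b * pdet E (repcol G b (\<lambda>i. G i f)))"
    unfolding R_def sum_subtractf by (subst sum.swap) (simp add: trace flip: sum_distrib_right)
  moreover have "(\<Sum>f\<in>V. G f b * pdet E (repcol G b (\<lambda>i. G i f))) = \<nu> * pdet E G" if b: "b \<in> E" for b
  proof -
    have "(\<Sum>f\<in>V. G f b * pdet E (repcol G b (\<lambda>i. G i f))) = pdet E (repcol G b (\<lambda>i. \<Sum>f\<in>V. G f b * G i f))"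
      by (rule pdet_repcol_sum[OF fin b])
    also have "\<dots> = pdet E (repcol G b (\<lambda>i. \<nu> * G i b))"
      by (rule pdet_cong) (use square E b in \<open>auto simp: repcol_def mult.commute\<close>)
    also have "\<dots> = \<nu> * pdet E G"
      using pdet_repcol_sum[OF fin b, of "\<lambda>_. \<nu>" G "\<lambda>f i. G i b" "{b}"] by simp
    finally show ?thesis .
  qed
  ultimately show ?thesis by (simp add: algebra_simps)
qed

definition supersets :: "'a set \<Rightarrow> nat \<Rightarrow> 'a set set" where
  "supersets E m = {T. E \<subseteq> T \<and> T \<subseteq> V \<and> card T = m}"

lemma finite_supersets [simp]: "finite (supersets E m)"
  by (rule finite_subset[of _ "Pow V"]) (auto simp: supersets_def finite_V)

text \<open>Double counting of pairs (T, f) with \<open>f\<close> in \<open>T - E\<close>: deleting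
  \<open>f\<close> leaves a set of size \<open>m\<close>, to which \<open>sum_pdet_insert\<close>
  applies.\<close>

lemma sum_supersets_Suc:
  assumes E: "E \<subseteq> V"
  shows "(real (Suc m) - real (card E)) * (\<Sum>T\<in>supersets E (Suc m). pdet T G)
    = \<nu> * (real k - real m) * (\<Sum>T\<in>supersets E m. pdet T G)"
proof -
  have finE: "finite E" using E finite_V finite_subset by blast
  have fin: "finite T" if "T \<in> supersets E j" for T j
    using that finite_V by (auto simp: supersets_def intro: finite_subset)
  have "(real (Suc m) - real (card E)) * (\<Sum>T\<in>supersets E (Suc m). pdet T G)
      = (\<Sum>T\<in>supersets E (Suc m). \<Sum>f\<in>T-E. pdet T G)"
  proof (subst sum_distrib_left, intro sum.cong refl)
    fix T assume T: "T \<in> supersets E (Suc m)"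
    then have "real (card (T - E)) = real (Suc m) - real (card E)"
    proof -
      have "E \<subseteq> T" "card T = Suc m" using T by (auto simp: supersets_def)
      then have "card E \<le> Suc m" "card (T - E) = Suc m - card E"
        using finE fin[OF T] by (metis card_mono, metis card_Diff_subset)
      then show ?thesis by (simp only: of_nat_diff)
    qed
    then show "(real (Suc m) - real (card E)) * pdet T G = (\<Sum>f\<in>T - E. pdet T G)"
      by (simp only: sum_constant)
  qed
  also have "\<dots> = (\<Sum>(T,f)\<in>Sigma (supersets E (Suc m)) (\<lambda>T. T - E). pdet T G)"
    by (rule sum.Sigma) (auto intro: fin)
  also have "\<dots> = (\<Sum>(T,f)\<in>Sigma (supersets E m) (\<lambda>T. V - T). pdet (insert f T) G)"
  proof (rule sum.reindex_bij_witness[where j = "\<lambda>(T,f). (T - {f}, f)" and i = "\<lambda>(T,f). (insert f T, f)"])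
    fix x assume "x \<in> Sigma (supersets E (Suc m)) (\<lambda>T. T - E)"
    then obtain T f where x: "x = (T, f)" "T \<in> supersets E (Suc m)" "f \<in> T - E" by auto
    then show "(case case x of (T, f) \<Rightarrow> (T - {f}, f) of (T, f) \<Rightarrow> (insert f T, f)) = x"
      and "(case x of (T, f) \<Rightarrow> (T - {f}, f)) \<in> Sigma (supersets E m) (\<lambda>T. V - T)"
      and "(case case x of (T, f) \<Rightarrow> (T - {f}, f) of (T, f) \<Rightarrow> pdet (insert f T) G) = (case x of (T, f) \<Rightarrow> pdet T G)"
      using fin[OF x(2)] x(2,3) unfolding x(1) by (auto simp: supersets_def insert_absorb)
  next
    fix x assume "x \<in> Sigma (supersets E m) (\<lambda>T. V - T)"
    then obtain T f where x: "x = (T, f)" "T \<in> supersets E m" "f \<in> V - T" by auto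
    then show "(case case x of (T, f) \<Rightarrow> (insert f T, f) of (T, f) \<Rightarrow> (T - {f}, f)) = x"
      and "(case x of (T, f) \<Rightarrow> (insert f T, f)) \<in> Sigma (supersets E (Suc m)) (\<lambda>T. T - E)"
      using fin[OF x(2)] x(2,3) unfolding x(1) by (auto simp: supersets_def)
  qed
  also have "\<dots> = (\<Sum>T\<in>supersets E m. \<Sum>f\<in>V-T. pdet (insert f T) G)"
    by (rule sum.Sigma[symmetric]) (auto intro: finite_V)
  also have "\<dots> = (\<Sum>T\<in>supersets E m. \<nu> * (real k - real m) * pdet T G)"
    by (intro sum.cong refl) (use sum_pdet_insert in \<open>auto simp: supersets_def\<close>)
  finally show ?thesis by (simp add: sum_distrib_left)
qed

text \<open>Apart from \<open>\<nu>\<close>, the recursion multiplies by (k - m) / (m + 1 - card E),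
  the ratio of consecutive binomial coefficients of \<open>k - card E\<close>.\<close>

lemma sum_supersets:
  assumes E: "E \<subseteq> V" and "card E \<le> m" "m \<le> k"
  shows "(\<Sum>T\<in>supersets E m. pdet T G) = \<nu> ^ (m - card E) * real ((k - card E) choose (m - card E)) * pdet E G"
  using assms(2,3)
proof (induction m rule: dec_induct)
  case base
  have fin: "finite T" if "T \<subseteq> V" for T using that finite_V finite_subset by blast
  have "supersets E (card E) = {E}"
    using E by (auto simp: supersets_def dest: card_subset_eq[OF fin])
  then show ?case by simp
next
  case (step m)
  define a where "a = card E"
  have am: "a \<le> m" "Suc m \<le> k" using step by (auto simp: a_def)
  have pos: "real (Suc m) - real a > 0" using am by simp
  have "(real (Suc m) - real a) * (\<Sum>T\<in>supersets E (Suc m). pdet T G)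
     = \<nu> * (real k - real m) * (\<nu> ^ (m - a) * real ((k - a) choose (m - a)) * pdet E G)"
    using sum_supersets_Suc[OF E, of m] step by (simp add: a_def)
  also have "\<dots> = \<nu> ^ Suc (m - a) * ((real k - real m) * real ((k - a) choose (m - a))) * pdet E G"
    by (simp only: power_Suc mult.assoc mult.left_commute)
  also have "(real k - real m) * real ((k - a) choose (m - a)) = (real (Suc m) - real a) * real ((k - a) choose Suc (m - a))"
  proof -
    have "Suc (m - a) * ((k - a) choose Suc (m - a)) = (k - a - (m - a)) * ((k - a) choose (m - a))"
      using binomial_absorb_comp[of "k - a" "m - a"] binomial_absorption[of "m - a" "k - a"] by simp
    then have "real (Suc (m - a)) * real ((k - a) choose Suc (m - a)) = real (k - a - (m - a)) * real ((k - a) choose (m - a))"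
      by (metis of_nat_mult)
    moreover have "real (Suc (m - a)) = real (Suc m) - real a" "real (k - a - (m - a)) = real k - real m"
      using am by (simp_all add: of_nat_diff)
    ultimately show ?thesis by metis
  qed
  also have "Suc (m - a) = Suc m - a"
    using am by simp
  finally have "(real (Suc m) - real a) * (\<Sum>T\<in>supersets E (Suc m). pdet T G)
     = (real (Suc m) - real a) * (\<nu> ^ (Suc m - a) * real ((k - a) choose (Suc m - a)) * pdet E G)"
    by (simp only: mult.assoc mult.left_commute)
  then show ?case using pos by (simp add: a_def)
qed

text \<open>At \<open>m = k\<close> the recursion has the factor 0, and all later sums inherit the
  zero.\<close>

lemma sum_pdet_card_gt:
  assumes "m > k"
  shows "(\<Sum>T\<in>supersets {} m. pdet T G) = 0"
  using assms
proof (induction m)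
  case (Suc m)
  have "real (Suc m) * (\<Sum>T\<in>supersets {} (Suc m). pdet T G) = \<nu> * (real k - real m) * (\<Sum>T\<in>supersets {} m. pdet T G)"
    using sum_supersets_Suc[of "{}" m] by simp
  also have "\<dots> = 0" using Suc by (cases "m = k") auto
  finally show ?case by simp
qed simp

text \<open>This is the elementary symmetric function of degree \<open>m\<close> of a spectrum in
  which \<open>\<nu>\<close> occurs \<open>k\<close> times and all else is 0.\<close>

lemma sum_pdet_card:
  "(\<Sum>T\<in>supersets {} m. pdet T G) = \<nu> ^ m * real (k choose m)"
  using sum_supersets[of "{}" m] sum_pdet_card_gt[of m] by (cases "m \<le> k") (auto simp: binomial_eq_0)

lemma pdet_card_gt:
  assumes "E \<subseteq> V" "card E > k"
  shows "pdet E G = 0"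
proof -
  have "pdet T G = 0" if "T \<in> supersets {} (card E)" for T
    using sum_pdet_card_gt[OF assms(2)] that pdet_nonneg
    by (subst (asm) sum_nonneg_eq_0_iff[OF finite_supersets]) (simp_all add: supersets_def)
  then show ?thesis using assms by (auto simp: supersets_def)
qed

definition wgt :: "'a set \<Rightarrow> real" where
  "wgt T = pdet T G / \<nu> ^ k"

text \<open>The probability that the random base contains \<open>E\<close>, as
  \<open>sum_wgt_supersets\<close> confirms: a principal minor of the kernel
  \<open>G / \<nu>\<close>.\<close>

definition incl :: "'a set \<Rightarrow> real" where
  "incl E = pdet E G / \<nu> ^ card E"

abbreviation "bases \<equiv> supersets {} k"

lemma wgt_nonneg: "T \<in> bases \<Longrightarrow> wgt T \<ge> 0"
  using pdet_nonneg \<nu>_pos by (auto simp: wgt_def supersets_def)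

lemma sum_wgt: "(\<Sum>T\<in>bases. wgt T) = 1"
  using sum_pdet_card[of k] \<nu>_pos by (simp add: wgt_def flip: sum_divide_distrib)

lemma sum_wgt_supersets:
  assumes "E \<subseteq> V"
  shows "(\<Sum>T\<in>bases. if E \<subseteq> T then wgt T else 0) = incl E"
proof -
  have "(\<Sum>T\<in>bases. if E \<subseteq> T then wgt T else 0) = (\<Sum>T\<in>supersets E k. wgt T)"
    by (rule sum.mono_neutral_cong_right) (auto simp: supersets_def finite_V)
  also have "\<dots> = incl E"
  proof (cases "card E \<le> k")
    case True
    then show ?thesis
      using sum_supersets[OF assms True] \<nu>_pos
      by (simp add: wgt_def incl_def power_diff flip: sum_divide_distrib)
  next
    case False
    have "supersets E k = {}"
    proof (rule ccontr)
      assume "supersets E k \<noteq> {}"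
      then obtain T where T: "E \<subseteq> T" "T \<subseteq> V" "card T = k" by (auto simp: supersets_def)
      then have "card E \<le> card T" using finite_V finite_subset by (intro card_mono) auto
      then show False using T False by simp
    qed
    then show ?thesis using pdet_card_gt[OF assms] False by (simp add: incl_def)
  qed
  finally show ?thesis .
qed

text \<open>Each shifted minor is expanded in powers of \<open>c\<close>, and a set \<open>F\<close>
  of size \<open>m\<close> is counted once for each of its supersets of size \<open>j\<close>. The
  case \<open>j = k\<close> yields the mean of the determinant ratio, the case
  \<open>j = card V\<close> the determinant of 1 + G.\<close>

lemma sum_pdet_add_diag:
  "(\<Sum>T\<in>supersets {} j. pdet T (\<lambda>e f. G e f + (if e = f then c else 0)))
    = (\<Sum>m\<le>j. c ^ (j - m) * real ((card V - m) choose (j - m)) * (\<nu> ^ m * real (k choose m)))"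
proof -
  have fin: "finite T" if "T \<subseteq> V" for T using that finite_V finite_subset by blast
  have "(\<Sum>T\<in>supersets {} j. pdet T (\<lambda>e f. G e f + (if e = f then c else 0)))
     = (\<Sum>T\<in>supersets {} j. \<Sum>F\<in>Pow T. c ^ card (T - F) * pdet F G)"
    by (intro sum.cong refl pdet_add_diag fin) (auto simp: supersets_def)
  also have "\<dots> = (\<Sum>T\<in>supersets {} j. \<Sum>F\<in>Pow V. if F \<subseteq> T then c ^ card (T - F) * pdet F G else 0)"
    by (intro sum.cong refl sum.mono_neutral_cong_left) (auto simp: supersets_def finite_V)
  also have "\<dots> = (\<Sum>F\<in>Pow V. \<Sum>T\<in>supersets {} j. if F \<subseteq> T then c ^ card (T - F) * pdet F G else 0)"
    by (rule sum.swap)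
  also have "\<dots> = (\<Sum>F\<in>Pow V. \<Sum>T\<in>supersets F j. c ^ (j - card F) * pdet F G)"
    by (intro sum.cong refl sum.mono_neutral_cong_right)
      (auto simp: supersets_def finite_V card_Diff_subset fin)
  also have "\<dots> = (\<Sum>F\<in>{F\<in>Pow V. card F \<le> j}. \<Sum>T\<in>supersets F j. c ^ (j - card F) * pdet F G)"
  proof (rule sum.mono_neutral_right)
    show "\<forall>F\<in>Pow V - {F \<in> Pow V. card F \<le> j}. (\<Sum>T\<in>supersets F j. c ^ (j - card F) * pdet F G) = 0"
    proof
      fix F assume F: "F \<in> Pow V - {F \<in> Pow V. card F \<le> j}"
      have "supersets F j = {}"
      proof (rule ccontr)
        assume "supersets F j \<noteq> {}"
        then obtain T where T: "F \<subseteq> T" "T \<subseteq> V" "card T = j" by (auto simp: supersets_def)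
        then have "card F \<le> card T" using fin by (intro card_mono) auto
        then show False using T F by simp
      qed
      then show "(\<Sum>T\<in>supersets F j. c ^ (j - card F) * pdet F G) = 0" by simp
    qed
  qed (auto simp: finite_V)
  also have "\<dots> = (\<Sum>F\<in>{F\<in>Pow V. card F \<le> j}. real ((card V - card F) choose (j - card F)) * c ^ (j - card F) * pdet F G)"
    by (intro sum.cong refl) (simp add: supersets_def card_supersets_of_card[OF finite_V])
  also have "\<dots> = (\<Sum>m\<le>j. \<Sum>F | F \<in> {F\<in>Pow V. card F \<le> j} \<and> card F = m.
      real ((card V - card F) choose (j - card F)) * c ^ (j - card F) * pdet F G)"
    by (rule sum.group[symmetric]) (auto simp: finite_V)
  also have "\<dots> = (\<Sum>m\<le>j. \<Sum>F\<in>supersets {} m. real ((card V - m) choose (j - m)) * c ^ (j - m) * pdet F G)"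
    by (intro sum.cong) (auto simp: supersets_def)
  also have "\<dots> = (\<Sum>m\<le>j. c ^ (j - m) * real ((card V - m) choose (j - m)) * (\<nu> ^ m * real (k choose m)))"
    by (simp only: sum_distrib_left[symmetric] sum_pdet_card mult.commute[of "c ^ _"])
  finally show ?thesis .
qed

text \<open>Otherwise there would be no bases, and their weights could not sum to 1.\<close>

lemma rank_le_card: "k \<le> card V"
proof (rule ccontr)
  assume *: "\<not> k \<le> card V"
  have "supersets {} k = {}"
    using * card_mono[OF finite_V] by (force simp: supersets_def)
  then show False using sum_wgt by simp
qed

lemma pdet_one_add: "pdet V (\<lambda>e f. G e f + (if e = f then 1 else 0)) = (1 + \<nu>) ^ k"
proof -
  have "supersets {} (card V) = {V}"
    using card_subset_eq[OF finite_V] by (auto simp: supersets_def)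
  then have "pdet V (\<lambda>e f. G e f + (if e = f then 1 else 0)) = (\<Sum>m\<le>card V. \<nu> ^ m * real (k choose m))"
    using sum_pdet_add_diag[of 1 "card V"] by simp
  also have "\<dots> = (\<Sum>m\<le>k. \<nu> ^ m * real (k choose m))"
    using rank_le_card by (intro sum.mono_neutral_right) (auto simp: binomial_eq_0)
  also have "\<dots> = (\<nu> + 1) ^ k"
    by (subst binomial_ring) (simp add: mult.commute)
  finally show ?thesis by (simp add: add.commute)
qed

end

section \<open>Spectra of Gram matrices\<close>

fun mpow :: "'a set \<Rightarrow> ('a \<Rightarrow> 'a \<Rightarrow> real) \<Rightarrow> nat \<Rightarrow> 'a \<Rightarrow> 'a \<Rightarrow> real" where
  "mpow T G 0 e f = (if e = f then 1 else 0)"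
| "mpow T G (Suc j) e f = (\<Sum>g\<in>T. G e g * mpow T G j g f)"

definition mtrace :: "'a set \<Rightarrow> ('a \<Rightarrow> 'a \<Rightarrow> real) \<Rightarrow> nat \<Rightarrow> real" where
  "mtrace T G j = (\<Sum>e\<in>T. mpow T G j e e)"

lemma sum_diag_mult_comm:
  fixes X Y :: "'b::comm_ring_1 mat"
  assumes "X \<in> carrier_mat m m" "Y \<in> carrier_mat m m"
  shows "(\<Sum>i<m. (X * Y) $$ (i, i)) = (\<Sum>i<m. (Y * X) $$ (i, i))"
proof -
  have "(\<Sum>i<m. (X * Y) $$ (i, i)) = (\<Sum>i<m. \<Sum>j<m. X $$ (i, j) * Y $$ (j, i))"
    using assms by (intro sum.cong refl) (auto simp: scalar_prod_def atLeast0LessThan)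
  also have "\<dots> = (\<Sum>j<m. \<Sum>i<m. X $$ (i, j) * Y $$ (j, i))"
    by (rule sum.swap)
  also have "\<dots> = (\<Sum>i<m. (Y * X) $$ (i, i))"
    using assms by (intro sum.cong refl) (auto simp: scalar_prod_def atLeast0LessThan mult.commute)
  finally show ?thesis .
qed

lemma sum_diag_conjugate:
  fixes B :: "'b::comm_ring_1 mat"
  assumes "B \<in> carrier_mat m m" "P \<in> carrier_mat m m" "Q \<in> carrier_mat m m" "Q * P = 1\<^sub>m m"
  shows "(\<Sum>i<m. (P * B * Q) $$ (i, i)) = (\<Sum>i<m. B $$ (i, i))"
proof -
  have "(\<Sum>i<m. (P * B * Q) $$ (i, i)) = (\<Sum>i<m. (Q * (P * B)) $$ (i, i))"
    using assms by (intro sum_diag_mult_comm) auto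
  also have "Q * (P * B) = B"
    using assms by (simp flip: assoc_mult_mat[of Q m m P m B m])
  finally show ?thesis .
qed

lemma upper_triangular_mult_diag:
  fixes X Y :: "'b::comm_ring_1 mat"
  assumes X: "X \<in> carrier_mat m m" and Y: "Y \<in> carrier_mat m m"
    and "upper_triangular X" "upper_triangular Y"
  shows "upper_triangular (X * Y)" "i < m \<Longrightarrow> (X * Y) $$ (i, i) = X $$ (i, i) * Y $$ (i, i)"
proof -
  have entry: "(X * Y) $$ (i, l) = (\<Sum>j<m. X $$ (i, j) * Y $$ (j, l))" if "i < m" "l < m" for i l
    using X Y that by (auto simp: scalar_prod_def atLeast0LessThan)
  have zX: "X $$ (i, j) = 0" if "j < i" "i < m" for i j using assms that by auto
  have zY: "Y $$ (i, j) = 0" if "j < i" "i < m" for i j using assms that by auto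
  show "upper_triangular (X * Y)"
  proof (intro upper_triangularI)
    fix i l assume "l < i" "i < dim_row (X * Y)"
    then have il: "l < i" "i < m" using X by auto
    have "X $$ (i, j) * Y $$ (j, l) = 0" if "j < m" for j
      using zX[of j i] zY[of l j] il that by (cases "j < i") auto
    then show "(X * Y) $$ (i, l) = 0" using entry[of i l] il by simp
  qed
  show "(X * Y) $$ (i, i) = X $$ (i, i) * Y $$ (i, i)" if i: "i < m"
  proof -
    have "X $$ (i, j) * Y $$ (j, i) = 0" if "j < m" "j \<noteq> i" for j
      using zX[of j i] zY[of i j] i that by (cases "j < i") auto
    then have "(\<Sum>j<m. X $$ (i, j) * Y $$ (j, i)) = (\<Sum>j\<in>{i}. X $$ (i, j) * Y $$ (j, i))"
      using i by (intro sum.mono_neutral_right) auto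
    then show ?thesis using entry i by simp
  qed
qed

lemma upper_triangular_pow_diag:
  fixes X :: "'b::comm_ring_1 mat"
  assumes X: "X \<in> carrier_mat m m" and "upper_triangular X"
  shows "upper_triangular (X ^\<^sub>m j) \<and> (\<forall>i<m. (X ^\<^sub>m j) $$ (i, i) = (X $$ (i, i)) ^ j)"
proof (induction j)
  case 0
  then show ?case using X by (auto intro!: upper_triangularI)
next
  case (Suc j)
  have c: "X ^\<^sub>m j \<in> carrier_mat m m" using X by simp
  show ?case
    using upper_triangular_mult_diag[OF c X _ assms(2)] Suc by (simp add: mult.commute)
qed

lemma pow_mat_Suc_left:
  fixes X :: "'b::comm_ring_1 mat"
  assumes X: "X \<in> carrier_mat m m"
  shows "X ^\<^sub>m Suc j = X * X ^\<^sub>m j"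
proof (induction j)
  case 0
  then show ?case using X by simp
next
  case (Suc j)
  have "X ^\<^sub>m Suc (Suc j) = X * X ^\<^sub>m j * X" using Suc by simp
  also have "\<dots> = X * (X ^\<^sub>m j * X)"
    using X by (intro assoc_mult_mat[of _ m m _ m _ m]) auto
  finally show ?case by simp
qed

text \<open>Schur triangularization over the complex numbers: shifted determinants and traces of
  powers are read off the diagonal of the triangular form. For an eigenvector the factorization of
  \<open>G\<close> writes the eigenvalue times the squared norm as a sum of squared moduli, so it is
  real and non-negative.\<close>

lemma gram_spectrum:
  fixes G :: "'a \<Rightarrow> 'a \<Rightarrow> real" and b :: "'r \<Rightarrow> 'a \<Rightarrow> real"
  assumes T: "finite T" and R: "finite R"
    and gram: "\<And>e f. e \<in> T \<Longrightarrow> f \<in> T \<Longrightarrow> G e f = (\<Sum>r\<in>R. b r e * b r f)"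
  obtains lam :: "nat \<Rightarrow> real" where
    "\<And>i. i < card T \<Longrightarrow> lam i \<ge> 0"
    "\<And>c. pdet T (\<lambda>e f. G e f + (if e = f then c else 0)) = (\<Prod>i<card T. lam i + c)"
    "\<And>j. mtrace T G j = (\<Sum>i<card T. lam i ^ j)"
proof -
  define m where "m = card T"
  obtain f where f: "bij_betw f {0..<m} T"
    using ex_bij_betw_nat_finite[OF T] by (auto simp: m_def)
  then have fT: "f i \<in> T" if "i < m" for i using that by (auto simp: bij_betw_def)
  have f_eq: "f i = f l \<longleftrightarrow> i = l" if "i < m" "l < m" for i l
    using f that by (auto simp: bij_betw_def inj_on_def)
  have sumT: "(\<Sum>e\<in>T. h e) = (\<Sum>i<m. h (f i))" for h :: "'a \<Rightarrow> 'c::comm_monoid_add"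
    using sum.reindex_bij_betw[OF f, of h] by (simp add: atLeast0LessThan)
  define A where "A = mat m m (\<lambda>(i, l). complex_of_real (G (f i) (f l)))"
  have A: "A \<in> carrier_mat m m" by (simp add: A_def)
  obtain es where es: "char_poly A = (\<Prod>a\<leftarrow>es. [:- a, 1:])" "length es = m"
    using char_poly_factorized[OF A] by blast
  obtain B P Q where "schur_decomposition A es = (B, P, Q)" by (metis prod_cases3)
  from schur_decomposition[OF A es(1) this]
  have wit: "similar_mat_wit A B P Q" and ut: "upper_triangular B" and diag: "diag_mat B = es" by auto
  note PQ = similar_mat_witD2[OF A wit]
  have Bii: "B $$ (i, i) = es ! i" if "i < m" for i
    using that PQ(5) unfolding diag[symmetric] by (simp add: diag_mat_def)

  have nonneg: "es ! i = of_real (Re (es ! i)) \<and> Re (es ! i) \<ge> 0" if i: "i < m" for i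
  proof -
    define l where "l = es ! i"
    have "poly (char_poly A) l = 0"
      unfolding es(1) poly_prod_list using i es(2) by (force simp: l_def prod_list_zero_iff)
    then have "eigenvalue A l" using eigenvalue_root_char_poly[OF A] by simp
    then obtain v where v: "v \<in> carrier_vec m" "v \<noteq> 0\<^sub>v m" "A *\<^sub>v v = l \<cdot>\<^sub>v v"
      unfolding eigenvalue_def eigenvector_def using A by auto
    define S where "S = (\<Sum>i<m. (cmod (v $ i))\<^sup>2)"
    \<comment> \<open>The pairing of row \<open>r\<close> of the factor \<open>b\<close> with the
      eigenvector; the quadratic form of \<open>G\<close> at \<open>v\<close> is the sum of the
      squared moduli of these numbers.\<close>
    define w where "w r = (\<Sum>j<m. of_real (b r (f j)) * v $ j)" for r
    have "S \<noteq> 0"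
    proof
      assume "S = 0"
      then have "\<forall>i<m. v $ i = 0" unfolding S_def by (subst (asm) sum_nonneg_eq_0_iff) auto
      then have "v = 0\<^sub>v m" using v(1) by (intro eq_vecI) auto
      with v(2) show False by simp
    qed
    then have "S > 0" unfolding S_def by (simp add: less_le sum_nonneg)
    have Av: "(\<Sum>j<m. of_real (G (f i) (f j)) * v $ j) = l * v $ i" if "i < m" for i
    proof -
      have "(A *\<^sub>v v) $ i = (\<Sum>j<m. of_real (G (f i) (f j)) * v $ j)"
        using that A v(1) by (simp add: A_def scalar_prod_def atLeast0LessThan)
      then show ?thesis using v that by simp
    qed
    have "l * of_real S = (\<Sum>i<m. cnj (v $ i) * (l * v $ i))"
      unfolding S_def of_real_sum sum_distrib_left
      by (intro sum.cong refl) (simp add: complex_norm_square mult_ac del: of_real_power)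
    also have "\<dots> = (\<Sum>i<m. cnj (v $ i) * (\<Sum>j<m. of_real (G (f i) (f j)) * v $ j))"
      using Av by simp
    also have "\<dots> = (\<Sum>i<m. cnj (v $ i) * (\<Sum>j<m. (\<Sum>r\<in>R. of_real (b r (f i)) * of_real (b r (f j))) * v $ j))"
      using gram fT by (intro sum.cong refl arg_cong2[where f="(*)"]) simp
    also have "\<dots> = (\<Sum>i<m. \<Sum>j<m. \<Sum>r\<in>R. (of_real (b r (f i)) * cnj (v $ i)) * (of_real (b r (f j)) * v $ j))"
      by (simp add: sum_distrib_left sum_distrib_right mult_ac)
    also have "\<dots> = (\<Sum>r\<in>R. \<Sum>i<m. \<Sum>j<m. (of_real (b r (f i)) * cnj (v $ i)) * (of_real (b r (f j)) * v $ j))"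
    proof -
      have "(\<Sum>i<m. \<Sum>j<m. \<Sum>r\<in>R. (of_real (b r (f i)) * cnj (v $ i)) * (of_real (b r (f j)) * v $ j))
        = (\<Sum>i<m. \<Sum>r\<in>R. \<Sum>j<m. (of_real (b r (f i)) * cnj (v $ i)) * (of_real (b r (f j)) * v $ j))"
        by (intro sum.cong refl sum.swap)
      also have "\<dots> = (\<Sum>r\<in>R. \<Sum>i<m. \<Sum>j<m. (of_real (b r (f i)) * cnj (v $ i)) * (of_real (b r (f j)) * v $ j))"
        by (rule sum.swap)
      finally show ?thesis .
    qed
    also have "\<dots> = (\<Sum>r\<in>R. cnj (w r) * w r)"
      unfolding w_def by (simp add: sum_product)
    also have "\<dots> = of_real (\<Sum>r\<in>R. (cmod (w r))\<^sup>2)"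
      unfolding of_real_sum by (intro sum.cong refl) (simp add: complex_norm_square mult.commute del: of_real_power)
    finally have "l = of_real ((\<Sum>r\<in>R. (cmod (w r))\<^sup>2) / S)"
      using \<open>S > 0\<close> by (simp add: field_simps)
    moreover have "(\<Sum>r\<in>R. (cmod (w r))\<^sup>2) / S \<ge> 0"
      using \<open>S > 0\<close> by (intro divide_nonneg_pos sum_nonneg) auto
    ultimately show ?thesis unfolding l_def[symmetric] by simp
  qed

  define lam where "lam i = Re (es ! i)" for i
  have es_lam: "es ! i = of_real (lam i)" if "i < m" for i using nonneg that by (simp add: lam_def)
  show ?thesis
  proof (rule that[of lam])
    show "lam i \<ge> 0" if "i < card T" for i using nonneg that by (simp add: lam_def m_def)
  next
    fix c :: real
    \<comment> \<open>A scalar matrix is unchanged by the triangularizing similarity, which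
      therefore carries \<open>B + C\<close> to \<open>A + C\<close>.\<close>
    define C where "C = complex_of_real c \<cdot>\<^sub>m 1\<^sub>m m"
    have C: "C \<in> carrier_mat m m" by (simp add: C_def)
    have PCQ: "P * C * Q = C"
      using PQ by (simp add: C_def mult_smult_distrib[of _ m m _ m] mult_smult_assoc_mat[of _ m m _ m])
    have "P * (B + C) * Q = A + C"
      using PQ C PCQ by (simp add: mult_add_distrib_mat[of _ m m _ m] add_mult_distrib_mat[of _ m m _ _ m])
    then have "det (A + C) = det P * det (B + C) * det Q"
      using PQ C by (metis det_mult mult_carrier_mat add_carrier_mat)
    also have "\<dots> = det (P * Q) * det (B + C)"
      unfolding det_mult[OF PQ(6,7)] by (simp add: mult_ac)
    also have "\<dots> = det (B + C)" using PQ by simp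
    also have "\<dots> = prod_list (diag_mat (B + C))"
    proof (rule det_upper_triangular)
      show "upper_triangular (B + C)"
        using ut PQ C by (intro upper_triangularI) (auto simp: C_def)
    qed (use PQ C in auto)
    also have "\<dots> = (\<Prod>i\<in>{0..<m}. (B + C) $$ (i, i))"
      using C prod.distinct_set_conv_list[of "[0..<m]" "\<lambda>i. (B + C) $$ (i, i)"]
      by (simp add: diag_mat_def)
    also have "\<dots> = (\<Prod>i<m. es ! i + of_real c)"
      using PQ C Bii by (intro prod.cong) (auto simp: C_def)
    also have "\<dots> = of_real (\<Prod>i<m. lam i + c)" using es_lam by simp
    finally have "det (A + C) = of_real (\<Prod>i<m. lam i + c)" .
    moreover have "complex_of_real (pdet T (\<lambda>e f. G e f + (if e = f then c else 0))) = det (A + C)"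
    proof -
      have "T = f ` {0..<m}" using f by (simp add: bij_betw_def)
      then have "pdet T (\<lambda>e f. G e f + (if e = f then c else 0)) =
         pdet {0..<m} (\<lambda>i l. G (f i) (f l) + (if f i = f l then c else 0))"
        using f by (simp add: pdet_image bij_betw_def)
      also have "of_real \<dots> = pdet {0..<m} (\<lambda>i l. complex_of_real (G (f i) (f l) + (if f i = f l then c else 0)))"
        by (rule pdet_of_real[symmetric])
      also have "\<dots> = det (A + C)"
        unfolding pdet_eq_det using f_eq
        by (intro arg_cong[where f=det] eq_matI) (auto simp: A_def C_def)
      finally show ?thesis .
    qed
    ultimately have "complex_of_real (pdet T (\<lambda>e f. G e f + (if e = f then c else 0))) = of_real (\<Prod>i<m. lam i + c)"
      by simp
    then show "pdet T (\<lambda>e f. G e f + (if e = f then c else 0)) = (\<Prod>i<card T. lam i + c)"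
      unfolding of_real_eq_iff m_def .
  next
    fix j
    have entry: "(A ^\<^sub>m j) $$ (i, l) = of_real (mpow T G j (f i) (f l))" if "i < m" "l < m" for i l
      using that
    proof (induction j arbitrary: i l)
      case 0
      then show ?case using A f_eq by simp
    next
      case (Suc j)
      have "(A ^\<^sub>m Suc j) $$ (i, l) = (A * A ^\<^sub>m j) $$ (i, l)"
        using pow_mat_Suc_left[OF A] by simp
      also have "\<dots> = (\<Sum>g<m. A $$ (i, g) * (A ^\<^sub>m j) $$ (g, l))"
        using Suc.prems A by (simp add: scalar_prod_def atLeast0LessThan pow_carrier_mat[OF A, THEN carrier_matD(1)] pow_carrier_mat[OF A, THEN carrier_matD(2)])
      also have "\<dots> = (\<Sum>g<m. of_real (G (f i) (f g) * mpow T G j (f g) (f l)))"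
        using Suc by (intro sum.cong refl) (simp add: A_def)
      finally show ?case by (simp add: sumT)
    qed
    have "complex_of_real (mtrace T G j) = (\<Sum>i<m. (A ^\<^sub>m j) $$ (i, i))"
      by (simp add: mtrace_def sumT entry)
    also have "A ^\<^sub>m j = P * B ^\<^sub>m j * Q"
      by (rule similar_mat_wit_pow_id[OF wit])
    also have "(\<Sum>i<m. (P * B ^\<^sub>m j * Q) $$ (i, i)) = (\<Sum>i<m. (B ^\<^sub>m j) $$ (i, i))"
      using PQ by (intro sum_diag_conjugate) auto
    also have "\<dots> = (\<Sum>i<m. of_real (lam i ^ j))"
      using upper_triangular_pow_diag[OF PQ(5) ut, of j] Bii es_lam by simp
    finally have "complex_of_real (mtrace T G j) = of_real (\<Sum>i<m. lam i ^ j)" by simp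
    then show "mtrace T G j = (\<Sum>i<card T. lam i ^ j)" unfolding of_real_eq_iff m_def .
  qed
qed

section \<open>The up- and down-Laplacian of the full simplex\<close>

definition vertex_sign :: "nat set \<Rightarrow> nat \<Rightarrow> int" where
  "vertex_sign t v = (-1) ^ card {w \<in> t. w < v}"

text \<open>The coefficient of \<open>s\<close> in the boundary of \<open>t\<close>, see
  \<open>lookup_simplex_boundary\<close>; at most one summand is nonzero.\<close>

definition incidence :: "nat set \<Rightarrow> nat set \<Rightarrow> int" where
  "incidence s t = (\<Sum>v\<in>t. if s = t - {v} then vertex_sign t v else 0)"

text \<open>The inner product of the boundaries of \<open>e\<close> and \<open>f\<close>. Only faces
  of \<open>e\<close> have nonzero incidence with \<open>e\<close>, so the sum over
  \<open>Pow e\<close> is complete, and the value does not refer to \<open>n\<close>. This makes it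
  an invariant of the order type of the pair.\<close>

definition gram :: "nat set \<Rightarrow> nat set \<Rightarrow> int" where
  "gram e f = (\<Sum>s\<in>Pow e. incidence s e * incidence s f)"

definition nsub :: "'a set \<Rightarrow> nat \<Rightarrow> 'a set set" where
  "nsub A m = {e. e \<subseteq> A \<and> card e = m}"

abbreviation rgram :: "nat set \<Rightarrow> nat set \<Rightarrow> real" where
  "rgram e f \<equiv> of_int (gram e f)"

lemma finite_nsub [simp]: "finite A \<Longrightarrow> finite (nsub A m)"
  by (simp add: nsub_def)

lemma nsub_finite: "finite A \<Longrightarrow> e \<in> nsub A m \<Longrightarrow> finite e"
  by (auto simp: nsub_def intro: finite_subset)

lemma card_nsub: "finite A \<Longrightarrow> card (nsub A m) = card A choose m"
  by (simp add: nsub_def n_subsets)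

lemma vertex_sign_square [simp]: "vertex_sign t v * vertex_sign t v = 1"
  by (simp add: vertex_sign_def flip: power_mult_distrib)

lemma abs_vertex_sign [simp]: "\<bar>vertex_sign t v\<bar> = 1"
  by (simp add: vertex_sign_def power_abs)

lemma lookup_simplex_boundary:
  "Poly_Mapping.lookup (simplex_boundary t) s = incidence s t"
proof -
  have "Poly_Mapping.lookup (\<Sum>v\<in>A. F v) s = (\<Sum>v\<in>A. Poly_Mapping.lookup (F v) s)"
    for F :: "nat \<Rightarrow> nat set \<Rightarrow>\<^sub>0 int" and A
    by (rule lookup_sum)
  then show ?thesis
    unfolding simplex_boundary_def incidence_def
    by (simp, intro sum.cong) (auto simp: vertex_sign_def lookup_single when_def)
qed

lemma incidence_Diff: "finite t \<Longrightarrow> v \<in> t \<Longrightarrow> incidence (t - {v}) t = vertex_sign t v"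
proof -
  assume t: "finite t" "v \<in> t"
  have "incidence (t - {v}) t = (\<Sum>w\<in>{v}. if t - {v} = t - {w} then vertex_sign t w else 0)"
    unfolding incidence_def using t by (intro sum.mono_neutral_right) auto
  then show ?thesis by simp
qed

lemma incidence_eq_0: "(\<And>v. v \<in> t \<Longrightarrow> s \<noteq> t - {v}) \<Longrightarrow> incidence s t = 0"
  by (simp add: incidence_def)

lemma incidence_nonzeroD: "incidence s t \<noteq> 0 \<Longrightarrow> \<exists>v\<in>t. s = t - {v}"
  using incidence_eq_0 by blast

lemma sum_incidence:
  assumes "finite R" "\<And>v. v \<in> t \<Longrightarrow> t - {v} \<in> R"
  shows "(\<Sum>s\<in>R. incidence s t * \<phi> s) = (\<Sum>v\<in>t. vertex_sign t v * \<phi> (t - {v}))"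
proof -
  have "(\<Sum>s\<in>R. incidence s t * \<phi> s) = (\<Sum>s\<in>R. \<Sum>v\<in>t. if s = t - {v} then vertex_sign t v * \<phi> s else 0)"
    by (simp add: incidence_def sum_distrib_right if_distrib[of "\<lambda>x. x * _"] cong: if_cong)
  also have "\<dots> = (\<Sum>v\<in>t. \<Sum>s\<in>R. if s = t - {v} then vertex_sign t v * \<phi> s else 0)"
    by (rule sum.swap)
  also have "\<dots> = (\<Sum>v\<in>t. vertex_sign t v * \<phi> (t - {v}))"
    using assms by (intro sum.cong refl) (simp add: sum.delta)
  finally show ?thesis .
qed

lemma gram_eq: "finite e \<Longrightarrow> gram e f = (\<Sum>v\<in>e. vertex_sign e v * incidence (e - {v}) f)"
  unfolding gram_def by (rule sum_incidence[where \<phi> = "\<lambda>s. incidence s f"]) auto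

lemma gram_eq_sum:
  assumes "finite R" "finite e" "\<And>v. v \<in> e \<Longrightarrow> e - {v} \<in> R"
  shows "gram e f = (\<Sum>s\<in>R. incidence s e * incidence s f)"
  unfolding gram_eq[OF assms(2)] by (rule sum_incidence[OF assms(1,3), where \<phi> = "\<lambda>s. incidence s f", symmetric])

lemma gram_nonzeroD:
  assumes "gram e f \<noteq> 0"
  obtains v w where "v \<in> e" "w \<in> f" "e - {v} = f - {w}"
proof -
  from assms obtain s where "incidence s e * incidence s f \<noteq> 0" unfolding gram_def by (rule sum.not_neutral_contains_not_neutral)
  then show ?thesis using incidence_nonzeroD[of s e] incidence_nonzeroD[of s f] that by auto
qed

lemma gram_self: "finite e \<Longrightarrow> gram e e = int (card e)"
  by (simp add: gram_eq incidence_Diff)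

lemma abs_incidence_le: "finite t \<Longrightarrow> \<bar>incidence s t\<bar> \<le> 1"
  by (cases "incidence s t = 0") (auto dest!: incidence_nonzeroD simp: incidence_Diff)

lemma abs_gram_le:
  assumes "finite e" "finite f"
  shows "\<bar>gram e f\<bar> \<le> int (card e)"
proof -
  have "\<bar>gram e f\<bar> \<le> (\<Sum>v\<in>e. \<bar>vertex_sign e v * incidence (e - {v}) f\<bar>)"
    unfolding gram_eq[OF assms(1)] by (rule sum_abs)
  also have "\<dots> \<le> (\<Sum>v\<in>e. 1)"
    using abs_incidence_le[OF assms(2)] by (intro sum_mono) (simp add: abs_mult)
  finally show ?thesis by simp
qed

text \<open>The sign only counts predecessors, so increasing relabelling preserves it;
  \<open>incidence\<close> and \<open>gram\<close> inherit this.\<close>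

lemma vertex_sign_image:
  assumes "strict_mono_on t h" "v \<in> t"
  shows "vertex_sign (h ` t) (h v) = vertex_sign t v"
proof -
  have "inj_on h t" using assms(1) by (rule strict_mono_on_imp_inj_on)
  moreover have "{w \<in> h ` t. w < h v} = h ` {w \<in> t. w < v}"
    using assms by (auto simp: strict_mono_on_less)
  ultimately show ?thesis
    by (simp add: vertex_sign_def card_image inj_on_subset)
qed

lemma incidence_image:
  assumes "strict_mono_on A h" "s \<subseteq> A" "t \<subseteq> A"
  shows "incidence (h ` s) (h ` t) = incidence s t"
proof -
  have inj: "inj_on h A" using assms(1) by (rule strict_mono_on_imp_inj_on)
  then have injt: "inj_on h t" using assms(3) inj_on_subset by blast
  have "incidence (h ` s) (h ` t) = (\<Sum>v\<in>t. if h ` s = h ` t - {h v} then vertex_sign (h ` t) (h v) else 0)"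
    unfolding incidence_def using injt by (simp add: sum.reindex)
  also have "\<dots> = incidence s t"
    unfolding incidence_def
  proof (rule sum.cong[OF refl])
    fix v assume v: "v \<in> t"
    have "h ` t - {h v} = h ` (t - {v})"
      using inj_on_image_set_diff[OF inj, of t "{v}"] v assms(3) by auto
    then have "h ` s = h ` t - {h v} \<longleftrightarrow> s = t - {v}"
      using inj_on_image_eq_iff[OF inj, of s "t - {v}"] assms by auto
    moreover have "vertex_sign (h ` t) (h v) = vertex_sign t v"
      using assms v by (intro vertex_sign_image) (auto intro: monotone_on_subset)
    ultimately show "(if h ` s = h ` t - {h v} then vertex_sign (h ` t) (h v) else 0) = (if s = t - {v} then vertex_sign t v else 0)"
      by simp
  qed
  finally show ?thesis .
qed

lemma gram_image:
  assumes "finite A" "strict_mono_on A h" "e \<subseteq> A" "f \<subseteq> A"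
  shows "gram (h ` e) (h ` f) = gram e f"
proof -
  have inj: "inj_on h A" using assms(2) by (rule strict_mono_on_imp_inj_on)
  have fin: "finite e" using assms finite_subset by blast
  have inje: "inj_on h e" using inj assms(3) inj_on_subset by blast
  have "gram (h ` e) (h ` f) = (\<Sum>v\<in>e. vertex_sign (h ` e) (h v) * incidence (h ` e - {h v}) (h ` f))"
    using fin inje by (simp add: gram_eq sum.reindex)
  also have "\<dots> = (\<Sum>v\<in>e. vertex_sign e v * incidence (e - {v}) f)"
  proof (intro sum.cong refl arg_cong2[where f="(*)"])
    fix v assume v: "v \<in> e"
    show "vertex_sign (h ` e) (h v) = vertex_sign e v"
      using assms v by (intro vertex_sign_image) (auto intro: monotone_on_subset)
    have "h ` e - {h v} = h ` (e - {v})"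
      using inj_on_image_set_diff[OF inj, of e "{v}"] v assms(3) by auto
    then show "incidence (h ` e - {h v}) (h ` f) = incidence (e - {v}) f"
      using assms v by (auto intro!: incidence_image)
  qed
  finally show ?thesis using fin by (simp add: gram_eq)
qed

section \<open>The Laplacian identity of the complete complex\<close>

lemma vertex_sign_Diff:
  assumes "finite t" "a \<in> t" "b \<in> t" "a < b"
  shows "vertex_sign (t - {b}) a = vertex_sign t a" "vertex_sign (t - {a}) b = - vertex_sign t b"
proof -
  have "{w \<in> t - {b}. w < a} = {w \<in> t. w < a}" using assms(4) by (intro Collect_cong) auto
  then show "vertex_sign (t - {b}) a = vertex_sign t a" by (simp add: vertex_sign_def)
  have "{w \<in> t. w < b} = insert a {w \<in> t - {a}. w < b}" using assms(2,4) by blast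
  moreover have "finite {w \<in> t - {a}. w < b}" "a \<notin> {w \<in> t - {a}. w < b}" using assms(1) by simp_all
  ultimately have "card {w \<in> t. w < b} = Suc (card {w \<in> t - {a}. w < b})" by simp
  then show "vertex_sign (t - {a}) b = - vertex_sign t b" by (simp add: vertex_sign_def)
qed

text \<open>The sign rule behind the vanishing double boundary: deleting the smaller of two vertices
  shifts the position of the larger by one, deleting the larger leaves the smaller in place.\<close>

lemma vertex_sign_Diff_cancel:
  assumes "finite t" "a \<in> t" "b \<in> t" "a \<noteq> b"
  shows "vertex_sign (t - {a}) b * vertex_sign (t - {b}) a + vertex_sign t a * vertex_sign t b = 0"
proof (cases "a < b")
  case True
  then show ?thesis using vertex_sign_Diff[of t a b] assms by simp
next
  case False
  then show ?thesis using vertex_sign_Diff[of t b a] assms by simp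
qed

text \<open>On the diagonal one counts the \<open>card e\<close> facets of \<open>e\<close> and its
  \<open>card A - card e\<close> cofaces. Off the diagonal both terms vanish unless \<open>e\<close>
  and \<open>f\<close> share a facet; then they have exactly one common coface,
  \<open>e \<union> f\<close>, and the two products of signs cancel.\<close>

lemma laplacian:
  assumes A: "finite A" and e: "e \<in> nsub A (Suc d)" and f: "f \<in> nsub A (Suc d)"
  shows "gram e f + (\<Sum>u\<in>nsub A (Suc (Suc d)). incidence e u * incidence f u) = (if e = f then int (card A) else 0)"
proof -
  have fin: "finite e" "finite f" using A e f nsub_finite by blast+
  have sub: "e \<subseteq> A" "f \<subseteq> A" "card e = Suc d" "card f = Suc d" using e f by (auto simp: nsub_def)
  show ?thesis
  proof (cases "e = f")
    case True
    have "(\<Sum>u\<in>nsub A (Suc (Suc d)). incidence e u * incidence f u) = (\<Sum>u\<in>(\<lambda>v. insert v e) ` (A - e). 1)"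
    proof (rule sum.mono_neutral_cong_right)
      show "(\<lambda>v. insert v e) ` (A - e) \<subseteq> nsub A (Suc (Suc d))"
        using sub fin by (auto simp: nsub_def)
      show "\<forall>u\<in>nsub A (Suc (Suc d)) - (\<lambda>v. insert v e) ` (A - e). incidence e u * incidence f u = 0"
      proof
        fix u assume u: "u \<in> nsub A (Suc (Suc d)) - (\<lambda>v. insert v e) ` (A - e)"
        have "incidence e u = 0"
        proof (rule ccontr)
          assume "incidence e u \<noteq> 0"
          then obtain v where "v \<in> u" "e = u - {v}" using incidence_nonzeroD by blast
          then have "u = insert v e" "v \<in> A - e" using u by (auto simp: nsub_def)
          then show False using u by blast
        qed
        then show "incidence e u * incidence f u = 0" by simp
      qed
      fix u assume "u \<in> (\<lambda>v. insert v e) ` (A - e)"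
      then obtain v where v: "v \<in> A - e" "u = insert v e" by blast
      then have "e = u - {v}" by auto
      then show "incidence e u * incidence f u = 1" using incidence_Diff[of u v] v fin True by simp
    qed (use A in auto)
    also have "\<dots> = int (card (A - e))"
      by (subst sum.reindex) (auto simp: inj_on_def)
    also have "\<dots> = int (card A) - int (card e)"
      using card_Diff_subset[OF fin(1) sub(1)] card_mono[OF A sub(1)] by (simp add: of_nat_diff)
    finally show ?thesis using True fin by (simp add: gram_self)
  next
    case False
    show ?thesis
    proof (cases "\<exists>a\<in>f. \<exists>b\<in>e. e - {b} = f - {a}")
      case False2: False
      have "gram e f = 0" by (rule ccontr, elim gram_nonzeroD) (use False2 in blast)
      moreover have "incidence e u * incidence f u = 0" if "u \<in> nsub A (Suc (Suc d))" for u
      proof (rule ccontr)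
        assume "incidence e u * incidence f u \<noteq> 0"
        then obtain a b where "a \<in> u" "e = u - {a}" "b \<in> u" "f = u - {b}"
          using incidence_nonzeroD[of e u] incidence_nonzeroD[of f u] by auto
        moreover from this have "a \<noteq> b" using False by auto
        ultimately have "a \<in> f" "b \<in> e" "e - {b} = f - {a}" by auto
        then show False using False2 by blast
      qed
      ultimately show ?thesis using False by simp
    next
      case True
      then obtain a b where ab: "a \<in> f" "b \<in> e" "e - {b} = f - {a}" by blast
      have anb: "a \<noteq> b" "a \<notin> e" "b \<notin> f" using ab False by blast+
      define u where "u = insert a e"
      have u: "finite u" "a \<in> u" "b \<in> u" "e = u - {a}" "f = u - {b}"
        using ab anb fin by (auto simp: u_def)
      \<comment> \<open>Every other facet of \<open>e\<close> still contains \<open>b\<close>, which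
        is not a vertex of \<open>f\<close>.\<close>
      have "gram e f = (\<Sum>v\<in>{b}. vertex_sign e v * incidence (e - {v}) f)"
        unfolding gram_eq[OF fin(1)]
      proof (rule sum.mono_neutral_right)
        show "\<forall>v\<in>e - {b}. vertex_sign e v * incidence (e - {v}) f = 0"
        proof
          fix v assume v: "v \<in> e - {b}"
          have "b \<in> e - {v}" using v ab by auto
          then have "incidence (e - {v}) f = 0" using anb by (intro incidence_eq_0) auto
          then show "vertex_sign e v * incidence (e - {v}) f = 0" by simp
        qed
      qed (use fin ab in auto)
      also have "\<dots> = vertex_sign e b * vertex_sign f a"
        using incidence_Diff[OF fin(2) ab(1)] ab(3) by simp
      finally have 1: "gram e f = vertex_sign (u - {a}) b * vertex_sign (u - {b}) a"
        using u by simp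
      have "(\<Sum>u'\<in>nsub A (Suc (Suc d)). incidence e u' * incidence f u') = (\<Sum>u'\<in>{u}. incidence e u' * incidence f u')"
      proof (rule sum.mono_neutral_right)
        show "{u} \<subseteq> nsub A (Suc (Suc d))"
          using sub ab anb fin by (auto simp: u_def nsub_def)
        show "\<forall>u'\<in>nsub A (Suc (Suc d)) - {u}. incidence e u' * incidence f u' = 0"
        proof
          fix u' assume u': "u' \<in> nsub A (Suc (Suc d)) - {u}"
          show "incidence e u' * incidence f u' = 0"
          proof (rule ccontr)
            assume "incidence e u' * incidence f u' \<noteq> 0"
            then obtain a' b' where *: "a' \<in> u'" "e = u' - {a'}" "b' \<in> u'" "f = u' - {b'}"
              using incidence_nonzeroD[of e u'] incidence_nonzeroD[of f u'] by auto
            moreover from this have "a' \<noteq> b'" using False by auto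
            ultimately have "u' = e \<union> f" by auto
            moreover have "u = e \<union> f" using u anb ab by auto
            ultimately show False using u' by blast
          qed
        qed
      qed (use A in auto)
      also have "\<dots> = vertex_sign u a * vertex_sign u b"
        using incidence_Diff[OF u(1,2)] incidence_Diff[OF u(1,3)] u(4,5) by simp
      finally show ?thesis using 1 vertex_sign_Diff_cancel[OF u(1,2,3) anb(1)] False by simp
    qed
  qed
qed

lemma incidence_incidence:
  assumes "finite u" "finite R" "\<And>v. v \<in> u \<Longrightarrow> u - {v} \<in> R"
  shows "(\<Sum>g\<in>R. incidence s g * incidence g u) = 0"
proof -
  have lk: "Poly_Mapping.lookup (\<Sum>v\<in>B. F v) s = (\<Sum>v\<in>B. Poly_Mapping.lookup (F v) s)"
    for F :: "nat \<Rightarrow> nat set \<Rightarrow>\<^sub>0 int" and B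
    by (rule lookup_sum)
  have "frag_extend simplex_boundary (simplex_boundary u)
     = (\<Sum>v\<in>u. frag_cmul (vertex_sign u v) (simplex_boundary (u - {v})))"
    using assms(1) unfolding simplex_boundary_def[of u] vertex_sign_def
    by (simp add: frag_extend_sum frag_extend_cmul)
  then have "(\<Sum>v\<in>u. frag_cmul (vertex_sign u v) (simplex_boundary (u - {v}))) = 0"
    using simplicial_boundary_boundary[OF assms(1)] by simp
  then have "(\<Sum>v\<in>u. vertex_sign u v * incidence s (u - {v})) = 0"
    using lk[of "\<lambda>v. frag_cmul (vertex_sign u v) (simplex_boundary (u - {v}))" u]
    by (simp add: lookup_simplex_boundary)
  then show ?thesis
    using sum_incidence[OF assms(2,3), where \<phi> = "\<lambda>g. incidence s g"] by (simp add: mult.commute)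
qed

lemma Diff_in_nsub: "e \<in> nsub A (Suc d) \<Longrightarrow> v \<in> e \<Longrightarrow> e - {v} \<in> nsub A d"
  by (auto simp: nsub_def card_Diff_singleton)

text \<open>The Laplacian identity replaces \<open>gram\<close> by \<open>card A\<close> times the
  identity minus the up-part, and the up-part followed by the boundary is a double boundary, hence
  zero. \<open>gram_square\<close> follows by one more factor.\<close>

lemma sum_gram_incidence:
  assumes A: "finite A" and e: "e \<in> nsub A (Suc d)"
  shows "(\<Sum>g\<in>nsub A (Suc d). gram e g * incidence s g) = int (card A) * incidence s e"
proof -
  have "(\<Sum>g\<in>nsub A (Suc d). gram e g * incidence s g) =
     (\<Sum>g\<in>nsub A (Suc d). (if e = g then int (card A) * incidence s g else 0)
        - (\<Sum>u\<in>nsub A (Suc (Suc d)). incidence e u * (incidence s g * incidence g u)))"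
  proof (rule sum.cong[OF refl])
    fix g assume g: "g \<in> nsub A (Suc d)"
    have "gram e g = (if e = g then int (card A) else 0) - (\<Sum>u\<in>nsub A (Suc (Suc d)). incidence e u * incidence g u)"
      using laplacian[OF A e g] by simp
    then have "gram e g * incidence s g = (if e = g then int (card A) else 0) * incidence s g
        - (\<Sum>u\<in>nsub A (Suc (Suc d)). incidence e u * incidence g u) * incidence s g"
      by (simp only: left_diff_distrib)
    also have "(\<Sum>u\<in>nsub A (Suc (Suc d)). incidence e u * incidence g u) * incidence s g
        = (\<Sum>u\<in>nsub A (Suc (Suc d)). incidence e u * (incidence s g * incidence g u))"
      unfolding sum_distrib_right by (simp only: mult_ac)
    finally show "gram e g * incidence s g = (if e = g then int (card A) * incidence s g else 0)
        - (\<Sum>u\<in>nsub A (Suc (Suc d)). incidence e u * (incidence s g * incidence g u))"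
      by simp
  qed
  also have "\<dots> = int (card A) * incidence s e - (\<Sum>g\<in>nsub A (Suc d). \<Sum>u\<in>nsub A (Suc (Suc d)). incidence e u * (incidence s g * incidence g u))"
    using A e by (simp add: sum_subtractf sum.delta)
  also have "(\<Sum>g\<in>nsub A (Suc d). \<Sum>u\<in>nsub A (Suc (Suc d)). incidence e u * (incidence s g * incidence g u))
     = (\<Sum>u\<in>nsub A (Suc (Suc d)). incidence e u * (\<Sum>g\<in>nsub A (Suc d). incidence s g * incidence g u))"
    by (subst sum.swap) (simp add: sum_distrib_left)
  also have "\<dots> = 0"
    using A by (intro sum.neutral ballI) (simp add: incidence_incidence nsub_finite Diff_in_nsub)
  finally show ?thesis by simp
qed

lemma gram_square:
  assumes A: "finite A" and e: "e \<in> nsub A (Suc d)" and f: "f \<in> nsub A (Suc d)"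
  shows "(\<Sum>g\<in>nsub A (Suc d). gram e g * gram g f) = int (card A) * gram e f"
proof -
  have eq: "gram g f = (\<Sum>s\<in>nsub A d. incidence s g * incidence s f)" if "g \<in> nsub A (Suc d)" for g
    using A that by (intro gram_eq_sum) (auto simp: nsub_finite Diff_in_nsub)
  have "(\<Sum>g\<in>nsub A (Suc d). gram e g * gram g f) = (\<Sum>g\<in>nsub A (Suc d). \<Sum>s\<in>nsub A d. (gram e g * incidence s g) * incidence s f)"
    by (intro sum.cong refl) (simp add: eq sum_distrib_left mult_ac)
  also have "\<dots> = (\<Sum>s\<in>nsub A d. (\<Sum>g\<in>nsub A (Suc d). gram e g * incidence s g) * incidence s f)"
    by (subst sum.swap) (simp add: sum_distrib_right)
  also have "\<dots> = int (card A) * gram e f"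
    unfolding sum_gram_incidence[OF A e] eq[OF e] by (simp add: sum_distrib_left mult_ac)
  finally show ?thesis .
qed

lemma rgram_eq_sum:
  assumes "finite A" "e \<in> nsub A (Suc d)"
  shows "rgram e f = (\<Sum>s\<in>nsub A d. real_of_int (incidence s e) * real_of_int (incidence s f))"
proof -
  have "gram e f = (\<Sum>s\<in>nsub A d. incidence s e * incidence s f)"
    using assms by (intro gram_eq_sum) (auto simp: nsub_finite Diff_in_nsub)
  then show ?thesis by simp
qed

lemma rgram_spectrum:
  assumes A: "finite A" and T: "T \<subseteq> nsub A (Suc d)"
  obtains lam :: "nat \<Rightarrow> real" where
    "\<And>i. i < card T \<Longrightarrow> lam i \<ge> 0"
    "\<And>c. pdet T (\<lambda>e f. rgram e f + (if e = f then c else 0)) = (\<Prod>i<card T. lam i + c)"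
    "\<And>j. mtrace T rgram j = (\<Sum>i<card T. lam i ^ j)"
proof -
  have finT: "finite T" by (rule finite_subset[OF T finite_nsub[OF A]])
  have G: "rgram e f = (\<Sum>s\<in>nsub A d. real_of_int (incidence s e) * real_of_int (incidence s f))"
    if "e \<in> T" "f \<in> T" for e f
    using that T by (intro rgram_eq_sum[OF A]) blast
  show ?thesis
    by (rule gram_spectrum[of T "nsub A d" rgram "\<lambda>s e. real_of_int (incidence s e)",
          OF finT finite_nsub[OF A] G]) (assumption, assumption, rule that)
qed

text \<open>All diagonal entries are \<open>d + 1\<close>, so the eigenvalues have mean
  \<open>d + 1\<close>, and the upper bound is the inequality of arithmetic and geometric
  means.\<close>

lemma rgram_pdet_bounds:
  assumes A: "finite A" and T: "T \<subseteq> nsub A (Suc d)"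
  shows "pdet T rgram \<ge> 0" "pdet T rgram \<le> (real d + 1) ^ card T"
proof -
  obtain lam where lam: "\<And>i. i < card T \<Longrightarrow> lam i \<ge> 0"
    "\<And>c. pdet T (\<lambda>e f. rgram e f + (if e = f then c else 0)) = (\<Prod>i<card T. lam i + c)"
    "\<And>j. mtrace T rgram j = (\<Sum>i<card T. lam i ^ j)"
    by (rule rgram_spectrum[OF assms]) (rule that)
  have det: "pdet T rgram = (\<Prod>i<card T. lam i)" using lam(2)[of 0] by simp
  then show "pdet T rgram \<ge> 0" using lam(1) by (auto intro!: prod_nonneg)
  have finT: "finite T" by (rule finite_subset[OF T finite_nsub[OF A]])
  have "mpow T rgram 1 e e = real d + 1" if "e \<in> T" for e
  proof -
    have "mpow T rgram 1 e e = rgram e e"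
      using that finT by (simp add: if_distrib[of "\<lambda>x. _ * x"] cong: if_cong)
    also have "\<dots> = real d + 1"
      using that T nsub_finite[OF A, of e "Suc d"] by (auto simp: gram_self nsub_def)
    finally show ?thesis .
  qed
  then have "(\<Sum>i<card T. lam i) = (real d + 1) * real (card T)"
    using lam(3)[of 1] by (simp add: mtrace_def mult.commute)
  then have sum0: "(\<Sum>i<card T. lam i / (real d + 1) - 1) = 0"
    by (simp add: sum_subtractf flip: sum_divide_distrib)
  \<comment> \<open>The inequality x \<le> exp (x - 1), applied to each eigenvalue divided by the
    mean; the exponents add up to 0.\<close>
  have "(\<Prod>i<card T. lam i / (real d + 1)) \<le> (\<Prod>i<card T. exp (lam i / (real d + 1) - 1))"
  proof (rule prod_mono, intro conjI)
    fix i assume "i \<in> {..<card T}"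
    then show "0 \<le> lam i / (real d + 1)" using lam(1) by simp
    show "lam i / (real d + 1) \<le> exp (lam i / (real d + 1) - 1)"
      using exp_ge_add_one_self[of "lam i / (real d + 1) - 1"] by simp
  qed
  also have "\<dots> = 1" using sum0 by (simp flip: exp_sum)
  finally have "(\<Prod>i<card T. lam i) / (real d + 1) ^ card T \<le> 1"
    by (simp add: prod_dividef)
  then show "pdet T rgram \<le> (real d + 1) ^ card T"
    unfolding det by (simp add: divide_le_eq)
qed

lemma projection_kernel_rgram:
  assumes A: "finite A" "card A > 0"
  shows "projection_kernel (nsub A (Suc d)) rgram (real (card A)) ((card A - 1) choose d)"
proof
  show "finite (nsub A (Suc d))" using A by simp
  show "real (card A) > 0" using A by simp
  show "pdet E rgram \<ge> 0" if "E \<subseteq> nsub A (Suc d)" for E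
    using rgram_pdet_bounds A that by blast
  show "(\<Sum>g\<in>nsub A (Suc d). rgram e g * rgram g f) = real (card A) * rgram e f"
    if "e \<in> nsub A (Suc d)" "f \<in> nsub A (Suc d)" for e f
  proof -
    have "real_of_int (\<Sum>g\<in>nsub A (Suc d). gram e g * gram g f) = real_of_int (int (card A) * gram e f)"
      using gram_square[OF A(1) that] by simp
    then show ?thesis by simp
  qed
  have "(\<Sum>e\<in>nsub A (Suc d). rgram e e) = (\<Sum>e\<in>nsub A (Suc d). real (Suc d))"
    using nsub_finite[OF A(1)] by (intro sum.cong refl) (simp add: gram_self nsub_def)
  also have "\<dots> = real (Suc d * (card A choose Suc d))"
    unfolding sum_constant card_nsub[OF A(1)] by (simp only: of_nat_mult mult.commute)
  \<comment> \<open>The trace is \<open>d + 1\<close> times the number of simplices. Absorption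
    rewrites it as \<open>card A\<close> times a binomial coefficient, and this identifies the
    rank.\<close>
  also have "Suc d * (card A choose Suc d) = card A * ((card A - 1) choose d)"
    using binomial_absorption[of d "card A"] by simp
  finally show "(\<Sum>e\<in>nsub A (Suc d). rgram e e) = real (card A) * real ((card A - 1) choose d)" by simp
qed

section \<open>Traces of powers as sums over closed walks\<close>

definition lists_of :: "'a set \<Rightarrow> nat \<Rightarrow> 'a list set" where
  "lists_of T m = {L. set L \<subseteq> T \<and> length L = m}"

lemma finite_lists_of [simp]: "finite T \<Longrightarrow> finite (lists_of T m)"
  unfolding lists_of_def by (rule finite_lists_length_eq)

lemma lists_of_0 [simp]: "lists_of T 0 = {[]}"
  by (auto simp: lists_of_def)

lemma sum_lists_of_Suc:
  "(\<Sum>L\<in>lists_of T (Suc m). F L) = (\<Sum>e\<in>T. \<Sum>L\<in>lists_of T m. F (e # L))"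
proof -
  have "(\<Sum>L\<in>lists_of T (Suc m). F L) = (\<Sum>(e, L)\<in>T \<times> lists_of T m. F (e # L))"
    by (rule sum.reindex_bij_witness[where i = "\<lambda>(e, L). e # L" and j = "\<lambda>L. (hd L, tl L)"])
      (auto simp: lists_of_def length_Suc_conv)
  then show ?thesis by (simp add: sum.cartesian_product)
qed

fun walk_weight :: "('a \<Rightarrow> 'a \<Rightarrow> real) \<Rightarrow> 'a \<Rightarrow> 'a list \<Rightarrow> 'a \<Rightarrow> real" where
  "walk_weight G e [] f = G e f"
| "walk_weight G e (g # gs) f = G e g * walk_weight G g gs f"

text \<open>A non-empty list holds the stations of a cyclic walk without repeating the start, so its
  length is the number of steps.\<close>

definition closed_walk_weight :: "('a \<Rightarrow> 'a \<Rightarrow> real) \<Rightarrow> 'a list \<Rightarrow> real" where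
  "closed_walk_weight G L = walk_weight G (hd L) (tl L) (hd L)"

lemma mpow_eq_sum_walk_weight:
  assumes "finite T" "f \<in> T"
  shows "mpow T G (Suc m) e f = (\<Sum>L\<in>lists_of T m. walk_weight G e L f)"
proof (induction m arbitrary: e)
  case 0
  then show ?case using assms by (simp add: if_distrib[of "\<lambda>x. _ * x"] cong: if_cong)
next
  case (Suc m)
  have "mpow T G (Suc (Suc m)) e f = (\<Sum>g\<in>T. G e g * mpow T G (Suc m) g f)" by simp
  then show ?case unfolding Suc sum_lists_of_Suc by (simp add: sum_distrib_left)
qed

lemma mtrace_eq_sum_closed_walk_weight:
  assumes "finite T"
  shows "mtrace T G (Suc m) = (\<Sum>L\<in>lists_of T (Suc m). closed_walk_weight G L)"
  unfolding mtrace_def sum_lists_of_Suc closed_walk_weight_def using assms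
  by (intro sum.cong refl) (simp only: mpow_eq_sum_walk_weight list.sel)

context projection_kernel
begin

text \<open>The index is shifted: \<open>mean m\<close> belongs to the power \<open>m + 1\<close>,
  so that all walks are non-empty.\<close>

definition mean :: "nat \<Rightarrow> real" where
  "mean m = (\<Sum>T\<in>bases. wgt T * mtrace T G (Suc m))"

lemma mtrace_eq_sum_if:
  assumes "T \<subseteq> V"
  shows "mtrace T G (Suc m) = (\<Sum>L\<in>lists_of V (Suc m). if set L \<subseteq> T then closed_walk_weight G L else 0)"
proof -
  have "finite T" using assms finite_V finite_subset by blast
  then show ?thesis
    unfolding mtrace_eq_sum_closed_walk_weight[OF \<open>finite T\<close>]
    by (intro sum.mono_neutral_cong_left) (use assms finite_V in \<open>auto simp: lists_of_def finite_lists_length_eq\<close>)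
qed

text \<open>A walk stays inside \<open>T\<close> exactly when its set of stations does, so
  exchanging the sums leaves the inclusion probability of that set.\<close>

lemma mean_eq: "mean m = (\<Sum>L\<in>lists_of V (Suc m). closed_walk_weight G L * incl (set L))"
proof -
  have "mean m = (\<Sum>T\<in>bases. \<Sum>L\<in>lists_of V (Suc m). closed_walk_weight G L * (if set L \<subseteq> T then wgt T else 0))"
    unfolding mean_def
    by (intro sum.cong refl) (auto simp: mtrace_eq_sum_if supersets_def sum_distrib_left intro!: sum.cong)
  also have "\<dots> = (\<Sum>L\<in>lists_of V (Suc m). closed_walk_weight G L * (\<Sum>T\<in>bases. if set L \<subseteq> T then wgt T else 0))"
    by (subst sum.swap) (simp add: sum_distrib_left)
  also have "\<dots> = (\<Sum>L\<in>lists_of V (Suc m). closed_walk_weight G L * incl (set L))"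
    by (intro sum.cong refl) (simp add: sum_wgt_supersets lists_of_def)
  finally show ?thesis .
qed

lemma second_moment_eq:
  "(\<Sum>T\<in>bases. wgt T * (mtrace T G (Suc m))\<^sup>2) =
    (\<Sum>L\<in>lists_of V (Suc m). \<Sum>L'\<in>lists_of V (Suc m). closed_walk_weight G L * closed_walk_weight G L' * incl (set L \<union> set L'))"
proof -
  have "(\<Sum>T\<in>bases. wgt T * (mtrace T G (Suc m))\<^sup>2) = (\<Sum>T\<in>bases. \<Sum>L\<in>lists_of V (Suc m). \<Sum>L'\<in>lists_of V (Suc m).
      closed_walk_weight G L * closed_walk_weight G L' * (if set L \<union> set L' \<subseteq> T then wgt T else 0))"
  proof (intro sum.cong refl)
    fix T assume "T \<in> bases"
    then have "T \<subseteq> V" by (simp add: supersets_def)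
    then have "wgt T * (mtrace T G (Suc m))\<^sup>2 = (\<Sum>L\<in>lists_of V (Suc m). \<Sum>L'\<in>lists_of V (Suc m).
       wgt T * ((if set L \<subseteq> T then closed_walk_weight G L else 0) * (if set L' \<subseteq> T then closed_walk_weight G L' else 0)))"
      unfolding mtrace_eq_sum_if[OF \<open>T \<subseteq> V\<close>] power2_eq_square sum_product
      by (simp only: sum_distrib_left)
    then show "wgt T * (mtrace T G (Suc m))\<^sup>2 = (\<Sum>L\<in>lists_of V (Suc m). \<Sum>L'\<in>lists_of V (Suc m).
      closed_walk_weight G L * closed_walk_weight G L' * (if set L \<union> set L' \<subseteq> T then wgt T else 0))"
      by (auto intro!: sum.cong)
  qed
  also have "\<dots> = (\<Sum>L\<in>lists_of V (Suc m). \<Sum>T\<in>bases. \<Sum>L'\<in>lists_of V (Suc m).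
      closed_walk_weight G L * closed_walk_weight G L' * (if set L \<union> set L' \<subseteq> T then wgt T else 0))"
    by (rule sum.swap)
  also have "\<dots> = (\<Sum>L\<in>lists_of V (Suc m). \<Sum>L'\<in>lists_of V (Suc m).
      closed_walk_weight G L * closed_walk_weight G L' * (\<Sum>T\<in>bases. if set L \<union> set L' \<subseteq> T then wgt T else 0))"
    by (subst sum.swap) (simp add: sum_distrib_left)
  also have "\<dots> = (\<Sum>L\<in>lists_of V (Suc m). \<Sum>L'\<in>lists_of V (Suc m). closed_walk_weight G L * closed_walk_weight G L' * incl (set L \<union> set L'))"
  proof (intro sum.cong refl)
    fix L L' assume "L \<in> lists_of V (Suc m)" "L' \<in> lists_of V (Suc m)"
    then have "set L \<union> set L' \<subseteq> V" by (auto simp: lists_of_def)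
    from sum_wgt_supersets[OF this]
    show "closed_walk_weight G L * closed_walk_weight G L' * (\<Sum>T\<in>bases. if set L \<union> set L' \<subseteq> T then wgt T else 0) =
        closed_walk_weight G L * closed_walk_weight G L' * incl (set L \<union> set L')" by (rule arg_cong)
  qed
  finally show ?thesis .
qed

text \<open>A sum of covariances over pairs of walks; a summand disappears as soon as the inclusion
  probabilities factor.\<close>

lemma variance_eq:
  "(\<Sum>T\<in>bases. wgt T * (mtrace T G (Suc m) - mean m)\<^sup>2) =
    (\<Sum>L\<in>lists_of V (Suc m). \<Sum>L'\<in>lists_of V (Suc m).
      closed_walk_weight G L * closed_walk_weight G L' * (incl (set L \<union> set L') - incl (set L) * incl (set L')))"
proof -
  have "(\<Sum>T\<in>bases. wgt T * (mtrace T G (Suc m) - mean m)\<^sup>2) =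
     (\<Sum>T\<in>bases. wgt T * (mtrace T G (Suc m))\<^sup>2 - (2 * mean m * (wgt T * mtrace T G (Suc m))) + (mean m)\<^sup>2 * wgt T)"
    by (intro sum.cong refl) (simp add: power2_eq_square algebra_simps)
  also have "\<dots> = (\<Sum>T\<in>bases. wgt T * (mtrace T G (Suc m))\<^sup>2)
      - 2 * mean m * (\<Sum>T\<in>bases. wgt T * mtrace T G (Suc m)) + (mean m)\<^sup>2 * (\<Sum>T\<in>bases. wgt T)"
    by (simp only: sum.distrib sum_subtractf sum_distrib_left)
  also have "\<dots> = (\<Sum>T\<in>bases. wgt T * (mtrace T G (Suc m))\<^sup>2) - mean m * mean m"
    unfolding mean_def[symmetric] sum_wgt by (simp add: power2_eq_square)
  also have "mean m * mean m = (\<Sum>L\<in>lists_of V (Suc m). \<Sum>L'\<in>lists_of V (Suc m).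
      closed_walk_weight G L * closed_walk_weight G L' * (incl (set L) * incl (set L')))"
    unfolding mean_eq sum_product by (intro sum.cong refl) simp
  finally show ?thesis
    unfolding second_moment_eq by (simp only: sum_subtractf[symmetric] right_diff_distrib[symmetric])
qed

end

section \<open>Sums over lists of simplices, grouped by order type\<close>

definition facet_lists :: "nat \<Rightarrow> nat \<Rightarrow> nat set \<Rightarrow> nat set list set" where
  "facet_lists D m W = {L. length L = m \<and> (\<forall>e\<in>set L. finite e \<and> card e = D) \<and> \<Union>(set L) = W}"

lemma facet_lists_subset: "finite W \<Longrightarrow> facet_lists D m W \<subseteq> lists_of (Pow W) m"
  by (auto simp: facet_lists_def lists_of_def)

lemma finite_facet_lists [simp]: "finite W \<Longrightarrow> finite (facet_lists D m W)"
  using facet_lists_subset[of W D m] finite_lists_of[of "Pow W" m] finite_subset by (metis finite_Pow_iff)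

lemma facet_lists_card:
  assumes "L \<in> facet_lists D m W" "finite W"
  shows "card W \<le> m * D"
proof -
  have "card (\<Union>(set L)) \<le> (\<Sum>e\<in>set L. card e)"
    by (rule card_Union_le_sum_card)
  also have "\<dots> = card (set L) * D" using assms by (simp add: facet_lists_def)
  also have "\<dots> \<le> m * D" using assms card_length[of L] by (simp add: facet_lists_def)
  finally show ?thesis using assms by (simp add: facet_lists_def)
qed

lemma bij_betw_facet_lists:
  assumes "bij_betw h U W" "finite U"
  shows "bij_betw (map ((`) h)) (facet_lists D m U) (facet_lists D m W)"
proof -
  have inj: "inj_on h U" and img: "h ` U = W" using assms by (auto simp: bij_betw_def)
  define h' where "h' = inv_into U h"
  have h'h: "h' ` h ` e = e" if "e \<subseteq> U" for e
    using that inj by (auto simp: h'_def image_image inv_into_f_f subset_iff)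
  have hh': "h ` h' ` e = e" if "e \<subseteq> W" for e
    using that img by (force simp: h'_def image_image f_inv_into_f subset_iff)
  have inj': "inj_on h' W" unfolding h'_def using img inj_on_inv_into by blast
  have img': "h' ` W = U" using h'h[of U] img by simp
  have map_in: "map ((`) g) L \<in> facet_lists D m Y"
    if "L \<in> facet_lists D m X" "inj_on g X" "g ` X = Y" for g X Y L
  proof -
    have "finite (g ` e) \<and> card (g ` e) = D" if "e \<in> set L" for e
    proof -
      have "e \<subseteq> X" using \<open>L \<in> _\<close> that by (auto simp: facet_lists_def)
      then show ?thesis using \<open>L \<in> _\<close> that \<open>inj_on g X\<close>
        by (auto simp: facet_lists_def card_image inj_on_subset)
    qed
    moreover have "\<Union>(set (map ((`) g) L)) = g ` \<Union>(set L)" by auto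
    ultimately show ?thesis using that by (simp add: facet_lists_def)
  qed
  show ?thesis
  proof (rule bij_betw_byWitness[where f' = "map ((`) h')"])
    show "\<forall>L\<in>facet_lists D m U. map ((`) h') (map ((`) h) L) = L"
    proof
      fix L assume "L \<in> facet_lists D m U"
      then have "e \<in> set L \<Longrightarrow> h' ` h ` e = e" for e by (intro h'h) (auto simp: facet_lists_def)
      then show "map ((`) h') (map ((`) h) L) = L" by (simp add: map_idI)
    qed
    show "\<forall>L\<in>facet_lists D m W. map ((`) h) (map ((`) h') L) = L"
    proof
      fix L assume "L \<in> facet_lists D m W"
      then have "e \<in> set L \<Longrightarrow> h ` h' ` e = e" for e by (intro hh') (auto simp: facet_lists_def)
      then show "map ((`) h) (map ((`) h') L) = L" by (simp add: map_idI)
    qed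
    show "map ((`) h) ` facet_lists D m U \<subseteq> facet_lists D m W"
      using map_in inj img by blast
    show "map ((`) h') ` facet_lists D m W \<subseteq> facet_lists D m U"
      using map_in inj' img' by blast
  qed
qed

lemma binomial_div_power_lim: "(\<lambda>n. real (n choose v) / real n ^ v) \<longlonglongrightarrow> 1 / fact v"
proof -
  have 1: "(\<lambda>n. (\<Prod>i = 0..<v. 1 - real i / real n) / fact v) \<longlonglongrightarrow> (\<Prod>i = 0..<v. 1 - 0) / fact v"
    by (intro tendsto_intros lim_const_over_n) auto
  have 2: "\<forall>\<^sub>F n in sequentially. (\<Prod>i = 0..<v. 1 - real i / real n) / fact v = real (n choose v) / real n ^ v"
  proof (rule eventually_sequentiallyI[of 1])
    fix n :: nat assume n: "1 \<le> n"
    have "(\<Prod>i = 0..<v. 1 - real i / real n) = (\<Prod>i = 0..<v. (real n - real i) / real n)"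
      using n by (intro prod.cong refl) (simp add: diff_divide_distrib)
    also have "\<dots> = (\<Prod>i = 0..<v. real n - real i) / real n ^ v"
      by (simp add: prod_dividef)
    also have "(\<Prod>i = 0..<v. real n - real i) = fact v * real (n choose v)"
      by (simp add: binomial_gbinomial gbinomial_prod_rev)
    finally show "(\<Prod>i = 0..<v. 1 - real i / real n) / fact v = real (n choose v) / real n ^ v"
      by simp
  qed
  show ?thesis using Lim_transform_eventually[OF 1 2] by simp
qed

lemma binomial_div_power_convergent:
  assumes "v \<le> s"
  shows "convergent (\<lambda>n. real (n choose v) / real n ^ s)"
proof -
  have 1: "(\<lambda>n. real (n choose v) / real n ^ v * (1 / real n) ^ (s - v)) \<longlonglongrightarrow> 1 / fact v * 0 ^ (s - v)"
    by (intro tendsto_mult tendsto_power binomial_div_power_lim lim_const_over_n)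
  have 2: "\<forall>\<^sub>F n in sequentially. real (n choose v) / real n ^ v * (1 / real n) ^ (s - v)
     = real (n choose v) / real n ^ s"
    by (rule eventually_sequentiallyI[of 1]) (use assms in \<open>simp add: power_divide flip: power_add\<close>)
  show ?thesis using Lim_transform_eventually[OF 1 2] by (auto simp: convergent_def)
qed

text \<open>Group the lists by the vertex set they cover. By \<open>inv\<close> the contribution of
  a vertex set depends only on its size \<open>v\<close>, and \<open>v\<close> is at most
  \<open>m * D\<close>. So the sum is a combination, with a number of terms independent of
  \<open>n\<close>, of the quotients of \<open>n choose v\<close> by
  \<open>n ^ (card (set L) + d)\<close>. These converge because \<open>small\<close> keeps the
  degree of the numerator at most that of the denominator.\<close>

lemma order_type_limit:
  fixes \<Psi> :: "nat set list \<Rightarrow> real"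
  assumes inv: "\<And>U h L. finite U \<Longrightarrow> strict_mono_on U h \<Longrightarrow> L \<in> facet_lists D m U \<Longrightarrow>
      \<Psi> (map ((`) h) L) = \<Psi> L"
    and small: "\<And>U L. finite U \<Longrightarrow> L \<in> facet_lists D m U \<Longrightarrow> \<Psi> L \<noteq> 0 \<Longrightarrow> card U \<le> d + card (set L)"
  shows "convergent (\<lambda>n. (\<Sum>L\<in>lists_of (nsub {1..n} D) m. \<Psi> L / real n ^ card (set L)) / real n ^ d)"
proof -
  define S where "S n U = (\<Sum>L\<in>facet_lists D m U. \<Psi> L / real n ^ card (set L))" for n :: nat and U :: "nat set"
  have S_card: "S n W = S n {..<card W}" if W: "finite W" for n W
  proof -
    obtain h where h: "bij_betw h {..<card W} W" "strict_mono_on {..<card W} h"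
      using ex_bij_betw_strict_mono_card[OF W] by blast
    have "S n W = (\<Sum>L\<in>facet_lists D m {..<card W}. \<Psi> (map ((`) h) L) / real n ^ card (set (map ((`) h) L)))"
      unfolding S_def by (rule sum.reindex_bij_betw[OF bij_betw_facet_lists[OF h(1)], symmetric]) simp
    also have "\<dots> = S n {..<card W}"
      unfolding S_def
    proof (intro sum.cong refl)
      fix L assume L: "L \<in> facet_lists D m {..<card W}"
      have "inj_on ((`) h) (Pow {..<card W})"
        using h(1) by (intro inj_on_image_Pow) (simp add: bij_betw_def)
      moreover have "set L \<subseteq> Pow {..<card W}" using L by (auto simp: facet_lists_def)
      ultimately have "card ((`) h ` set L) = card (set L)"
        by (meson card_image inj_on_subset)
      then show "\<Psi> (map ((`) h) L) / real n ^ card (set (map ((`) h) L)) = \<Psi> L / real n ^ card (set L)"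
        using inv[OF _ h(2) L] by simp
    qed
    finally show ?thesis .
  qed
  have eq: "(\<Sum>L\<in>lists_of (nsub {1..n} D) m. \<Psi> L / real n ^ card (set L)) / real n ^ d
     = (\<Sum>v\<le>m * D. \<Sum>L\<in>facet_lists D m {..<v}. \<Psi> L * (real (n choose v) / real n ^ (card (set L) + d)))" for n
  proof -
    have "(\<Sum>L\<in>lists_of (nsub {1..n} D) m. \<Psi> L / real n ^ card (set L))
       = (\<Sum>W\<in>Pow {1..n}. \<Sum>L | L \<in> lists_of (nsub {1..n} D) m \<and> \<Union>(set L) = W. \<Psi> L / real n ^ card (set L))"
    proof (rule sum.group[symmetric])
      show "finite (lists_of (nsub {1..n} D) m)" by simp
      show "(\<lambda>L. \<Union>(set L)) ` lists_of (nsub {1..n} D) m \<subseteq> Pow {1..n}"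
        unfolding lists_of_def nsub_def by blast
    qed simp
    also have "\<dots> = (\<Sum>W\<in>Pow {1..n}. S n W)"
    proof (intro sum.cong refl)
      fix W assume "W \<in> Pow {1..n}"
      then have W: "W \<subseteq> {1..n}" by simp
      have "{L \<in> lists_of (nsub {1..n} D) m. \<Union>(set L) = W} = facet_lists D m W"
        using W by (auto simp: lists_of_def nsub_def facet_lists_def intro: finite_subset)
      then show "(\<Sum>L | L \<in> lists_of (nsub {1..n} D) m \<and> \<Union>(set L) = W. \<Psi> L / real n ^ card (set L)) = S n W"
        by (simp add: S_def)
    qed
    also have "\<dots> = (\<Sum>W\<in>Pow {1..n}. S n {..<card W})"
      by (intro sum.cong refl S_card) (auto intro: finite_subset)
    also have "\<dots> = (\<Sum>v\<le>n. \<Sum>W | W \<in> Pow {1..n} \<and> card W = v. S n {..<card W})"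
    proof (rule sum.group[symmetric])
      show "card ` Pow {1..n} \<subseteq> {..n}"
        using card_mono[of "{1..n}"] by auto
    qed auto
    also have "\<dots> = (\<Sum>v\<le>n. real (n choose v) * S n {..<v})"
    proof (intro sum.cong refl)
      fix v
      have "(\<Sum>W | W \<in> Pow {1..n} \<and> card W = v. S n {..<card W}) = (\<Sum>W\<in>nsub {1..n} v. S n {..<v})"
        by (intro sum.cong) (auto simp: nsub_def)
      then show "(\<Sum>W | W \<in> Pow {1..n} \<and> card W = v. S n {..<card W}) = real (n choose v) * S n {..<v}"
        by (simp add: card_nsub)
    qed
    \<comment> \<open>Passage to a range of \<open>v\<close> independent of \<open>n\<close>: the
      binomial coefficients vanish for \<open>v > n\<close>, and \<open>m\<close> sets of size
      \<open>D\<close> cover at most \<open>m * D\<close> vertices.\<close>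
    also have "\<dots> = (\<Sum>v\<le>max n (m * D). real (n choose v) * S n {..<v})"
      by (intro sum.mono_neutral_left) (auto simp: binomial_eq_0)
    also have "\<dots> = (\<Sum>v\<le>m * D. real (n choose v) * S n {..<v})"
    proof (rule sum.mono_neutral_right)
      show "\<forall>v\<in>{..max n (m * D)} - {..m * D}. real (n choose v) * S n {..<v} = 0"
      proof
        fix v assume v: "v \<in> {..max n (m * D)} - {..m * D}"
        have "facet_lists D m {..<v} = {}"
          using facet_lists_card[of _ D m "{..<v}"] v by fastforce
        then show "real (n choose v) * S n {..<v} = 0" by (simp add: S_def)
      qed
    qed auto
    finally show ?thesis
      by (simp add: S_def sum_distrib_left sum_divide_distrib power_add mult.commute)
  qed
  have "convergent (\<lambda>n. \<Sum>v\<le>m * D. \<Sum>L\<in>facet_lists D m {..<v}. \<Psi> L * (real (n choose v) / real n ^ (card (set L) + d)))"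
  proof (intro convergent_sum)
    fix v L assume L: "L \<in> facet_lists D m {..<v}"
    show "convergent (\<lambda>n. \<Psi> L * (real (n choose v) / real n ^ (card (set L) + d)))"
    proof (cases "\<Psi> L = 0")
      case True
      then show ?thesis by (simp add: convergent_const)
    next
      case False
      then have "v \<le> card (set L) + d" using small[OF _ L] by simp
      then show ?thesis
        by (intro convergent_mult convergent_const binomial_div_power_convergent)
    qed
  qed
  then show ?thesis by (simp only: eq)
qed

section \<open>Means and variances of the traces\<close>

text \<open>The relation is symmetrized in its definition, so reachability is symmetric at
  once.\<close>

definition adj :: "nat set set \<Rightarrow> (nat set \<times> nat set) set" where
  "adj F = {(e, f). e \<in> F \<and> f \<in> F \<and> (gram e f \<noteq> 0 \<or> gram f e \<noteq> 0)}"

definition rooted :: "nat set \<Rightarrow> nat set set \<Rightarrow> bool" where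
  "rooted r F \<longleftrightarrow> r \<in> F \<and> (\<forall>e\<in>F. (r, e) \<in> (adj F)\<^sup>*)"

lemma adj_mono: "F \<subseteq> F' \<Longrightarrow> adj F \<subseteq> adj F'"
  by (auto simp: adj_def)

lemma rtrancl_adj_sym: "(e, f) \<in> (adj F)\<^sup>* \<Longrightarrow> (f, e) \<in> (adj F)\<^sup>*"
proof -
  have "sym (adj F)" by (auto simp: sym_def adj_def)
  then show "(e, f) \<in> (adj F)\<^sup>* \<Longrightarrow> (f, e) \<in> (adj F)\<^sup>*"
    by (meson sym_rtrancl symD)
qed

lemma rtrancl_exit:
  assumes "(r, y) \<in> R\<^sup>*" "r \<in> S" "y \<notin> S"
  obtains a b where "(a, b) \<in> R" "a \<in> S" "b \<notin> S"
  using assms by (induction rule: rtrancl_induct) blast+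

text \<open>Build \<open>F\<close> up from the root, always along a pair that leaves the part
  already built. Adjacent simplices agree up to one vertex, so the root contributes
  \<open>d + 1\<close> vertices and each further simplex at most one.\<close>

lemma rooted_card_Union:
  assumes F: "finite F" and D: "\<And>e. e \<in> F \<Longrightarrow> finite e \<and> card e = Suc d" and r: "rooted r F"
  shows "card (\<Union>F) \<le> d + card F"
proof -
  have grow: "\<exists>F'\<subseteq>F. r \<in> F' \<and> card F' = j \<and> card (\<Union>F') \<le> d + j" if "1 \<le> j" "j \<le> card F" for j
    using that
  proof (induction j rule: dec_induct)
    case base
    then show ?case using r D by (intro exI[of _ "{r}"]) (auto simp: rooted_def)
  next
    case (step j)
    then obtain F' where F': "F' \<subseteq> F" "r \<in> F'" "card F' = j" "card (\<Union>F') \<le> d + j" by auto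
    have finF': "finite F'" using F F' finite_subset by blast
    have "F' \<noteq> F" using step.prems F'(3) by auto
    then obtain y where y: "y \<in> F" "y \<notin> F'" using F'(1) by blast
    then have "(r, y) \<in> (adj F)\<^sup>*" using r by (simp add: rooted_def)
    then obtain a b where ab: "(a, b) \<in> adj F" "a \<in> F'" "b \<notin> F'"
      using rtrancl_exit F'(2) y(2) by metis
    have "gram a b \<noteq> 0 \<or> gram b a \<noteq> 0" "b \<in> F" using ab by (auto simp: adj_def)
    then obtain v w where "v \<in> a" "w \<in> b" "a - {v} = b - {w}"
      using gram_nonzeroD[of a b] gram_nonzeroD[of b a] by metis
    then have "\<Union>(insert b F') \<subseteq> insert w (\<Union>F')" using ab by blast
    moreover have fin: "finite (\<Union>F')" using finF' F' D by blast
    ultimately have "card (\<Union>(insert b F')) \<le> card (insert w (\<Union>F'))"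
      by (intro card_mono) auto
    also have "\<dots> \<le> Suc (card (\<Union>F'))" by (rule card_insert_le_m1[of "Suc _", simplified]) simp_all
    finally have "card (\<Union>(insert b F')) \<le> d + Suc j" using F' by simp
    then show ?case using F' ab \<open>b \<in> F\<close> finF' by (intro exI[of _ "insert b F'"]) auto
  qed
  have "1 \<le> card F" using r F by (auto simp: rooted_def Suc_le_eq card_gt_0_iff)
  then obtain F' where "F' \<subseteq> F" "card F' = card F" "card (\<Union>F') \<le> d + card F"
    using grow[of "card F"] by auto
  then show ?thesis using card_subset_eq[OF F] by metis
qed

lemma rooted_Un:
  assumes "rooted r F" "rooted r' F'" "a \<in> F" "b \<in> F'" "gram a b \<noteq> 0"
  shows "rooted r (F \<union> F')"
proof -
  let ?A = "adj (F \<union> F')"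
  have 1: "(r, e) \<in> ?A\<^sup>*" if "e \<in> F" for e
    using assms(1) that rtrancl_mono[OF adj_mono[of F "F \<union> F'"]] by (auto simp: rooted_def)
  have 2: "(r', e) \<in> ?A\<^sup>*" if "e \<in> F'" for e
    using assms(2) that rtrancl_mono[OF adj_mono[of F' "F \<union> F'"]] by (auto simp: rooted_def)
  have "(a, b) \<in> ?A" using assms by (auto simp: adj_def)
  then have "(r, b) \<in> ?A\<^sup>*" using 1[OF assms(3)] by auto
  moreover have "(b, e) \<in> ?A\<^sup>*" if "e \<in> F'" for e
    using rtrancl_adj_sym[OF 2[OF assms(4)]] 2[OF that] by auto
  ultimately have "(r, e) \<in> ?A\<^sup>*" if "e \<in> F'" for e using that by (meson rtrancl_trans)
  then show ?thesis using 1 assms(1) unfolding rooted_def by blast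
qed

lemma rooted_singleton: "rooted e {e}"
  by (simp add: rooted_def)

fun chain :: "nat set list \<Rightarrow> bool" where
  "chain [] \<longleftrightarrow> False"
| "chain [e] \<longleftrightarrow> True"
| "chain (e # g # L) \<longleftrightarrow> gram e g \<noteq> 0 \<and> chain (g # L)"

lemma chain_rooted: "chain L \<Longrightarrow> rooted (hd L) (set L)"
proof (induction L rule: chain.induct)
  case (3 e g L)
  then have r: "rooted g (set (g # L))" by simp
  have "rooted e ({e} \<union> set (g # L))"
    by (rule rooted_Un[OF rooted_singleton r, where a = e and b = g]) (use 3 in auto)
  then show ?case by (simp add: insert_commute)
qed (auto simp: rooted_singleton)

lemma walk_weight_chain: "walk_weight rgram e L f \<noteq> 0 \<Longrightarrow> chain (e # L)"
  by (induction L arbitrary: e) auto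

lemma closed_walk_weight_chain: "L \<noteq> [] \<Longrightarrow> closed_walk_weight rgram L \<noteq> 0 \<Longrightarrow> chain L"
  unfolding closed_walk_weight_def using walk_weight_chain[of "hd L" "tl L" "hd L"] by simp

lemma abs_walk_weight_le:
  assumes "\<And>e. e \<in> insert x (insert f (set L)) \<Longrightarrow> finite e \<and> card e = Suc d"
  shows "\<bar>walk_weight rgram x L f\<bar> \<le> (real d + 1) ^ Suc (length L)"
  using assms
proof (induction L arbitrary: x)
  have *: "\<bar>rgram a b\<bar> \<le> real d + 1" if "finite a \<and> card a = Suc d" "finite b \<and> card b = Suc d" for a b
    using abs_gram_le[of a b] that by linarith
  {
    case Nil
    then show ?case using * by simp
  next
    case (Cons g L)
    have "\<bar>walk_weight rgram x (g # L) f\<bar> = \<bar>rgram x g\<bar> * \<bar>walk_weight rgram g L f\<bar>" by (simp add: abs_mult)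
    also have "\<dots> \<le> (real d + 1) * (real d + 1) ^ Suc (length L)"
    proof (rule mult_mono)
      show "\<bar>rgram x g\<bar> \<le> real d + 1" by (rule *) (rule Cons.prems, simp)+
      show "\<bar>walk_weight rgram g L f\<bar> \<le> (real d + 1) ^ Suc (length L)"
        by (rule Cons.IH) (rule Cons.prems, auto)
    qed auto
    finally show ?case by simp
  }
qed

lemma walk_weight_image:
  assumes "finite U" "strict_mono_on U h" "\<Union>(set (e # f # L)) \<subseteq> U"
  shows "walk_weight rgram (h ` e) (map ((`) h) L) (h ` f) = walk_weight rgram e L f"
  using assms(3) by (induction L arbitrary: e) (auto simp: gram_image[OF assms(1,2)])

lemma closed_walk_weight_image:
  assumes "finite U" "strict_mono_on U h" "\<Union>(set L) \<subseteq> U" "L \<noteq> []"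
  shows "closed_walk_weight rgram (map ((`) h) L) = closed_walk_weight rgram L"
  unfolding closed_walk_weight_def using assms walk_weight_image[OF assms(1,2), of "hd L" "hd L" "tl L"]
  by (cases L) auto

lemma pdet_rgram_image:
  assumes "finite U" "strict_mono_on U h" "\<Union>F \<subseteq> U"
  shows "pdet ((`) h ` F) rgram = pdet F rgram"
proof -
  have "F \<subseteq> Pow U" using assms(3) by auto
  moreover have "inj_on ((`) h) (Pow U)"
    using strict_mono_on_imp_inj_on[OF assms(2)] by (rule inj_on_image_Pow)
  ultimately have "inj_on ((`) h) F" by (meson inj_on_subset)
  moreover have "finite F" using \<open>F \<subseteq> Pow U\<close> assms(1) by (meson finite_Pow_iff finite_subset)
  ultimately have "pdet ((`) h ` F) rgram = pdet F (\<lambda>e f. rgram (h ` e) (h ` f))"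
    by (intro pdet_image)
  also have "\<dots> = pdet F rgram"
    using assms by (intro pdet_cong) (auto intro!: gram_image[OF assms(1,2)])
  finally show ?thesis .
qed

lemma convergent_closed_walk_weight_sum:
  assumes "m > 0"
  shows "convergent (\<lambda>n. (\<Sum>L\<in>lists_of (nsub {1..n} (Suc d)) m.
    (closed_walk_weight rgram L * pdet (set L) rgram) / real n ^ card (set L)) / real n ^ d)"
proof (rule order_type_limit)
  fix U and h :: "nat \<Rightarrow> nat" and L :: "nat set list"
  assume U: "finite U" "strict_mono_on U h" "L \<in> facet_lists (Suc d) m U"
  then have L: "L \<noteq> []" "\<Union>(set L) \<subseteq> U" using assms by (auto simp: facet_lists_def)
  show "closed_walk_weight rgram (map ((`) h) L) * pdet (set (map ((`) h) L)) rgram = closed_walk_weight rgram L * pdet (set L) rgram"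
    using closed_walk_weight_image[OF U(1,2) L(2,1)] pdet_rgram_image[OF U(1,2) L(2)] by simp
next
  fix U and L :: "nat set list"
  assume U: "finite U" "L \<in> facet_lists (Suc d) m U" and nz: "closed_walk_weight rgram L * pdet (set L) rgram \<noteq> 0"
  have "L \<noteq> []" using U assms by (auto simp: facet_lists_def)
  then have "rooted (hd L) (set L)" using nz closed_walk_weight_chain chain_rooted by simp
  then have "card (\<Union>(set L)) \<le> d + card (set L)"
    using U by (intro rooted_card_Union) (auto simp: facet_lists_def)
  then show "card U \<le> d + card (set L)" using U by (simp add: facet_lists_def)
qed

section \<open>Pairs of walks and their covariances\<close>

definition linked :: "nat set list \<Rightarrow> nat set list \<Rightarrow> bool" where
  "linked L L' \<longleftrightarrow> (\<exists>a\<in>set L. \<exists>b\<in>set L'. gram a b \<noteq> 0)"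

text \<open>Divided by \<open>n ^ card (set L \<union> set L')\<close>, this bounds the covariance
  of the two walks; it is 0 for unlinked walks because these are uncorrelated. Unlike the covariance
  it does not involve \<open>n\<close>, so it depends on the order type only.\<close>

definition pair_weight :: "nat set list \<Rightarrow> nat set list \<Rightarrow> real" where
  "pair_weight L L' = (if linked L L'
    then \<bar>closed_walk_weight rgram L * closed_walk_weight rgram L'\<bar> * (\<bar>pdet (set L \<union> set L') rgram\<bar> + \<bar>pdet (set L) rgram * pdet (set L') rgram\<bar>)
    else 0)"

lemma linked_image:
  assumes "finite U" "strict_mono_on U h" "\<Union>(set L) \<subseteq> U" "\<Union>(set L') \<subseteq> U"
  shows "linked (map ((`) h) L) (map ((`) h) L') = linked L L'"
proof -
  have "gram (h ` a) (h ` b) = gram a b" if "a \<in> set L" "b \<in> set L'" for a b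
    using that assms by (intro gram_image[OF assms(1,2)]) auto
  then show ?thesis by (auto simp: linked_def)
qed

lemma pair_weight_image:
  assumes U: "finite U" "strict_mono_on U h" and L: "\<Union>(set L) \<subseteq> U" "\<Union>(set L') \<subseteq> U" "L \<noteq> []" "L' \<noteq> []"
  shows "pair_weight (map ((`) h) L) (map ((`) h) L') = pair_weight L L'"
proof -
  have "\<Union>(set L \<union> set L') \<subseteq> U" using L by auto
  from pdet_rgram_image[OF U this]
  have "pdet (set (map ((`) h) L) \<union> set (map ((`) h) L')) rgram = pdet (set L \<union> set L') rgram"
    by (simp add: image_Un)
  moreover have "pdet (set (map ((`) h) L)) rgram = pdet (set L) rgram"
    using pdet_rgram_image[OF U L(1)] by simp
  moreover have "pdet (set (map ((`) h) L')) rgram = pdet (set L') rgram"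
    using pdet_rgram_image[OF U L(2)] by simp
  ultimately show ?thesis
    by (simp only: pair_weight_def linked_image[OF U L(1,2)] closed_walk_weight_image[OF U L(1,3)] closed_walk_weight_image[OF U L(2,4)])
qed

text \<open>Turns a pair of walks into a single list, so that \<open>order_type_limit\<close>
  applies to pairs.\<close>

lemma sum_lists_of_append:
  "(\<Sum>L\<in>lists_of V m. \<Sum>L'\<in>lists_of V m'. F L L') = (\<Sum>L\<in>lists_of V (m + m'). F (take m L) (drop m L))"
proof -
  have "(\<Sum>L\<in>lists_of V m. \<Sum>L'\<in>lists_of V m'. F L L') = (\<Sum>(L, L')\<in>lists_of V m \<times> lists_of V m'. F L L')"
    by (rule sum.cartesian_product)
  also have "\<dots> = (\<Sum>L\<in>lists_of V (m + m'). F (take m L) (drop m L))"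
  proof (rule sum.reindex_bij_witness[where j = "\<lambda>(L, L'). L @ L'" and i = "\<lambda>L. (take m L, drop m L)"])
    fix L assume "L \<in> lists_of V (m + m')"
    then show "(take m L, drop m L) \<in> lists_of V m \<times> lists_of V m'"
      using set_take_subset[of m L] set_drop_subset[of m L] by (auto simp: lists_of_def)
  qed (auto simp: lists_of_def)
  finally show ?thesis .
qed

text \<open>The union of two linked walks is connected, so its vertices exceed its simplices in
  number by at most \<open>d\<close>. The double sum is therefore of order \<open>n ^ d\<close>,
  against \<open>n ^ (2 * d)\<close> for the square of a mean.\<close>

lemma convergent_pair_sum:
  assumes "m > 0"
  shows "convergent (\<lambda>n. (\<Sum>L\<in>lists_of (nsub {1..n} (Suc d)) m. \<Sum>L'\<in>lists_of (nsub {1..n} (Suc d)) m.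
    pair_weight L L' / real n ^ card (set L \<union> set L')) / real n ^ d)"
proof -
  have un: "set (take m L) \<union> set (drop m L) = set L" for L :: "nat set list"
    by (metis append_take_drop_id set_append)
  have "convergent (\<lambda>n. (\<Sum>L\<in>lists_of (nsub {1..n} (Suc d)) (m + m).
    pair_weight (take m L) (drop m L) / real n ^ card (set L)) / real n ^ d)"
  proof (rule order_type_limit)
    fix U and h :: "nat \<Rightarrow> nat" and L :: "nat set list"
    assume U: "finite U" "strict_mono_on U h" "L \<in> facet_lists (Suc d) (m + m) U"
    then have len: "take m L \<noteq> []" "drop m L \<noteq> []" and sub: "\<Union>(set (take m L)) \<subseteq> U" "\<Union>(set (drop m L)) \<subseteq> U"
      using assms un[of L] by (auto simp: facet_lists_def)
    show "pair_weight (take m (map ((`) h) L)) (drop m (map ((`) h) L)) = pair_weight (take m L) (drop m L)"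
      unfolding take_map drop_map by (rule pair_weight_image[OF U(1,2) sub len])
  next
    fix U and L :: "nat set list"
    assume U: "finite U" "L \<in> facet_lists (Suc d) (m + m) U" and nz: "pair_weight (take m L) (drop m L) \<noteq> 0"
    have len: "take m L \<noteq> []" "drop m L \<noteq> []" using U assms by (auto simp: facet_lists_def)
    have closed_walk_weight: "closed_walk_weight rgram (take m L) \<noteq> 0" "closed_walk_weight rgram (drop m L) \<noteq> 0" and "linked (take m L) (drop m L)"
      using nz by (auto simp: pair_weight_def split: if_splits)
    then obtain a b where ab: "a \<in> set (take m L)" "b \<in> set (drop m L)" "gram a b \<noteq> 0"
      by (auto simp: linked_def)
    have "rooted (hd (take m L)) (set (take m L) \<union> set (drop m L))"
      using ab by (intro rooted_Un[OF chain_rooted chain_rooted] closed_walk_weight_chain len closed_walk_weight)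
    then have "rooted (hd (take m L)) (set L)" by (simp only: un)
    then have "card (\<Union>(set L)) \<le> d + card (set L)"
      using U by (intro rooted_card_Union) (auto simp: facet_lists_def)
    then show "card U \<le> d + card (set L)" using U by (simp add: facet_lists_def)
  qed
  then show ?thesis unfolding sum_lists_of_append un .
qed

locale hypertree_kernel =
  fixes d n :: nat
  assumes n_pos: "n > 0"
begin

definition facets :: "nat set set" where "facets = nsub {1..n} (Suc d)"

definition rk :: nat where "rk = (n - 1) choose d"

sublocale projection_kernel facets rgram "real n" rk
  unfolding facets_def rk_def using projection_kernel_rgram[of "{1..n}" d] n_pos by simp

lemma facets_cards: "e \<in> facets \<Longrightarrow> finite e \<and> card e = Suc d"
  by (auto simp: facets_def nsub_def intro: finite_subset)

lemma mean_eq': "mean m = (\<Sum>L\<in>lists_of facets (Suc m). (closed_walk_weight rgram L * pdet (set L) rgram) / real n ^ card (set L))"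
  by (simp add: mean_eq incl_def)

text \<open>For unlinked walks an off-diagonal block of the Gram matrix vanishes, and the walks are
  disjoint since \<open>gram e e\<close> is nonzero; so the minor factors.\<close>

lemma incl_unlinked:
  assumes "L \<in> lists_of facets m" "L' \<in> lists_of facets m'" "\<not> linked L L'"
  shows "incl (set L \<union> set L') = incl (set L) * incl (set L')"
proof -
  have z: "gram a b = 0" if "a \<in> set L" "b \<in> set L'" for a b
    using that assms(3) by (auto simp: linked_def)
  have disj: "set L \<inter> set L' = {}"
  proof (rule ccontr)
    assume "set L \<inter> set L' \<noteq> {}"
    then obtain e where e: "e \<in> set L" "e \<in> set L'" by blast
    then have "finite e \<and> card e = Suc d" using assms facets_cards by (auto simp: lists_of_def)
    then show False using z[OF e] by (simp add: gram_self)
  qed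
  then have "pdet (set L \<union> set L') rgram = pdet (set L) rgram * pdet (set L') rgram"
    using z by (intro pdet_block) auto
  moreover have "card (set L \<union> set L') = card (set L) + card (set L')"
    using disj by (intro card_Un_disjoint) auto
  ultimately show ?thesis by (simp add: incl_def power_add)
qed

lemma variance_le:
  "(\<Sum>T\<in>bases. wgt T * (mtrace T rgram (Suc m) - mean m)\<^sup>2) \<le>
    (\<Sum>L\<in>lists_of facets (Suc m). \<Sum>L'\<in>lists_of facets (Suc m). pair_weight L L' / real n ^ card (set L \<union> set L'))"
  unfolding variance_eq
proof (intro sum_mono)
  fix L L' assume L: "L \<in> lists_of facets (Suc m)" "L' \<in> lists_of facets (Suc m)"
  define s where "s = card (set L \<union> set L')"
  have s: "s \<le> card (set L) + card (set L')" by (simp add: s_def card_Un_le)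
  show "closed_walk_weight rgram L * closed_walk_weight rgram L' * (incl (set L \<union> set L') - incl (set L) * incl (set L'))
      \<le> pair_weight L L' / real n ^ card (set L \<union> set L')"
  proof (cases "linked L L'")
    case False
    then show ?thesis using incl_unlinked[OF L False] by (simp add: pair_weight_def)
  next
    case True
    have "\<bar>incl (set L) * incl (set L')\<bar> = \<bar>pdet (set L) rgram * pdet (set L') rgram\<bar> / real n ^ (card (set L) + card (set L'))"
      by (simp add: incl_def abs_mult power_add)
    \<comment> \<open>The union has at most as many elements as the two sets together, and
      \<open>n \<ge> 1\<close>, so the denominator only decreases.\<close>
    also have "\<dots> \<le> \<bar>pdet (set L) rgram * pdet (set L') rgram\<bar> / real n ^ s"
      using s n_pos by (intro divide_left_mono power_increasing) auto
    finally have 1: "\<bar>incl (set L) * incl (set L')\<bar> \<le> \<bar>pdet (set L) rgram * pdet (set L') rgram\<bar> / real n ^ s" .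
    have 2: "\<bar>incl (set L \<union> set L')\<bar> = \<bar>pdet (set L \<union> set L') rgram\<bar> / real n ^ s"
      by (simp add: incl_def s_def)
    have "closed_walk_weight rgram L * closed_walk_weight rgram L' * (incl (set L \<union> set L') - incl (set L) * incl (set L'))
       \<le> \<bar>closed_walk_weight rgram L * closed_walk_weight rgram L'\<bar> * \<bar>incl (set L \<union> set L') - incl (set L) * incl (set L')\<bar>"
      unfolding abs_mult[symmetric] by (rule abs_ge_self)
    also have "\<dots> \<le> \<bar>closed_walk_weight rgram L * closed_walk_weight rgram L'\<bar> * (\<bar>pdet (set L \<union> set L') rgram\<bar> / real n ^ s
         + \<bar>pdet (set L) rgram * pdet (set L') rgram\<bar> / real n ^ s)"
      using 1 2 by (intro mult_left_mono) linarith+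
    also have "\<dots> = pair_weight L L' / real n ^ s"
      using True by (simp only: pair_weight_def if_True times_divide_eq_right add_divide_distrib[symmetric])
    finally show ?thesis by (simp add: s_def)
  qed
qed

section \<open>Factorial bounds for the mean traces\<close>

lemma card_neighbours: 
  assumes "h \<in> facets"
  shows "card {x \<in> facets. gram x h \<noteq> 0} \<le> Suc d * n"
proof -
  \<comment> \<open>A neighbour of \<open>h\<close> arises by exchanging a vertex \<open>w\<close>
    of \<open>h\<close> for some vertex \<open>v\<close>.\<close>
  have "{x \<in> facets. gram x h \<noteq> 0} \<subseteq> (\<lambda>(w, v). insert v (h - {w})) ` (h \<times> {1..n})"
  proof clarify
    fix x assume x: "x \<in> facets" "gram x h \<noteq> 0"
    then obtain v w where vw: "v \<in> x" "w \<in> h" "x - {v} = h - {w}" by (elim gram_nonzeroD)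
    then have "x = insert v (h - {w})" "v \<in> {1..n}" using x by (auto simp: facets_def nsub_def)
    with vw show "x \<in> (\<lambda>(w, v). insert v (h - {w})) ` (h \<times> {1..n})" by blast
  qed
  moreover have fin: "finite (h \<times> {1..n})" using facets_cards[OF assms] by simp
  ultimately have "card {x \<in> facets. gram x h \<noteq> 0} \<le> card (h \<times> {1..n})"
    using surj_card_le by blast
  then show ?thesis using facets_cards[OF assms] by (simp add: card_cartesian_product)
qed

text \<open>The diagonal entry of the kernel, that is, the inclusion probability of a single
  simplex. By \<open>rgram_pdet_bounds\<close> a set \<open>F\<close> is included with probability
  at most \<open>\<theta> ^ card F\<close>.\<close>

definition \<theta> :: real where "\<theta> = (real d + 1) / real n"

lemma \<theta>_nonneg: "\<theta> \<ge> 0" by (simp add: \<theta>_def)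

definition chain_sum :: "nat \<Rightarrow> real" where
  "chain_sum m = (\<Sum>L\<in>lists_of facets m. if chain L then \<theta> ^ card (set L) else 0)"

text \<open>A simplex put in front of a chain either repeats one of its at most \<open>m + 1\<close>
  simplices at no cost, or is one of at most \<open>(d + 1) * n\<close> neighbours of the first
  simplex and costs a factor \<open>\<theta>\<close>; the new ones amount to
  \<open>(d + 1)\<^sup>2\<close>.\<close>

lemma chain_sum_Suc:
  "chain_sum (Suc (Suc m)) \<le> (real (Suc m) + (real d + 1)\<^sup>2) * chain_sum (Suc m)"
proof -
  have finV: "finite facets" by (rule finite_V)
  have "chain_sum (Suc (Suc m)) = (\<Sum>L\<in>lists_of facets (Suc m). \<Sum>x\<in>facets. if chain (x # L) then \<theta> ^ card (set (x # L)) else 0)"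
    unfolding chain_sum_def sum_lists_of_Suc[of _ facets "Suc m"] by (rule sum.swap)
  also have "\<dots> \<le> (\<Sum>L\<in>lists_of facets (Suc m). (real (Suc m) + (real d + 1)\<^sup>2) * (if chain L then \<theta> ^ card (set L) else 0))"
  proof (rule sum_mono)
    fix L assume L: "L \<in> lists_of facets (Suc m)"
    then obtain g L' where gL: "L = g # L'" "g \<in> facets" by (cases L) (auto simp: lists_of_def)
    show "(\<Sum>x\<in>facets. if chain (x # L) then \<theta> ^ card (set (x # L)) else 0)
        \<le> (real (Suc m) + (real d + 1)\<^sup>2) * (if chain L then \<theta> ^ card (set L) else 0)"
    proof (cases "chain L")
      case False
      then show ?thesis using gL by simp
    next
      case True
      define c where "c = \<theta> ^ card (set L)"
      have c: "c \<ge> 0" using \<theta>_nonneg by (simp add: c_def)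
      have "(\<Sum>x\<in>facets. if chain (x # L) then \<theta> ^ card (set (x # L)) else 0)
         \<le> (\<Sum>x\<in>facets. (if x \<in> set L then c else 0) + (if gram x g \<noteq> 0 then \<theta> * c else 0))"
        using c \<theta>_nonneg by (intro sum_mono) (auto simp: gL card_insert_if c_def)
      also have "\<dots> = real (card (facets \<inter> set L)) * c + real (card {x \<in> facets. gram x g \<noteq> 0}) * (\<theta> * c)"
        using finV by (simp add: sum.distrib sum.inter_restrict[symmetric] sum.inter_filter[symmetric])
      also have "\<dots> \<le> real (Suc m) * c + real (Suc d * n) * (\<theta> * c)"
      proof (intro add_mono mult_right_mono)
        have "card (facets \<inter> set L) \<le> card (set L)" by (intro card_mono) auto
        also have "\<dots> \<le> Suc m" using card_length[of L] L by (simp add: lists_of_def)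
        finally show "real (card (facets \<inter> set L)) \<le> real (Suc m)" by simp
        show "real (card {x \<in> facets. gram x g \<noteq> 0}) \<le> real (Suc d * n)"
          using card_neighbours[OF gL(2)] by (simp only: of_nat_le_iff)
      qed (use c \<theta>_nonneg in auto)
      also have "\<dots> = (real (Suc m) + (real d + 1)\<^sup>2) * c"
        using n_pos by (simp add: \<theta>_def power2_eq_square field_simps)
      finally show ?thesis using True by (simp add: c_def)
    qed
  qed
  also have "\<dots> = (real (Suc m) + (real d + 1)\<^sup>2) * chain_sum (Suc m)"
    by (simp add: chain_sum_def sum_distrib_left)
  finally show ?thesis .
qed

lemma card_facets: "real (card facets) * (real d + 1) = real n * real rk"
proof -
  have "card facets * Suc d = n * rk"
    using binomial_absorption[of d n] by (simp add: card_nsub facets_def rk_def mult.commute)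
  then have "real (card facets * Suc d) = real (n * rk)" by (rule arg_cong)
  then show ?thesis by (simp add: algebra_simps)
qed

text \<open>The factor \<open>j + (d + 1)\<^sup>2\<close> of each step is at most
  \<open>j * (1 + (d + 1)\<^sup>2)\<close>, which separates factorial from geometric growth. The
  start is the expected number of simplices, \<open>rk\<close>.\<close>

lemma chain_sum_le: "chain_sum (Suc m) \<le> real rk * (1 + (real d + 1)\<^sup>2) ^ m * fact m"
proof (induction m)
  case 0
  have "chain_sum (Suc 0) = real (card facets) * \<theta>"
    unfolding chain_sum_def sum_lists_of_Suc by simp
  then show ?case using card_facets n_pos by (simp add: \<theta>_def field_simps)
next
  case (Suc m)
  have "chain_sum (Suc (Suc m)) \<le> (real (Suc m) + (real d + 1)\<^sup>2) * chain_sum (Suc m)"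
    by (rule chain_sum_Suc)
  also have "\<dots> \<le> (real (Suc m) * (1 + (real d + 1)\<^sup>2)) * (real rk * (1 + (real d + 1)\<^sup>2) ^ m * fact m)"
  proof (intro mult_mono Suc)
    have "1 * (real d + 1)\<^sup>2 \<le> real (Suc m) * (real d + 1)\<^sup>2" by (intro mult_right_mono) auto
    then show "real (Suc m) + (real d + 1)\<^sup>2 \<le> real (Suc m) * (1 + (real d + 1)\<^sup>2)"
      by (simp add: algebra_simps)
    show "0 \<le> chain_sum (Suc m)" unfolding chain_sum_def using \<theta>_nonneg by (intro sum_nonneg) auto
  qed auto
  also have "\<dots> = real rk * (1 + (real d + 1)\<^sup>2) ^ Suc m * fact (Suc m)"
    by (simp only: power_Suc fact_Suc mult_ac of_nat_mult)
  finally show ?case .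
qed

text \<open>Each of the \<open>m + 1\<close> entries along a walk is at most \<open>d + 1\<close> in
  absolute value, and the inclusion probability is at most the power of \<open>\<theta>\<close> in
  \<open>chain_sum\<close>. The last estimates give up some precision to reach the shape C^j
  j!.\<close>

lemma mean_le: "mean m \<le> real rk * ((real d + 1) * (1 + (real d + 1)\<^sup>2)) ^ Suc m * fact (Suc m)"
proof -
  have "mean m \<le> (\<Sum>L\<in>lists_of facets (Suc m). (real d + 1) ^ Suc m * (if chain L then \<theta> ^ card (set L) else 0))"
    unfolding mean_eq
  proof (rule sum_mono)
    fix L assume L: "L \<in> lists_of facets (Suc m)"
    then have ne: "L \<noteq> []" and sub: "set L \<subseteq> facets" by (auto simp: lists_of_def)
    show "closed_walk_weight rgram L * incl (set L) \<le> (real d + 1) ^ Suc m * (if chain L then \<theta> ^ card (set L) else 0)"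
    proof (cases "chain L")
      case False
      then have "closed_walk_weight rgram L = 0" using closed_walk_weight_chain[OF ne] by blast
      then show ?thesis using False by simp
    next
      case True
      have "\<bar>closed_walk_weight rgram L\<bar> \<le> (real d + 1) ^ Suc (length (tl L))"
        unfolding closed_walk_weight_def
      proof (rule abs_walk_weight_le)
        fix e assume "e \<in> insert (hd L) (insert (hd L) (set (tl L)))"
        then have "e \<in> set L" using ne by (cases L) auto
        then show "finite e \<and> card e = Suc d" using sub facets_cards by blast
      qed
      then have 1: "\<bar>closed_walk_weight rgram L\<bar> \<le> (real d + 1) ^ Suc m" using L by (simp add: lists_of_def)
      have 2: "incl (set L) \<ge> 0" "incl (set L) \<le> \<theta> ^ card (set L)"
        using rgram_pdet_bounds[OF _ sub[unfolded facets_def]] by (simp_all add: incl_def \<theta>_def power_divide divide_right_mono)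
      have "closed_walk_weight rgram L * incl (set L) \<le> \<bar>closed_walk_weight rgram L\<bar> * incl (set L)"
        using 2 by (intro mult_right_mono) auto
      also have "\<dots> \<le> (real d + 1) ^ Suc m * \<theta> ^ card (set L)"
        using 1 2 by (intro mult_mono) auto
      finally show ?thesis using True by simp
    qed
  qed
  also have "\<dots> = (real d + 1) ^ Suc m * chain_sum (Suc m)"
    by (simp add: chain_sum_def sum_distrib_left)
  also have "\<dots> \<le> (real d + 1) ^ Suc m * (real rk * (1 + (real d + 1)\<^sup>2) ^ m * fact m)"
    by (intro mult_left_mono chain_sum_le) auto
  also have "\<dots> \<le> (real d + 1) ^ Suc m * (real rk * (1 + (real d + 1)\<^sup>2) ^ Suc m * fact (Suc m))"
  proof (intro mult_left_mono mult_mono)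
    show "(1 + (real d + 1)\<^sup>2) ^ m \<le> (1 + (real d + 1)\<^sup>2) ^ Suc m"
      by (rule power_increasing) auto
    show "(fact m :: real) \<le> fact (Suc m)" by (rule fact_mono) auto
  qed auto
  also have "\<dots> = real rk * ((real d + 1) * (1 + (real d + 1)\<^sup>2)) ^ Suc m * fact (Suc m)"
    by (simp only: power_mult_distrib mult_ac)
  finally show ?thesis .
qed

end

section \<open>Lattices and determinants\<close>

lemma pdet_coladd:
  fixes A :: "'a \<Rightarrow> 'a \<Rightarrow> int"
  assumes "finite J" "p \<in> J" "q \<in> J" "p \<noteq> q"
  shows "pdet J (repcol A q (\<lambda>i. A i q + c * A i p)) = pdet J A"
proof -
  have "pdet J (repcol A q (\<lambda>i. A i q + c * A i p))
     = (\<Sum>f\<in>{q, p}. (if f = q then 1 else c) * pdet J (repcol A q (\<lambda>i. A i f)))"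
    unfolding pdet_repcol_sum[OF assms(1,3)] using assms(4) by simp
  moreover have "pdet J (repcol A q (\<lambda>i. A i p)) = 0"
    by (rule pdet_identical_columns[OF assms(1-4)]) (use assms(4) in \<open>simp add: repcol_def\<close>)
  ultimately show ?thesis using assms(4) by simp
qed

lemma coladd_lattice:
  fixes A :: "'a \<Rightarrow> 'a \<Rightarrow> int"
  assumes "finite J" "p \<in> J" "q \<in> J" "p \<noteq> q"
  shows "(\<Sum>j\<in>J. x j * repcol A q (\<lambda>i. A i q + c * A i p) i j) = (\<Sum>j\<in>J. (x(p := x p + c * x q)) j * A i j)"
proof -
  have "(\<Sum>j\<in>J. x j * repcol A q (\<lambda>i. A i q + c * A i p) i j)
      = (\<Sum>j\<in>J. x j * A i j + (if j = q then c * x q * A i p else 0))"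
    by (intro sum.cong refl) (simp add: repcol_def algebra_simps)
  also have "\<dots> = (\<Sum>j\<in>J. x j * A i j) + c * x q * A i p"
    using assms by (simp add: sum.distrib)
  also have "\<dots> = (\<Sum>j\<in>J. x j * A i j + (if j = p then c * x q * A i p else 0))"
    using assms by (simp add: sum.distrib)
  also have "\<dots> = (\<Sum>j\<in>J. (x(p := x p + c * x q)) j * A i j)"
    by (intro sum.cong refl) (simp add: algebra_simps)
  finally show ?thesis .
qed

text \<open>Two consequences of unimodular column operations are kept: the determinants agree, and
  the column lattice of \<open>A'\<close> lies in that of \<open>A\<close>. Containment in this
  direction transfers a cover by cosets from \<open>A'\<close> to \<open>A\<close>.\<close>

definition col_le :: "'a set \<Rightarrow> ('a \<Rightarrow> 'a \<Rightarrow> int) \<Rightarrow> ('a \<Rightarrow> 'a \<Rightarrow> int) \<Rightarrow> bool" where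
  "col_le J A' A \<longleftrightarrow> pdet J A' = pdet J A \<and>
    (\<forall>x. \<exists>x'. \<forall>i. (\<Sum>j\<in>J. x j * A' i j) = (\<Sum>j\<in>J. x' j * A i j))"

lemma col_le_refl: "col_le J A A"
  by (auto simp: col_le_def)

lemma col_le_trans: "col_le J A B \<Longrightarrow> col_le J B C \<Longrightarrow> col_le J A C"
  unfolding col_le_def by metis

lemma col_le_coladd:
  assumes "finite J" "p \<in> J" "q \<in> J" "p \<noteq> q"
  shows "col_le J (repcol A q (\<lambda>i. A i q + c * A i p)) A"
  unfolding col_le_def using pdet_coladd[OF assms] coladd_lattice[OF assms] by blast

text \<open>Euclid's algorithm on the row \<open>a\<close>.\<close>

lemma clear_row:
  assumes J: "finite J" "a \<in> J"
  shows "\<exists>A'. col_le J A' A \<and> (\<forall>j\<in>J-{a}. A' a j = 0)"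
proof (induction "nat (\<Sum>j\<in>J. \<bar>A a j\<bar>)" arbitrary: A rule: less_induct)
  case less
  show ?case
  proof (cases "\<exists>p\<in>J. \<exists>q\<in>J. p \<noteq> q \<and> A a p \<noteq> 0 \<and> A a q \<noteq> 0 \<and> \<bar>A a p\<bar> \<le> \<bar>A a q\<bar>")
    case True
    then obtain p q where pq: "p \<in> J" "q \<in> J" "p \<noteq> q" "A a p \<noteq> 0" "A a q \<noteq> 0" "\<bar>A a p\<bar> \<le> \<bar>A a q\<bar>" by blast
    \<comment> \<open>The sign for which adding \<open>c\<close> times column \<open>p\<close> to
      column \<open>q\<close> lowers the absolute value of the entry in row \<open>a\<close> by
      \<open>\<bar>A a p\<bar>\<close>.\<close>
    define c where "c = - (sgn (A a p) * sgn (A a q))"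
    define B where "B = repcol A q (\<lambda>i. A i q + c * A i p)"
    have Bq: "\<bar>B a q\<bar> < \<bar>A a q\<bar>"
    proof -
      have "c * A a p = - (sgn (A a q) * \<bar>A a p\<bar>)"
        by (simp add: c_def mult_ac sgn_if)
      moreover have "A a q = sgn (A a q) * \<bar>A a q\<bar>" by (simp add: sgn_if)
      ultimately have "B a q = sgn (A a q) * (\<bar>A a q\<bar> - \<bar>A a p\<bar>)"
        unfolding B_def repcol_def by (simp add: algebra_simps)
      then have "\<bar>B a q\<bar> = \<bar>A a q\<bar> - \<bar>A a p\<bar>"
        using pq by (simp add: abs_mult abs_sgn_eq)
      then show ?thesis using pq by simp
    qed
    have "(\<Sum>j\<in>J. \<bar>B a j\<bar>) < (\<Sum>j\<in>J. \<bar>A a j\<bar>)"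
    proof (rule sum_strict_mono_ex1)
      show "\<forall>j\<in>J. \<bar>B a j\<bar> \<le> \<bar>A a j\<bar>" using Bq by (simp add: B_def repcol_def)
      show "\<exists>j\<in>J. \<bar>B a j\<bar> < \<bar>A a j\<bar>" using Bq pq by blast
    qed (rule J)
    then have "nat (\<Sum>j\<in>J. \<bar>B a j\<bar>) < nat (\<Sum>j\<in>J. \<bar>A a j\<bar>)"
      by (smt (verit) nat_less_eq_zless sum_nonneg abs_ge_zero)
    from less[of B, OF this] obtain A' where "col_le J A' B" "\<forall>j\<in>J-{a}. A' a j = 0" by blast
    moreover have "col_le J B A"
      unfolding B_def by (rule col_le_coladd[OF J(1) pq(1-3)])
    ultimately show ?thesis using col_le_trans by blast
  next
    case False
    then have gt: "\<not> \<bar>A a p\<bar> \<le> \<bar>A a q\<bar>"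
      if "p \<in> J" "q \<in> J" "p \<noteq> q" "A a p \<noteq> 0" "A a q \<noteq> 0" for p q
      using that by blast
    show ?thesis
    proof (cases "\<exists>q\<in>J-{a}. A a q \<noteq> 0")
      case no: False
      then show ?thesis using col_le_refl by blast
    next
      case True
      then obtain q where q: "q \<in> J" "q \<noteq> a" "A a q \<noteq> 0" by blast
      have others: "A a j = 0" if "j \<in> J" "j \<noteq> q" for j
      proof (rule ccontr)
        assume nz: "A a j \<noteq> 0"
        show False
          using gt[OF that(1) q(1) that(2) nz q(3)] gt[OF q(1) that(1) that(2)[symmetric] q(3) nz] by linarith
      qed
      \<comment> \<open>The only nonzero entry of row \<open>a\<close> sits in column
        \<open>q\<close>. Two column additions move it to column \<open>a\<close>; exchanging the
        columns would change the sign of the determinant.\<close>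
      define B where "B = repcol A a (\<lambda>i. A i a + 1 * A i q)"
      define B' where "B' = repcol B q (\<lambda>i. B i q + (- 1) * B i a)"
      have "col_le J B A" unfolding B_def using q J by (intro col_le_coladd) auto
      moreover have "col_le J B' B" unfolding B'_def using q J by (intro col_le_coladd) auto
      moreover have "B' a j = 0" if "j \<in> J - {a}" for j
        using others[of j] others[of a] that q J by (auto simp: B'_def B_def repcol_def)
      ultimately show ?thesis using col_le_trans by blast
    qed
  qed
qed

text \<open>The column lattice has index at most the absolute determinant. Once row \<open>a\<close>
  is cleared outside the pivot \<open>g\<close>, the determinant is \<open>g\<close> times the
  smaller one, and residues modulo \<open>\<bar>g\<bar>\<close> in coordinate \<open>a\<close>
  combine with representatives for the other coordinates.\<close>

lemma lattice_cover:
  fixes A :: "'a \<Rightarrow> 'a \<Rightarrow> int"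
  assumes "finite I" "pdet I A \<noteq> 0"
  shows "\<exists>R. finite R \<and> int (card R) \<le> \<bar>pdet I A\<bar> \<and>
    (\<forall>z. \<exists>r\<in>R. \<exists>x. \<forall>i\<in>I. z i = r i + (\<Sum>j\<in>I. x j * A i j))"
  using assms
proof (induction I arbitrary: A rule: finite_induct)
  case empty
  then show ?case by (intro exI[of _ "{\<lambda>_. 0}"]) auto
next
  case (insert a I)
  let ?J = "insert a I"
  obtain A' where A': "col_le ?J A' A" "\<And>j. j \<in> I \<Longrightarrow> A' a j = 0"
    using clear_row[of ?J a A] insert.hyps by auto
  define g where "g = A' a a"
  have det: "pdet ?J A = g * pdet I A'"
    using A' insert.hyps by (simp add: col_le_def pdet_insert g_def)
  then have "pdet I A' \<noteq> 0" "g \<noteq> 0" using insert.prems by auto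
  from insert.IH[OF this(1)] obtain R where R: "finite R" "int (card R) \<le> \<bar>pdet I A'\<bar>"
    "\<And>z. \<exists>r\<in>R. \<exists>x. \<forall>i\<in>I. z i = r i + (\<Sum>j\<in>I. x j * A' i j)" by blast
  define R' where "R' = (\<lambda>(t, r). r(a := t)) ` ({0..<\<bar>g\<bar>} \<times> R)"
  have "card R' \<le> card ({0..<\<bar>g\<bar>} \<times> R)"
    unfolding R'_def using R by (intro card_image_le) auto
  also have "\<dots> = nat \<bar>g\<bar> * card R" by (simp add: card_cartesian_product)
  finally have "int (card R') \<le> int (nat \<bar>g\<bar> * card R)" by (simp only: of_nat_le_iff)
  also have "\<dots> = \<bar>g\<bar> * int (card R)" by simp
  also have "\<dots> \<le> \<bar>pdet ?J A\<bar>"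
    unfolding det abs_mult using R(2) by (intro mult_left_mono) auto
  finally have card: "int (card R') \<le> \<bar>pdet ?J A\<bar>" .
  have "\<exists>r\<in>R'. \<exists>x. \<forall>i\<in>?J. z i = r i + (\<Sum>j\<in>?J. x j * A i j)" for z
  proof -
    define t where "t = z a mod \<bar>g\<bar>"
    have t: "0 \<le> t" "t < \<bar>g\<bar>" using \<open>g \<noteq> 0\<close> by (auto simp: t_def)
    have "g dvd z a - t" unfolding t_def by (metis abs_dvd_iff minus_mod_eq_mult_div dvd_triv_left)
    then obtain y where y: "z a = t + g * y" by (metis dvd_def diff_eq_eq add.commute)
    obtain r x where rx: "r \<in> R" "\<And>i. i \<in> I \<Longrightarrow> z i - y * A' i a = r i + (\<Sum>j\<in>I. x j * A' i j)"
      using R(3)[of "\<lambda>i. z i - y * A' i a"] by blast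
    have J_sum: "(\<Sum>j\<in>?J. (x(a := y)) j * A' i j) = y * A' i a + (\<Sum>j\<in>I. x j * A' i j)" for i
    proof -
      have "(\<Sum>j\<in>I. (x(a := y)) j * A' i j) = (\<Sum>j\<in>I. x j * A' i j)"
        using insert.hyps by (intro sum.cong) auto
      then show ?thesis using insert.hyps by simp
    qed
    obtain x' where x': "\<And>i. (\<Sum>j\<in>?J. (x(a := y)) j * A' i j) = (\<Sum>j\<in>?J. x' j * A i j)"
      using A'(1) unfolding col_le_def by blast
    have "z i = (r(a := t)) i + (\<Sum>j\<in>?J. x' j * A i j)" if "i \<in> ?J" for i
    proof (cases "i = a")
      case True
      have "(\<Sum>j\<in>I. x j * A' a j) = 0" using A'(2) by simp
      then show ?thesis using True y unfolding x'[symmetric] J_sum by (simp add: g_def)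
    next
      case False
      then have "i \<in> I" using that by simp
      then show ?thesis using rx(2)[of i] False unfolding x'[symmetric] J_sum by simp
    qed
    moreover have "r(a := t) \<in> R'" unfolding R'_def using rx(1) t by force
    ultimately show ?thesis by blast
  qed
  then show ?case using card R(1) by (intro exI[of _ R']) (auto simp: R'_def)
qed

lemma pdet_enum:
  assumes "bij_betw f {0..<m} I"
  shows "pdet I G = det (mat m m (\<lambda>(i, j). G (f i) (f j)))"
proof -
  have "I = f ` {0..<m}" "inj_on f {0..<m}" using assms by (auto simp: bij_betw_def)
  then show ?thesis by (simp add: pdet_image pdet_eq_det)
qed

text \<open>Multiplicativity of the determinant for the transpose of A times K times A, the form
  into which \<open>gram_cone_expansion\<close> brings the Gram matrix.\<close>

lemma pdet_congruence:
  fixes A K :: "'a \<Rightarrow> 'a \<Rightarrow> 'b::comm_ring_1"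
  assumes I: "finite I"
  shows "pdet I (\<lambda>i j. \<Sum>a\<in>I. \<Sum>b\<in>I. A a i * K a b * A b j) = (pdet I A)\<^sup>2 * pdet I K"
proof -
  define m where "m = card I"
  obtain f where f: "bij_betw f {0..<m} I"
    using ex_bij_betw_nat_finite[OF I] by (auto simp: m_def)
  define MA where "MA = mat m m (\<lambda>(i, j). A (f i) (f j))"
  define MK where "MK = mat m m (\<lambda>(i, j). K (f i) (f j))"
  have c: "MA \<in> carrier_mat m m" "MK \<in> carrier_mat m m" "transpose_mat MA \<in> carrier_mat m m"
    by (simp_all add: MA_def MK_def)
  have sumI: "(\<Sum>a\<in>I. h a) = (\<Sum>i = 0..<m. h (f i))" for h :: "'a \<Rightarrow> 'b"
    using sum.reindex_bij_betw[OF f, of h] by simp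
  have "mat m m (\<lambda>(i, j). \<Sum>a\<in>I. \<Sum>b\<in>I. A a (f i) * K a b * A b (f j)) = transpose_mat MA * (MK * MA)"
    by (rule eq_matI) (auto simp: MA_def MK_def scalar_prod_def sumI sum_distrib_left mult.assoc)
  then have "pdet I (\<lambda>i j. \<Sum>a\<in>I. \<Sum>b\<in>I. A a i * K a b * A b j) = det (transpose_mat MA * (MK * MA))"
    using pdet_enum[OF f, of "\<lambda>i j. \<Sum>a\<in>I. \<Sum>b\<in>I. A a i * K a b * A b j"] by simp
  also have "\<dots> = det MA * (det MK * det MA)"
    using det_mult[OF c(3) mult_carrier_mat[OF c(2,1)]] det_mult[OF c(2,1)] det_transpose[OF c(1)] by simp
  also have "\<dots> = (pdet I A)\<^sup>2 * pdet I K"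
    unfolding pdet_enum[OF f, of A] pdet_enum[OF f, of K] MA_def MK_def by (simp add: power2_eq_square mult_ac)
  finally show ?thesis .
qed

text \<open>The kernel vector has integer entries, so it can act as an integer-valued functional on
  chains in \<open>D_nonzero\<close>.\<close>

lemma pdet_0_left_kernel:
  fixes A :: "'a \<Rightarrow> 'a \<Rightarrow> int"
  assumes I: "finite I" and "pdet I A = 0"
  obtains y where "\<exists>i\<in>I. y i \<noteq> 0" "\<And>j. j \<in> I \<Longrightarrow> (\<Sum>i\<in>I. y i * A i j) = 0"
proof -
  define m where "m = card I"
  obtain f where f: "bij_betw f {0..<m} I"
    using ex_bij_betw_nat_finite[OF I] by (auto simp: m_def)
  define M where "M = mat m m (\<lambda>(i, j). A (f j) (f i))"
  have M: "M \<in> carrier_mat m m" by (simp add: M_def)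
  have "transpose_mat M = mat m m (\<lambda>(i, j). A (f i) (f j))"
    by (rule eq_matI) (auto simp: M_def)
  then have "det M = 0" using det_transpose[OF M] pdet_enum[OF f, of A] assms(2) by simp
  then obtain v where v: "v \<in> carrier_vec m" "v \<noteq> 0\<^sub>v m" "M *\<^sub>v v = 0\<^sub>v m"
    using det_0_iff_vec_prod_zero[OF M] by blast
  define f' where "f' = inv_into {0..<m} f"
  have f': "f' (f i) = i" if "i < m" for i
    using f that by (simp add: f'_def bij_betw_def inv_into_f_f)
  define y where "y i = v $ (f' i)" for i
  have "\<exists>i\<in>I. y i \<noteq> 0"
  proof (rule ccontr)
    assume *: "\<not> ?thesis"
    have "v $ i = 0" if "i < m" for i
    proof -
      have "f i \<in> I" using f that by (auto simp: bij_betw_def)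
      then have "y (f i) = 0" using * by blast
      then show ?thesis using f'[OF that] by (simp add: y_def)
    qed
    then have "v = 0\<^sub>v m" using v(1) by (intro eq_vecI) auto
    with v(2) show False ..
  qed
  moreover have "(\<Sum>i\<in>I. y i * A i j) = 0" if j: "j \<in> I" for j
  proof -
    obtain l where l: "l < m" "f l = j" using f j by (auto simp: bij_betw_def)
    have "(\<Sum>i\<in>I. y i * A i j) = (\<Sum>i = 0..<m. y (f i) * A (f i) j)"
      using sum.reindex_bij_betw[OF f, of "\<lambda>i. y i * A i j"] by simp
    also have "\<dots> = (\<Sum>i = 0..<m. A (f i) (f l) * v $ i)"
      using f' l by (intro sum.cong refl) (simp add: y_def)
    also have "\<dots> = (M *\<^sub>v v) $ l"
      using l v(1) by (simp add: M_def scalar_prod_def)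
    finally show ?thesis using v(3) l by simp
  qed
  ultimately show ?thesis using that by blast
qed

section \<open>Cones with apex \<open>n\<close> and the deterministic factor\<close>

lemma vertex_sign_max:
  assumes "\<And>w. w \<in> t \<Longrightarrow> w < n" "finite t"
  shows "vertex_sign (insert n t) n = (-1) ^ card t"
proof -
  have "{w \<in> insert n t. w < n} = t" using assms by auto
  then show ?thesis by (simp add: vertex_sign_def)
qed

lemma vertex_sign_insert_max: "v < n \<Longrightarrow> vertex_sign (insert n t) v = vertex_sign t v"
proof -
  assume "v < n"
  then have "{w \<in> insert n t. w < v} = {w \<in> t. w < v}" by auto
  then show ?thesis by (simp add: vertex_sign_def)
qed

lemma nsub_interval_less: "(n::nat) > 0 \<Longrightarrow> t \<in> nsub {1..n-1} m \<Longrightarrow> w \<in> t \<Longrightarrow> w < n"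
proof -
  assume *: "n > 0" "t \<in> nsub {1..n-1} m" "w \<in> t"
  then have "w \<in> {1..n-1}" unfolding nsub_def by blast
  with *(1) show "w < n" by auto
qed

lemma insert_max_in_nsub:
  assumes "(n::nat) > 0" "t \<in> nsub {1..n-1} m"
  shows "insert n t \<in> nsub {1..n} (Suc m)"
proof -
  have "finite t" using assms(2) nsub_finite by blast
  moreover have "n \<notin> t" using nsub_interval_less[OF assms] by blast
  moreover have "t \<subseteq> {1..n}"
  proof -
    have "t \<subseteq> {1..n-1}" using assms(2) by (simp add: nsub_def)
    also have "\<dots> \<subseteq> {1..n}" by auto
    finally show ?thesis .
  qed
  ultimately show ?thesis using assms by (auto simp: nsub_def)
qed

text \<open>The boundaries of the facets containing \<open>n\<close> form a basis of the cycles, and the coordinates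
  in this basis are, up to sign, the coefficients of the faces not containing \<open>n\<close>.\<close>

lemma incidence_cone_expansion:
  assumes n: "n > 0" and e: "e \<in> nsub {1..n} (Suc d)"
  shows "incidence s e = (-1) ^ d * (\<Sum>\<sigma>\<in>nsub {1..n-1} d. incidence \<sigma> e * incidence s (insert n \<sigma>))"
proof -
  have fe: "finite e" "card e = Suc d" "e \<subseteq> {1..n}"
    using e nsub_finite by (auto simp: nsub_def intro: finite_subset)
  show ?thesis
  proof (cases "n \<in> e")
    case True
    \<comment> \<open>If \<open>e\<close> contains \<open>n\<close>, it is itself a cone, and its
      base \<open>\<tau>\<close> is its only facet avoiding \<open>n\<close>.\<close>
    define \<tau> where "\<tau> = e - {n}"
    have e_eq: "e = insert n \<tau>" using True by (auto simp: \<tau>_def)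
    have \<tau>: "\<tau> \<in> nsub {1..n-1} d" using fe True by (auto simp: \<tau>_def nsub_def card_Diff_singleton)
    have "(\<Sum>\<sigma>\<in>nsub {1..n-1} d. incidence \<sigma> e * incidence s (insert n \<sigma>)) = (\<Sum>\<sigma>\<in>{\<tau>}. incidence \<sigma> e * incidence s (insert n \<sigma>))"
    proof (rule sum.mono_neutral_right)
      show "\<forall>\<sigma>\<in>nsub {1..n-1} d - {\<tau>}. incidence \<sigma> e * incidence s (insert n \<sigma>) = 0"
      proof
        fix \<sigma> assume \<sigma>: "\<sigma> \<in> nsub {1..n-1} d - {\<tau>}"
        have "incidence \<sigma> e = 0"
        proof (rule ccontr)
          assume "incidence \<sigma> e \<noteq> 0"
          then obtain v where v: "v \<in> e" "\<sigma> = e - {v}" using incidence_nonzeroD by blast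
          have "n \<notin> \<sigma>" using nsub_interval_less[OF n, of \<sigma> d n] \<sigma> by auto
          then have "\<sigma> = \<tau>" using v True by (auto simp: \<tau>_def)
          then show False using \<sigma> by simp
        qed
        then show "incidence \<sigma> e * incidence s (insert n \<sigma>) = 0" by simp
      qed
    qed (use \<tau> in auto)
    also have "\<dots> = (-1) ^ d * incidence s e"
    proof -
      have "incidence \<tau> e = vertex_sign e n" unfolding \<tau>_def using fe True by (intro incidence_Diff)
      also have "\<dots> = (-1) ^ d"
        unfolding e_eq using vertex_sign_max[OF nsub_interval_less[OF n \<tau>]] nsub_finite[OF _ \<tau>] \<tau>
        by (simp add: nsub_def)
      finally show ?thesis by (simp add: e_eq)
    qed
    finally show ?thesis by (simp flip: mult.assoc power_mult_distrib)
  next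
    case False
    \<comment> \<open>Otherwise the double boundary of the cone \<open>u\<close> over
      \<open>e\<close> vanishes; solved for the boundary of \<open>e\<close>, this relation
      expresses it by the boundaries of the cones over the facets of \<open>e\<close>.\<close>
    define u where "u = insert n e"
    have less: "w < n" if "w \<in> e" for w using that fe False by (metis atLeastAtMost_iff le_neq_implies_less subsetD)
    have u: "finite u" using fe by (simp add: u_def)
    have sub: "e - {v} \<in> nsub {1..n-1} d" if "v \<in> e" for v
    proof -
      have "e - {v} \<subseteq> {1..n-1}"
      proof
        fix w assume "w \<in> e - {v}"
        then have "w \<in> {1..n}" "w < n" using fe(3) less by auto
        then show "w \<in> {1..n-1}" by auto
      qed
      moreover have "card (e - {v}) = d" using that fe by (simp add: card_Diff_singleton)
      ultimately show ?thesis by (simp add: nsub_def)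
    qed
    have "0 = (\<Sum>g\<in>Pow u. incidence s g * incidence g u)"
      using u by (intro incidence_incidence[symmetric]) auto
    also have "\<dots> = (\<Sum>g\<in>Pow u. incidence g u * incidence s g)" by (simp add: mult.commute)
    also have "\<dots> = (\<Sum>v\<in>u. vertex_sign u v * incidence s (u - {v}))"
      using u by (intro sum_incidence) auto
    also have "\<dots> = vertex_sign u n * incidence s e + (\<Sum>v\<in>e. vertex_sign u v * incidence s (u - {v}))"
      using fe False by (simp add: u_def)
    also have "vertex_sign u n = - ((-1) ^ d)"
      unfolding u_def using vertex_sign_max[of e n] less fe by simp
    also have "(\<Sum>v\<in>e. vertex_sign u v * incidence s (u - {v})) = (\<Sum>v\<in>e. vertex_sign e v * incidence s (insert n (e - {v})))"
    proof (intro sum.cong refl arg_cong2[where f="(*)"])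
      fix v assume v: "v \<in> e"
      show "vertex_sign u v = vertex_sign e v" unfolding u_def using less[OF v] by (rule vertex_sign_insert_max)
      show "incidence s (u - {v}) = incidence s (insert n (e - {v}))"
        using less[OF v] by (simp add: u_def insert_Diff_if)
    qed
    also have "\<dots> = (\<Sum>\<sigma>\<in>nsub {1..n-1} d. incidence \<sigma> e * incidence s (insert n \<sigma>))"
      using sub by (intro sum_incidence[where \<phi> = "\<lambda>\<sigma>. incidence s (insert n \<sigma>)", symmetric]) auto
    finally have "(\<Sum>\<sigma>\<in>nsub {1..n-1} d. incidence \<sigma> e * incidence s (insert n \<sigma>)) = (-1) ^ d * incidence s e" by simp
    then show ?thesis by (simp flip: mult.assoc power_mult_distrib)
  qed
qed

text \<open>Both boundaries are expanded in the cone basis and the two signs multiply to 1. In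
  matrix terms, the Gram matrix is congruent, through the incidences with ridges avoiding
  \<open>n\<close>, to the Gram matrix of the cones.\<close>

lemma gram_cone_expansion:
  assumes n: "n > 0" and e: "e \<in> nsub {1..n} (Suc d)" and f: "f \<in> nsub {1..n} (Suc d)"
  shows "gram e f = (\<Sum>\<sigma>\<in>nsub {1..n-1} d. \<Sum>\<tau>\<in>nsub {1..n-1} d.
    incidence \<sigma> e * gram (insert n \<sigma>) (insert n \<tau>) * incidence \<tau> f)"
proof -
  let ?R = "nsub {1..n-1} d" and ?S = "nsub {1..n} d"
  have finS: "finite ?S" by simp
  have gr: "gram g h = (\<Sum>s\<in>?S. incidence s g * incidence s h)" if "g \<in> nsub {1..n} (Suc d)" for g h
    using that nsub_finite[OF _ that] by (intro gram_eq_sum) (auto simp: Diff_in_nsub)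
  have "gram e f = (\<Sum>s\<in>?S. incidence s e * incidence s f)" by (rule gr[OF e])
  also have "\<dots> = (\<Sum>s\<in>?S. ((-1) ^ d * (-1) ^ d) * ((\<Sum>\<sigma>\<in>?R. incidence \<sigma> e * incidence s (insert n \<sigma>)) * (\<Sum>\<tau>\<in>?R. incidence \<tau> f * incidence s (insert n \<tau>))))"
    by (intro sum.cong refl) (subst incidence_cone_expansion[OF n e], subst incidence_cone_expansion[OF n f], simp only: mult_ac)
  also have "\<dots> = (\<Sum>s\<in>?S. \<Sum>\<sigma>\<in>?R. \<Sum>\<tau>\<in>?R. (incidence \<sigma> e * incidence \<tau> f) * (incidence s (insert n \<sigma>) * incidence s (insert n \<tau>)))"
    by (simp only: sum_product flip: power_mult_distrib) (simp add: mult_ac)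
  also have "\<dots> = (\<Sum>\<sigma>\<in>?R. \<Sum>s\<in>?S. \<Sum>\<tau>\<in>?R. (incidence \<sigma> e * incidence \<tau> f) * (incidence s (insert n \<sigma>) * incidence s (insert n \<tau>)))"
    by (rule sum.swap)
  also have "\<dots> = (\<Sum>\<sigma>\<in>?R. \<Sum>\<tau>\<in>?R. \<Sum>s\<in>?S. (incidence \<sigma> e * incidence \<tau> f) * (incidence s (insert n \<sigma>) * incidence s (insert n \<tau>)))"
    by (intro sum.cong refl sum.swap)
  also have "\<dots> = (\<Sum>\<sigma>\<in>?R. \<Sum>\<tau>\<in>?R. incidence \<sigma> e * gram (insert n \<sigma>) (insert n \<tau>) * incidence \<tau> f)"
  proof (intro sum.cong refl)
    fix \<sigma> \<tau> assume "\<sigma> \<in> ?R"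
    then have "gram (insert n \<sigma>) (insert n \<tau>) = (\<Sum>s\<in>?S. incidence s (insert n \<sigma>) * incidence s (insert n \<tau>))"
      by (intro gr insert_max_in_nsub n)
    then show "(\<Sum>s\<in>?S. (incidence \<sigma> e * incidence \<tau> f) * (incidence s (insert n \<sigma>) * incidence s (insert n \<tau>)))
        = incidence \<sigma> e * gram (insert n \<sigma>) (insert n \<tau>) * incidence \<tau> f"
      unfolding sum_distrib_left[symmetric] by (simp only: mult_ac)
  qed
  finally show ?thesis .
qed

lemma incidence_insert_max:
  assumes "\<And>w. w \<in> t \<Longrightarrow> w < n" "n \<notin> s" "finite t"
  shows "incidence (insert n s) (insert n t) = incidence s t"
proof -
  have "n \<notin> t" using assms(1) by blast
  then have "incidence (insert n s) (insert n t) =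
     (if insert n s = insert n t - {n} then vertex_sign (insert n t) n else 0)
     + (\<Sum>v\<in>t. if insert n s = insert n t - {v} then vertex_sign (insert n t) v else 0)"
    unfolding incidence_def using assms(3) by simp
  also have "insert n s \<noteq> insert n t - {n}" by blast
  then have "(if insert n s = insert n t - {n} then vertex_sign (insert n t) n else 0) = 0" by simp
  also have "(\<Sum>v\<in>t. if insert n s = insert n t - {v} then vertex_sign (insert n t) v else 0)
      = (\<Sum>v\<in>t. if s = t - {v} then vertex_sign t v else 0)"
  proof (intro sum.cong refl)
    fix v assume v: "v \<in> t"
    then have "insert n t - {v} = insert n (t - {v})" using assms(1) by auto
    then have "insert n s = insert n t - {v} \<longleftrightarrow> s = t - {v}"
      using assms(2) \<open>n \<notin> t\<close> by (metis Diff_iff insert_ident)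
    then show "(if insert n s = insert n t - {v} then vertex_sign (insert n t) v else 0) = (if s = t - {v} then vertex_sign t v else 0)"
      using vertex_sign_insert_max[OF assms(1)[OF v]] by simp
  qed
  finally show ?thesis by (simp add: incidence_def)
qed

text \<open>A facet shared by two cones is either their base, which happens only for
  \<open>\<sigma> = \<tau>\<close> and contributes 1, or a cone over a shared facet of
  \<open>\<sigma>\<close> and \<open>\<tau>\<close>; the latter reproduce the Gram matrix one
  dimension lower.\<close>

lemma gram_insert_max:
  assumes n: "n > 0" and s: "\<sigma> \<in> nsub {1..n-1} m" and t: "\<tau> \<in> nsub {1..n-1} m"
  shows "gram (insert n \<sigma>) (insert n \<tau>) = gram \<sigma> \<tau> + (if \<sigma> = \<tau> then 1 else 0)"
proof -
  have less: "w < n" if "w \<in> \<sigma> \<union> \<tau>" for w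
    using nsub_interval_less[OF n s] nsub_interval_less[OF n t] that by blast
  have nin: "n \<notin> \<sigma>" "n \<notin> \<tau>" using less by blast+
  have fin: "finite \<sigma>" "finite \<tau>" using nsub_finite[OF _ s] nsub_finite[OF _ t] by auto
  have "gram (insert n \<sigma>) (insert n \<tau>) = vertex_sign (insert n \<sigma>) n * incidence \<sigma> (insert n \<tau>)
     + (\<Sum>v\<in>\<sigma>. vertex_sign (insert n \<sigma>) v * incidence (insert n \<sigma> - {v}) (insert n \<tau>))"
    using fin nin by (simp add: gram_eq)
  also have "vertex_sign (insert n \<sigma>) n * incidence \<sigma> (insert n \<tau>) = (if \<sigma> = \<tau> then 1 else 0)"
  proof (cases "\<sigma> = \<tau>")
    case True
    have "insert n \<tau> - {n} = \<tau>" using nin by simp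
    then have "incidence \<tau> (insert n \<tau>) = vertex_sign (insert n \<tau>) n" using incidence_Diff[of "insert n \<tau>" n] fin by simp
    then show ?thesis using True by simp
  next
    case False
    have "incidence \<sigma> (insert n \<tau>) = 0"
      using False nin by (intro incidence_eq_0) auto
    then show ?thesis using False by simp
  qed
  also have "(\<Sum>v\<in>\<sigma>. vertex_sign (insert n \<sigma>) v * incidence (insert n \<sigma> - {v}) (insert n \<tau>)) = (\<Sum>v\<in>\<sigma>. vertex_sign \<sigma> v * incidence (\<sigma> - {v}) \<tau>)"
  proof (intro sum.cong refl arg_cong2[where f="(*)"])
    fix v assume v: "v \<in> \<sigma>"
    show "vertex_sign (insert n \<sigma>) v = vertex_sign \<sigma> v" using less v by (intro vertex_sign_insert_max) auto
    have "insert n \<sigma> - {v} = insert n (\<sigma> - {v})" using v nin by auto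
    then show "incidence (insert n \<sigma> - {v}) (insert n \<tau>) = incidence (\<sigma> - {v}) \<tau>"
      using less nin fin by (simp add: incidence_insert_max)
  qed
  finally show ?thesis using fin by (simp add: gram_eq)
qed

text \<open>The Gram matrix of the bases lives on \<open>n - 1\<close> vertices, so its nonzero
  eigenvalue is \<open>n - 1\<close>, with multiplicity \<open>(n - 2) choose d\<close>; adding the
  identity turns it into \<open>n\<close>.\<close>

lemma pdet_cone:
  assumes n: "n > 1"
  shows "pdet (nsub {1..n-1} (Suc d)) (\<lambda>\<sigma> \<tau>. rgram (insert n \<sigma>) (insert n \<tau>)) = real n ^ ((n - 2) choose d)"
proof -
  interpret pk: projection_kernel "nsub {1..n-1} (Suc d)" rgram "real (card {1..n-1})" "(card {1..n-1} - 1) choose d"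
    using n by (intro projection_kernel_rgram) auto
  have "pdet (nsub {1..n-1} (Suc d)) (\<lambda>\<sigma> \<tau>. rgram (insert n \<sigma>) (insert n \<tau>))
    = pdet (nsub {1..n-1} (Suc d)) (\<lambda>\<sigma> \<tau>. rgram \<sigma> \<tau> + (if \<sigma> = \<tau> then 1 else 0))"
    using n by (intro pdet_cong) (simp add: gram_insert_max)
  also have "\<dots> = (1 + real (card {1..n-1})) ^ ((card {1..n-1} - 1) choose d)"
    by (rule pk.pdet_one_add)
  also have "1 + real (card {1..n-1}) = real n" using n by (simp add: of_nat_diff)
  also have "card {1..n-1} - 1 = n - 2" by simp
  finally show ?thesis .
qed

text \<open>The congruence combined with \<open>pdet_cone\<close> for \<open>d - 1\<close>. The
  squared determinant is that of the boundary matrix restricted to the ridges avoiding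
  \<open>n\<close>; the matching \<open>\<phi>\<close> labels its columns by the same index set as
  its rows.\<close>

lemma pdet_rgram_eq_square:
  assumes n: "n > 1" and d: "d > 0" and \<phi>: "bij_betw \<phi> (nsub {1..n-1} d) T" and T: "T \<subseteq> nsub {1..n} (Suc d)"
  shows "pdet T rgram = (real_of_int (pdet (nsub {1..n-1} d) (\<lambda>\<sigma> \<tau>. incidence \<sigma> (\<phi> \<tau>))))\<^sup>2 * real n ^ ((n - 2) choose (d - 1))"
proof -
  let ?R = "nsub {1..n-1} d"
  have T_eq: "T = \<phi> ` ?R" and inj: "inj_on \<phi> ?R" using \<phi> by (auto simp: bij_betw_def)
  have finR: "finite ?R" by simp
  have \<phi>V: "\<phi> \<tau> \<in> nsub {1..n} (Suc d)" if "\<tau> \<in> ?R" for \<tau> using that T T_eq by auto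
  have "pdet T rgram = pdet ?R (\<lambda>\<sigma>' \<tau>'. rgram (\<phi> \<sigma>') (\<phi> \<tau>'))"
    unfolding T_eq by (rule pdet_image[OF finR inj])
  also have "\<dots> = pdet ?R (\<lambda>\<sigma>' \<tau>'. \<Sum>\<sigma>\<in>?R. \<Sum>\<tau>\<in>?R. real_of_int (incidence \<sigma> (\<phi> \<sigma>')) * rgram (insert n \<sigma>) (insert n \<tau>) * real_of_int (incidence \<tau> (\<phi> \<tau>')))"
    using n by (intro pdet_cong) (simp add: gram_cone_expansion[OF _ \<phi>V \<phi>V])
  also have "\<dots> = (pdet ?R (\<lambda>\<sigma> \<tau>. real_of_int (incidence \<sigma> (\<phi> \<tau>))))\<^sup>2 * pdet ?R (\<lambda>\<sigma> \<tau>. rgram (insert n \<sigma>) (insert n \<tau>))"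
    by (rule pdet_congruence[OF finR])
  also have "pdet ?R (\<lambda>\<sigma> \<tau>. rgram (insert n \<sigma>) (insert n \<tau>)) = real n ^ ((n - 2) choose (d - 1))"
    using pdet_cone[OF n, of "d - 1"] d by simp
  finally show ?thesis by (simp only: pdet_of_int)
qed

section \<open>Homology of hypertrees\<close>

lemma lookup_frag_extend_boundary:
  "Poly_Mapping.lookup (frag_extend simplex_boundary c) s
     = (\<Sum>t\<in>Poly_Mapping.keys c. Poly_Mapping.lookup c t * incidence s t)"
proof -
  have lk: "Poly_Mapping.lookup (\<Sum>v\<in>B. F v) s = (\<Sum>v\<in>B. Poly_Mapping.lookup (F v) s)"
    for F :: "nat set \<Rightarrow> nat set \<Rightarrow>\<^sub>0 int" and B
    by (rule lookup_sum)
  show ?thesis unfolding frag_extend_def lk by (simp add: lookup_simplex_boundary)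
qed

lemma carrier_simplicial_homology:
  "carrier (simplicial_homology S k) =
    (\<lambda>a. (\<lambda>h. h + a) ` simplicial_boundaries S k) ` simplicial_cycles S k"
  unfolding simplicial_homology_def FactGroup_def RCOSETS_def r_coset_def simplicial_chain_group_def
  by (auto simp: free_Abelian_group_def)

locale hypertree_complex =
  fixes d n :: nat and S :: "nat set set"
  assumes d_ge: "d \<ge> 2" and n_ge: "n \<ge> d + 1" and tree: "hypertree d n S"
begin

section \<open>The order of the homology group and the reduced boundary matrix\<close>

definition R :: "nat set set" where "R = nsub {1..n-1} d"

text \<open>Any matching of the ridges avoiding \<open>n\<close> with the top faces, both
  \<open>(n - 1) choose d\<close> in number. It makes the reduced boundary matrix square; another
  choice permutes the columns and changes \<open>D\<close> at most in sign.\<close>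

definition \<phi> :: "nat set \<Rightarrow> nat set" where
  "\<phi> = (SOME f. bij_betw f R (faces S d))"

definition D :: int where
  "D = pdet R (\<lambda>\<sigma> \<tau>. incidence \<sigma> (\<phi> \<tau>))"

abbreviation "boundary \<equiv> frag_extend simplex_boundary"

lemma finite_R: "finite R" by (simp add: R_def)

lemma complex: "simplicial_complex_on n S"
  and card_face: "\<And>s. s \<in> S \<Longrightarrow> card s \<le> d + 1"
  and small_face: "\<And>s. s \<subseteq> {1..n} \<Longrightarrow> card s \<le> d \<Longrightarrow> s \<in> S"
  and card_faces_top: "card (faces S d) = (n - 1) choose d"
  and finite_homology: "finite (carrier (simplicial_homology S (d - 1)))"
  using tree unfolding hypertree_def by simp_all

lemma face_subset: "s \<in> S \<Longrightarrow> s \<subseteq> {1..n}"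
  using complex unfolding simplicial_complex_on_def by (meson PowD subsetD)

lemma face_down: "s \<in> S \<Longrightarrow> t \<subseteq> s \<Longrightarrow> t \<in> S"
  using complex unfolding simplicial_complex_on_def by simp

lemma faces_top: "faces S d \<subseteq> nsub {1..n} (Suc d)"
proof
  fix s assume "s \<in> faces S d"
  then have "s \<in> S" "card s = Suc d" by (simp_all add: faces_def)
  then show "s \<in> nsub {1..n} (Suc d)" using face_subset[of s] by (simp only: nsub_def mem_Collect_eq simp_thms)
qed

lemma faces_ridge: "faces S (d - 1) = nsub {1..n} d"
proof -
  have d1: "d - 1 + 1 = d" using d_ge by simp
  have fin: "finite s" if "s \<subseteq> {1..n}" for s using that finite_subset by blast
  show ?thesis
    unfolding faces_def nsub_def d1
  proof (intro Collect_cong iffI conjI)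
    fix s assume "s \<in> S \<and> finite s \<and> card s = d"
    then show "s \<subseteq> {1..n}" "card s = d" using face_subset[of s] by simp_all
  next
    fix s assume "s \<subseteq> {1..n} \<and> card s = d"
    then show "s \<in> S" "finite s" "card s = d" using small_face[of s] fin[of s] by simp_all
  qed
qed

lemma bij_\<phi>: "bij_betw \<phi> R (faces S d)"
proof -
  have "card R = (n - 1) choose d" by (simp add: R_def card_nsub)
  moreover have "finite (faces S d)"
    using faces_top finite_subset[OF _ finite_nsub] by blast
  ultimately have "\<exists>f. bij_betw f R (faces S d)"
    using card_faces_top finite_R by (intro finite_same_card_bij) auto
  then show ?thesis unfolding \<phi>_def by (rule someI_ex)
qed

lemma cycles_iff:
  "a \<in> simplicial_cycles S (d - 1) \<longleftrightarrow> Poly_Mapping.keys a \<subseteq> nsub {1..n} d \<and> boundary a = 0"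
  unfolding simplicial_cycles_def simplicial_chain_group_def faces_ridge
  using d_ge by (simp add: simplicial_boundary_def)

lemma boundaries_eq:
  "simplicial_boundaries S (d - 1) = boundary ` {c. Poly_Mapping.keys c \<subseteq> faces S d}"
proof -
  have "d - 1 + 1 = d" using d_ge by simp
  then show ?thesis
    using d_ge unfolding simplicial_boundaries_def simplicial_chain_group_def free_Abelian_group_def
    by (simp add: simplicial_boundary_def[abs_def])
qed

lemma boundary_cycle:
  assumes "Poly_Mapping.keys c \<subseteq> faces S d"
  shows "boundary c \<in> simplicial_cycles S (d - 1)"
proof -
  have "simplicial_boundaries S (d - 1) \<subseteq> simplicial_cycles S (d - 1)"
    by (rule simplicial_boundaries_subset_cycles)
      (rule face_down)
  then show ?thesis using assms unfolding boundaries_eq by blast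
qed

text \<open>If every ridge of the cycle contains \<open>n\<close>, a ridge \<open>s\<close> is the
  only one of them with the facet \<open>s - {n}\<close>, so its coefficient appears up to sign as a
  coefficient of the boundary, which is 0. Hence the coordinates in \<open>R\<close> determine a
  cycle.\<close>

lemma cycle_eq_0:
  assumes a: "a \<in> simplicial_cycles S (d - 1)" and z: "\<And>\<sigma>. \<sigma> \<in> R \<Longrightarrow> Poly_Mapping.lookup a \<sigma> = 0"
  shows "a = 0"
proof (rule ccontr)
  assume "a \<noteq> 0"
  have keys: "Poly_Mapping.keys a \<subseteq> nsub {1..n} d" and bda: "boundary a = 0"
    using a unfolding cycles_iff by blast+
  have n_in: "n \<in> s" if "s \<in> Poly_Mapping.keys a" for s
  proof (rule ccontr)
    assume "n \<notin> s"
    have s: "s \<subseteq> {1..n}" "card s = d" using keys that by (auto simp: nsub_def)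
    have "s \<subseteq> {1..n-1}"
    proof
      fix x assume "x \<in> s"
      then have "x \<in> {1..n}" "x \<noteq> n" using s \<open>n \<notin> s\<close> by auto
      then show "x \<in> {1..n-1}" by auto
    qed
    then have "s \<in> R" using s by (simp add: R_def nsub_def)
    then show False using z[of s] that by (simp add: in_keys_iff)
  qed
  obtain s where s: "s \<in> Poly_Mapping.keys a" using \<open>a \<noteq> 0\<close> by (metis keys_eq_empty ex_in_conv)
  define \<tau> where "\<tau> = s - {n}"
  have "0 = (\<Sum>t\<in>Poly_Mapping.keys a. Poly_Mapping.lookup a t * incidence \<tau> t)"
    using lookup_frag_extend_boundary[of a \<tau>] bda by simp
  also have "\<dots> = (\<Sum>t\<in>{s}. Poly_Mapping.lookup a t * incidence \<tau> t)"
  proof (rule sum.mono_neutral_right)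
    show "\<forall>t\<in>Poly_Mapping.keys a - {s}. Poly_Mapping.lookup a t * incidence \<tau> t = 0"
    proof
      fix t assume t: "t \<in> Poly_Mapping.keys a - {s}"
      have "incidence \<tau> t = 0"
      proof (rule ccontr)
        assume "incidence \<tau> t \<noteq> 0"
        then obtain v where v: "v \<in> t" "\<tau> = t - {v}" using incidence_nonzeroD by blast
        have "n \<in> t" using n_in t by blast
        then have "v = n" using v by (auto simp: \<tau>_def)
        then have "t = s" using v n_in[OF s] by (auto simp: \<tau>_def)
        then show False using t by simp
      qed
      then show "Poly_Mapping.lookup a t * incidence \<tau> t = 0" by simp
    qed
  qed (use s in auto)
  also have "\<dots> = Poly_Mapping.lookup a s * vertex_sign s n"
  proof -
    have "finite s" using s keys nsub_finite[of "{1..n}" s d] by blast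
    then show ?thesis using incidence_Diff[OF _ n_in[OF s]] by (simp add: \<tau>_def)
  qed
  finally have "Poly_Mapping.lookup a s * vertex_sign s n = 0" by simp
  moreover have "vertex_sign s n \<noteq> 0" by (simp add: vertex_sign_def)
  ultimately show False using s by (simp add: in_keys_iff)
qed

definition comb :: "(nat set \<Rightarrow> int) \<Rightarrow> nat set \<Rightarrow>\<^sub>0 int" where
  "comb y = (\<Sum>\<tau>\<in>R. frag_cmul (y \<tau>) (frag_of (\<phi> \<tau>)))"

lemma keys_comb: "Poly_Mapping.keys (comb y) \<subseteq> faces S d"
proof -
  have "Poly_Mapping.keys (comb y) \<subseteq> (\<Union>\<tau>\<in>R. Poly_Mapping.keys (frag_cmul (y \<tau>) (frag_of (\<phi> \<tau>))))"
    unfolding comb_def by (rule keys_sum)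
  also have "\<dots> \<subseteq> \<phi> ` R" using keys_cmul by fastforce
  finally show ?thesis using bij_\<phi> by (simp add: bij_betw_def)
qed

lemma lookup_boundary_comb: "Poly_Mapping.lookup (boundary (comb y)) s = (\<Sum>\<tau>\<in>R. y \<tau> * incidence s (\<phi> \<tau>))"
proof -
  have lk: "Poly_Mapping.lookup (\<Sum>v\<in>B. F v) s = (\<Sum>v\<in>B. Poly_Mapping.lookup (F v) s)"
    for F :: "nat set \<Rightarrow> nat set \<Rightarrow>\<^sub>0 int" and B
    by (rule lookup_sum)
  show ?thesis
    unfolding comb_def frag_extend_sum[OF finite_R] comp_def frag_extend_cmul frag_extend_of lk
    by (simp add: lookup_simplex_boundary)
qed

text \<open>Both sides are cycles with the same coordinates in \<open>R\<close>. This turns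
  congruence of coordinates modulo the column lattice into equality of homology classes.\<close>

lemma diff_boundary:
  assumes a: "a \<in> simplicial_cycles S (d - 1)" "a' \<in> simplicial_cycles S (d - 1)"
    and eq: "\<And>\<sigma>. \<sigma> \<in> R \<Longrightarrow> Poly_Mapping.lookup a \<sigma> - Poly_Mapping.lookup a' \<sigma> = (\<Sum>\<tau>\<in>R. y \<tau> * incidence \<sigma> (\<phi> \<tau>))"
  shows "a = a' + boundary (comb y)"
proof -
  have diff: "x - y \<in> simplicial_cycles S (d - 1)"
    if "x \<in> simplicial_cycles S (d - 1)" "y \<in> simplicial_cycles S (d - 1)" for x y
    using that keys_diff[of x y] unfolding cycles_iff frag_extend_diff by (simp, blast)
  have "a - a' - boundary (comb y) \<in> simplicial_cycles S (d - 1)"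
    by (intro diff a boundary_cycle keys_comb)
  moreover have "Poly_Mapping.lookup (a - a' - boundary (comb y)) \<sigma> = 0" if "\<sigma> \<in> R" for \<sigma>
    using eq[OF that] by (simp add: lookup_minus lookup_boundary_comb)
  ultimately have "a - a' - boundary (comb y) = 0" by (rule cycle_eq_0)
  then show ?thesis by (simp add: algebra_simps)
qed

abbreviation coset :: "(nat set \<Rightarrow>\<^sub>0 int) \<Rightarrow> (nat set \<Rightarrow>\<^sub>0 int) set" where
  "coset a \<equiv> (\<lambda>h. h + a) ` simplicial_boundaries S (d - 1)"

lemma coset_eq:
  assumes "a = a' + boundary c" "Poly_Mapping.keys c \<subseteq> faces S d"
  shows "coset a = coset a'"
proof -
  have 1: "h + boundary c \<in> simplicial_boundaries S (d - 1)" "h - boundary c \<in> simplicial_boundaries S (d - 1)"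
    if h: "h \<in> simplicial_boundaries S (d - 1)" for h
  proof -
    obtain c' where c': "h = boundary c'" "Poly_Mapping.keys c' \<subseteq> faces S d" using h unfolding boundaries_eq by blast
    have "Poly_Mapping.keys (c' + c) \<subseteq> faces S d" "Poly_Mapping.keys (c' - c) \<subseteq> faces S d"
      using c' assms(2) Poly_Mapping.keys_add[of c' c] keys_diff[of c' c] by auto
    then show "h + boundary c \<in> simplicial_boundaries S (d - 1)" "h - boundary c \<in> simplicial_boundaries S (d - 1)"
      unfolding boundaries_eq c'(1) frag_extend_add[symmetric] frag_extend_diff[symmetric] by blast+
  qed
  show ?thesis
  proof (intro equalityI subsetI)
    fix x assume "x \<in> coset a"
    then obtain h where "h \<in> simplicial_boundaries S (d - 1)" "x = h + a" by blast
    then show "x \<in> coset a'" using 1(1) assms(1) by (intro image_eqI[of _ _ "h + boundary c"]) (auto simp: algebra_simps)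
  next
    fix x assume "x \<in> coset a'"
    then obtain h where "h \<in> simplicial_boundaries S (d - 1)" "x = h + a'" by blast
    then show "x \<in> coset a" using 1(2) assms(1) by (intro image_eqI[of _ _ "h - boundary c"]) (auto simp: algebra_simps)
  qed
qed

text \<open>Restriction to \<open>R\<close> embeds the cycles into the integer vectors and sends the
  boundaries onto the column lattice of the reduced matrix. A cover by at most
  \<open>\<bar>D\<bar>\<close> cosets of the lattice therefore bounds the number of homology
  classes.\<close>

lemma order_le:
  assumes "D \<noteq> 0"
  shows "int (Coset.order (simplicial_homology S (d - 1))) \<le> \<bar>D\<bar>"
proof -
  let ?Z = "simplicial_cycles S (d - 1)"
  obtain Q where Q: "finite Q" "int (card Q) \<le> \<bar>D\<bar>"
    "\<And>z. \<exists>r\<in>Q. \<exists>x. \<forall>\<sigma>\<in>R. z \<sigma> = r \<sigma> + (\<Sum>\<tau>\<in>R. x \<tau> * incidence \<sigma> (\<phi> \<tau>))"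
    using lattice_cover[OF finite_R, of "\<lambda>\<sigma> \<tau>. incidence \<sigma> (\<phi> \<tau>)"] assms unfolding D_def by blast
  \<comment> \<open>The coordinates of the cycle \<open>a\<close> lie in the lattice coset of
    \<open>r\<close>. A coset may contain no cycle, so the map from \<open>Q\<close> onto the
    classes picks a cycle by choice.\<close>
  define rel where "rel a r \<longleftrightarrow> a \<in> ?Z \<and> (\<exists>x. \<forall>\<sigma>\<in>R. Poly_Mapping.lookup a \<sigma> = r \<sigma> + (\<Sum>\<tau>\<in>R. x \<tau> * incidence \<sigma> (\<phi> \<tau>)))" for a r
  have same: "coset a = coset a'" if r: "rel a r" "rel a' r" for a a' r
  proof -
    obtain x x' where x: "\<And>\<sigma>. \<sigma> \<in> R \<Longrightarrow> Poly_Mapping.lookup a \<sigma> = r \<sigma> + (\<Sum>\<tau>\<in>R. x \<tau> * incidence \<sigma> (\<phi> \<tau>))"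
      "\<And>\<sigma>. \<sigma> \<in> R \<Longrightarrow> Poly_Mapping.lookup a' \<sigma> = r \<sigma> + (\<Sum>\<tau>\<in>R. x' \<tau> * incidence \<sigma> (\<phi> \<tau>))"
      using r unfolding rel_def by blast
    have "a = a' + boundary (comb (\<lambda>\<tau>. x \<tau> - x' \<tau>))"
    proof (rule diff_boundary)
      show "a \<in> ?Z" "a' \<in> ?Z" using r by (auto simp: rel_def)
      show "Poly_Mapping.lookup a \<sigma> - Poly_Mapping.lookup a' \<sigma> = (\<Sum>\<tau>\<in>R. (x \<tau> - x' \<tau>) * incidence \<sigma> (\<phi> \<tau>))"
        if "\<sigma> \<in> R" for \<sigma>
        unfolding x(1)[OF that] x(2)[OF that] left_diff_distrib sum_subtractf by simp
    qed
    then show ?thesis by (rule coset_eq[OF _ keys_comb])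
  qed
  have "carrier (simplicial_homology S (d - 1)) \<subseteq> (\<lambda>r. coset (SOME a. rel a r)) ` Q"
  proof
    fix X assume "X \<in> carrier (simplicial_homology S (d - 1))"
    then obtain a where a: "a \<in> ?Z" "X = coset a" unfolding carrier_simplicial_homology by blast
    obtain r where r: "r \<in> Q" "rel a r" using Q(3)[of "Poly_Mapping.lookup a"] a(1) unfolding rel_def by blast
    then have "rel (SOME a. rel a r) r" by (metis someI)
    then have "X = coset (SOME a. rel a r)" using same[OF r(2)] a(2) by simp
    then show "X \<in> (\<lambda>r. coset (SOME a. rel a r)) ` Q" using r(1) by blast
  qed
  then have "Coset.order (simplicial_homology S (d - 1)) \<le> card Q"
    unfolding Coset.order_def using Q(1) surj_card_le by blast
  then show ?thesis using Q(2) by linarith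
qed

text \<open>A left kernel vector \<open>y\<close> would define a functional killing all boundaries.
  On the boundary of the cone over a ridge where \<open>y\<close> is nonzero this functional does
  not vanish, so the multiples of that cycle give infinitely many homology classes.\<close>

lemma D_nonzero: "D \<noteq> 0"
proof
  assume "D = 0"
  let ?Z = "simplicial_cycles S (d - 1)"
  have D0: "pdet R (\<lambda>\<sigma> \<tau>. incidence \<sigma> (\<phi> \<tau>)) = 0" using \<open>D = 0\<close> by (simp add: D_def)
  obtain y where y: "\<exists>\<sigma>\<in>R. y \<sigma> \<noteq> 0" "\<And>\<tau>. \<tau> \<in> R \<Longrightarrow> (\<Sum>\<sigma>\<in>R. y \<sigma> * incidence \<sigma> (\<phi> \<tau>)) = 0"
    by (rule pdet_0_left_kernel[OF finite_R D0]) (rule that)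
  define F where "F a = (\<Sum>\<sigma>\<in>R. y \<sigma> * Poly_Mapping.lookup a \<sigma>)" for a
  have F_incidence: "F h = 0" if h: "h \<in> simplicial_boundaries S (d - 1)" for h
  proof -
    obtain c where c: "h = boundary c" "Poly_Mapping.keys c \<subseteq> faces S d" using h unfolding boundaries_eq by blast
    have "F h = (\<Sum>\<sigma>\<in>R. \<Sum>t\<in>Poly_Mapping.keys c. Poly_Mapping.lookup c t * (y \<sigma> * incidence \<sigma> t))"
      unfolding F_def c(1) lookup_frag_extend_boundary by (simp add: sum_distrib_left mult_ac)
    also have "\<dots> = (\<Sum>t\<in>Poly_Mapping.keys c. Poly_Mapping.lookup c t * (\<Sum>\<sigma>\<in>R. y \<sigma> * incidence \<sigma> t))"
      by (subst sum.swap) (simp add: sum_distrib_left)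
    also have "\<dots> = 0"
    proof (intro sum.neutral ballI)
      fix t assume "t \<in> Poly_Mapping.keys c"
      then have "t \<in> \<phi> ` R" using c(2) bij_\<phi> unfolding bij_betw_def by blast
      then obtain \<tau> where "\<tau> \<in> R" "t = \<phi> \<tau>" by blast
      then show "Poly_Mapping.lookup c t * (\<Sum>\<sigma>\<in>R. y \<sigma> * incidence \<sigma> t) = 0" using y(2) by simp
    qed
    finally show ?thesis .
  qed
  have F_add: "F (a + b) = F a + F b" for a b
    by (simp add: F_def lookup_add distrib_left sum.distrib)
  have F_cmul: "F (frag_cmul m a) = m * F a" for m a
    by (simp add: F_def sum_distrib_left mult_ac)
  obtain \<sigma>0 where \<sigma>0: "\<sigma>0 \<in> R" "y \<sigma>0 \<noteq> 0" using y(1) by blast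
  have n: "n > 0" using n_ge by simp
  have \<sigma>0': "\<sigma>0 \<in> nsub {1..n-1} d" using \<sigma>0 by (simp add: R_def)
  define e where "e = insert n \<sigma>0"
  have e: "e \<in> nsub {1..n} (Suc d)" unfolding e_def by (rule insert_max_in_nsub[OF n \<sigma>0'])
  then have fin_e: "finite e" using nsub_finite by blast
  have n_notin: "n \<notin> \<sigma>" if "\<sigma> \<in> R" for \<sigma>
    using nsub_interval_less[OF n, of \<sigma> d n] that by (auto simp: R_def)
  define z where "z = simplex_boundary e"
  have keys_z: "Poly_Mapping.keys z \<subseteq> nsub {1..n} d"
  proof
    fix s assume "s \<in> Poly_Mapping.keys z"
    then have "incidence s e \<noteq> 0" by (simp add: z_def in_keys_iff lookup_simplex_boundary)
    then obtain v where "v \<in> e" "s = e - {v}" using incidence_nonzeroD by blast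
    then show "s \<in> nsub {1..n} d" using Diff_in_nsub[OF e] by simp
  qed
  have z: "frag_cmul m z \<in> ?Z" for m
  proof -
    have "boundary (frag_cmul m z) = frag_cmul m (boundary z)" by (rule frag_extend_cmul)
    also have "boundary z = 0" unfolding z_def by (rule simplicial_boundary_boundary[OF fin_e])
    finally show ?thesis using keys_z keys_cmul[of m z] unfolding cycles_iff by simp
  qed
  have "F z = (\<Sum>\<sigma>\<in>{\<sigma>0}. y \<sigma> * incidence \<sigma> e)"
    unfolding F_def z_def lookup_simplex_boundary
  proof (rule sum.mono_neutral_right)
    show "\<forall>\<sigma>\<in>R - {\<sigma>0}. y \<sigma> * incidence \<sigma> e = 0"
    proof
      fix \<sigma> assume \<sigma>: "\<sigma> \<in> R - {\<sigma>0}"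
      have "incidence \<sigma> e = 0"
      proof (rule incidence_eq_0)
        fix v assume "v \<in> e"
        show "\<sigma> \<noteq> e - {v}"
        proof
          assume eq: "\<sigma> = e - {v}"
          then have "v = n" using n_notin[of \<sigma>] \<sigma> by (auto simp: e_def)
          then have "\<sigma> = \<sigma>0" using eq n_notin[OF \<sigma>0(1)] by (auto simp: e_def)
          then show False using \<sigma> by simp
        qed
      qed
      then show "y \<sigma> * incidence \<sigma> e = 0" by simp
    qed
  qed (use \<sigma>0 finite_R in auto)
  also have "\<dots> = y \<sigma>0 * vertex_sign e n"
  proof -
    have "e - {n} = \<sigma>0" using n_notin[OF \<sigma>0(1)] by (simp add: e_def)
    then show ?thesis using incidence_Diff[OF fin_e, of n] by (simp add: e_def)
  qed
  also have "\<dots> \<noteq> 0" using \<sigma>0(2) by (simp add: vertex_sign_def)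
  finally have Fz: "F z \<noteq> 0" .
  have "inj (\<lambda>m. coset (frag_cmul m z))"
  proof (rule injI)
    fix m m' assume eq: "coset (frag_cmul m z) = coset (frag_cmul m' z)"
    have "boundary 0 \<in> simplicial_boundaries S (d - 1)" unfolding boundaries_eq by (rule imageI) simp
    then have "0 \<in> simplicial_boundaries S (d - 1)" by simp
    then have "0 + frag_cmul m z \<in> coset (frag_cmul m z)" by blast
    then obtain h where "h \<in> simplicial_boundaries S (d - 1)" "0 + frag_cmul m z = h + frag_cmul m' z"
      unfolding eq by blast
    then have "F (frag_cmul m z) = F (frag_cmul m' z)" using F_add F_incidence by simp
    then show "m = m'" using Fz by (simp add: F_cmul)
  qed
  then have "infinite (range (\<lambda>m::int. coset (frag_cmul m z)))"
    using infinite_UNIV_int finite_imageD by blast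
  moreover have "range (\<lambda>m. coset (frag_cmul m z)) \<subseteq> carrier (simplicial_homology S (d - 1))"
    unfolding carrier_simplicial_homology using z by blast
  ultimately show False using finite_homology finite_subset by blast
qed

lemma order_square_le:
  "(real (Coset.order (simplicial_homology S (d - 1))))\<^sup>2 * real n ^ ((n - 2) choose (d - 1)) \<le> pdet (faces S d) rgram"
proof -
  have n: "n > 1" "d > 0" using n_ge d_ge by auto
  have "real (Coset.order (simplicial_homology S (d - 1))) \<le> \<bar>real_of_int D\<bar>"
    using order_le[OF D_nonzero] by linarith
  then have "(real (Coset.order (simplicial_homology S (d - 1))))\<^sup>2 \<le> (real_of_int D)\<^sup>2"
    by (metis abs_le_square_iff abs_of_nat)
  then show ?thesis
    unfolding pdet_rgram_eq_square[OF n bij_\<phi>[unfolded R_def] faces_top] D_def R_def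
    by (intro mult_right_mono) auto
qed

text \<open>A hypertree is recovered from its top faces, so distinct hypertrees give distinct sets
  in the comparison of the two laws.\<close>

lemma tree_eq: "S = {s. s \<subseteq> {1..n} \<and> card s \<le> d} \<union> faces S d"
proof -
  have "card s \<le> d \<or> card s = d + 1" if "s \<in> S" for s
    using card_face[OF that] by linarith
  moreover have "finite s" if "s \<subseteq> {1..n}" for s using that finite_subset by blast
  ultimately show ?thesis unfolding faces_def using face_subset small_face by blast
qed

end

text \<open>For each hypertree the prescribed probability is at most the determinantal weight of its
  top faces. The probabilities sum to 1 and these weights to at most 1, so they agree, and bases
  that come from no hypertree have weight 0. Solving for the order expresses every event about it by
  weights alone; \<open>P\<close> is arbitrary so that the deviation event can be inserted.\<close>

lemma (in hypertree_kernel) prob_determinantal_hypertree: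
  assumes d: "d \<ge> 2" and n: "n \<ge> d + 1" and T: "determinantal_hypertree d n T"
  shows "measure_pmf.prob T {S. P (real (Coset.order (simplicial_homology S (d - 1))))}
    = (\<Sum>F\<in>bases. if P (sqrt (wgt F * real n ^ ((n - 2) choose d))) then wgt F else 0)"
proof -
  define H where "H = {S. hypertree d n S}"
  define q where "q S = real (Coset.order (simplicial_homology S (d - 1)))" for S
  define b where "b = (n - 2) choose d"
  have hc: "hypertree_complex d n S" if "S \<in> H" for S
    using that d n unfolding hypertree_complex_def H_def by simp
  have "H \<subseteq> Pow (Pow {1..n})"
  proof
    fix S assume "S \<in> H"
    from hypertree_complex.face_subset[OF hc[OF this]] show "S \<in> Pow (Pow {1..n})" by blast
  qed
  then have finH: "finite H" by (rule finite_subset) simp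
  have pmf_eq: "pmf T S = (q S)\<^sup>2 / real n ^ b" if "S \<in> H" for S
    using T that by (simp add: determinantal_hypertree_def H_def q_def b_def)
  have supp: "set_pmf T \<subseteq> H" using T by (simp add: determinantal_hypertree_def H_def)
  have in_bases: "faces S d \<in> bases" if "S \<in> H" for S
  proof -
    have "faces S d \<subseteq> facets" unfolding facets_def by (rule hypertree_complex.faces_top[OF hc[OF that]])
    moreover have "card (faces S d) = rk"
      unfolding rk_def by (rule hypertree_complex.card_faces_top[OF hc[OF that]])
    ultimately show ?thesis by (simp add: supersets_def)
  qed
  \<comment> \<open>Pascal's rule: the exponent in the law and the exponent of the deterministic
    factor add up to the normalizing exponent of \<open>wgt\<close>.\<close>
  have rk: "rk = b + ((n - 2) choose (d - 1))"
  proof -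
    have "n = Suc (Suc (n - 2))" "d = Suc (d - 1)" using n d by simp_all
    then obtain m j where "n = Suc (Suc m)" "d = Suc j" by (rule that)
    then show ?thesis unfolding rk_def b_def by simp
  qed
  have pmf_le: "pmf T S \<le> wgt (faces S d)" if S: "S \<in> H" for S
  proof -
    have "(q S)\<^sup>2 * real n ^ ((n - 2) choose (d - 1)) \<le> pdet (faces S d) rgram"
      unfolding q_def by (rule hypertree_complex.order_square_le[OF hc[OF S]])
    then have "(q S)\<^sup>2 * real n ^ ((n - 2) choose (d - 1)) / real n ^ rk \<le> wgt (faces S d)"
      unfolding wgt_def by (intro divide_right_mono) auto
    then show ?thesis using n_pos S by (simp add: pmf_eq rk power_add)
  qed
  have inj: "inj_on (\<lambda>S. faces S d) H"
  proof (rule inj_onI)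
    fix S S' assume "S \<in> H" "S' \<in> H" "faces S d = faces S' d"
    then show "S = S'" using hypertree_complex.tree_eq[OF hc] by metis
  qed
  have img: "(\<lambda>S. faces S d) ` H \<subseteq> bases" using in_bases by blast
  have sum_pmf: "(\<Sum>S\<in>H. pmf T S) = 1"
    using finH supp by (rule sum_pmf_eq_1)
  have sum_img: "(\<Sum>S\<in>H. wgt (faces S d)) = (\<Sum>F\<in>(\<lambda>S. faces S d) ` H. wgt F)"
    using inj by (simp add: sum.reindex)
  have split: "(\<Sum>F\<in>bases. wgt F) = (\<Sum>F\<in>(\<lambda>S. faces S d) ` H. wgt F) + (\<Sum>F\<in>bases - (\<lambda>S. faces S d) ` H. wgt F)"
    using sum.subset_diff[OF img finite_supersets, of wgt] by simp
  have rest: "(\<Sum>F\<in>bases - (\<lambda>S. faces S d) ` H. wgt F) \<ge> 0"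
    by (intro sum_nonneg wgt_nonneg) auto
  have le: "(\<Sum>S\<in>H. pmf T S) \<le> (\<Sum>S\<in>H. wgt (faces S d))"
    by (intro sum_mono pmf_le)
  have eq: "(\<Sum>S\<in>H. pmf T S) = (\<Sum>S\<in>H. wgt (faces S d))"
    and rest0: "(\<Sum>F\<in>bases - (\<lambda>S. faces S d) ` H. wgt F) = 0"
    using le rest split sum_pmf sum_wgt sum_img by linarith+
  have pmf_wgt: "pmf T S = wgt (faces S d)" if "S \<in> H" for S
    using sum_mono_inv[OF eq pmf_le that finH] .
  have wgt0: "wgt F = 0" if "F \<in> bases - (\<lambda>S. faces S d) ` H" for F
    using rest0 that by (subst (asm) sum_nonneg_eq_0_iff) (auto intro: wgt_nonneg)
  have q_eq: "q S = sqrt (wgt (faces S d) * real n ^ b)" if S: "S \<in> H" for S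
  proof -
    have "wgt (faces S d) * real n ^ b = (q S)\<^sup>2"
      unfolding pmf_wgt[OF S, symmetric] pmf_eq[OF S] using n_pos by simp
    then show ?thesis by (simp add: q_def)
  qed
  have "measure_pmf.prob T {S. P (q S)} = measure_pmf.prob T ({S. P (q S)} \<inter> set_pmf T)"
    by (simp add: measure_Int_set_pmf)
  also have "\<dots> = measure_pmf.prob T ({S \<in> H. P (q S)} \<inter> set_pmf T)"
    using supp by (intro arg_cong[where f = "measure_pmf.prob T"]) auto
  also have "\<dots> = measure_pmf.prob T {S \<in> H. P (q S)}"
    by (simp add: measure_Int_set_pmf)
  also have "\<dots> = (\<Sum>S\<in>{S \<in> H. P (q S)}. pmf T S)"
    using finH by (intro measure_measure_pmf_finite) auto
  also have "\<dots> = (\<Sum>S\<in>H. if P (q S) then pmf T S else 0)"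
    using finH by (rule sum.inter_filter)
  also have "\<dots> = (\<Sum>S\<in>H. if P (sqrt (wgt (faces S d) * real n ^ b)) then wgt (faces S d) else 0)"
    by (intro sum.cong refl) (simp only: q_eq pmf_wgt)
  also have "\<dots> = (\<Sum>F\<in>(\<lambda>S. faces S d) ` H. if P (sqrt (wgt F * real n ^ b)) then wgt F else 0)"
    using inj by (simp add: sum.reindex)
  also have "\<dots> = (\<Sum>F\<in>bases. if P (sqrt (wgt F * real n ^ b)) then wgt F else 0)"
    by (rule sum.mono_neutral_left[OF finite_supersets img]) (simp add: wgt0)
  finally show ?thesis unfolding q_def b_def .
qed

section \<open>Convergence of spectral averages\<close>

text \<open>A sequence of finite probability spaces in which each sample carries \<open>k n\<close>
  non-negative numbers; matrices and complexes play no part in this abstract setting.\<close>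

locale weighted_spectra =
  fixes \<Omega> :: "nat \<Rightarrow> 'w set" and w :: "nat \<Rightarrow> 'w \<Rightarrow> real"
    and k :: "nat \<Rightarrow> nat" and lam :: "nat \<Rightarrow> 'w \<Rightarrow> nat \<Rightarrow> real"
  assumes finite_\<Omega>: "finite (\<Omega> n)"
    and w_nonneg: "\<omega> \<in> \<Omega> n \<Longrightarrow> w n \<omega> \<ge> 0"
    and sum_w: "(\<Sum>\<omega>\<in>\<Omega> n. w n \<omega>) = 1"
    and k_pos: "k n > 0"
    and lam_nonneg: "\<omega> \<in> \<Omega> n \<Longrightarrow> i < k n \<Longrightarrow> lam n \<omega> i \<ge> 0"
begin

definition ex :: "nat \<Rightarrow> ('w \<Rightarrow> real) \<Rightarrow> real" where
  "ex n X = (\<Sum>\<omega>\<in>\<Omega> n. w n \<omega> * X \<omega>)"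

definition pr :: "nat \<Rightarrow> ('w \<Rightarrow> bool) \<Rightarrow> real" where
  "pr n P = ex n (\<lambda>\<omega>. of_bool (P \<omega>))"

definition av :: "nat \<Rightarrow> 'w \<Rightarrow> (real \<Rightarrow> real) \<Rightarrow> real" where
  "av n \<omega> f = (\<Sum>i<k n. f (lam n \<omega> i)) / real (k n)"

text \<open>Convergence in mean of the spectral average to a constant. In mean, errors simply add,
  and an approximation that is small uniformly in \<open>n\<close> can be passed to the
  limit.\<close>

definition conv :: "(real \<Rightarrow> real) \<Rightarrow> real \<Rightarrow> bool" where
  "conv f c \<longleftrightarrow> (\<lambda>n. ex n (\<lambda>\<omega>. \<bar>av n \<omega> f - c\<bar>)) \<longlonglongrightarrow> 0"

lemma ex_mono:
  assumes "\<And>\<omega>. \<omega> \<in> \<Omega> n \<Longrightarrow> w n \<omega> > 0 \<Longrightarrow> X \<omega> \<le> Y \<omega>"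
  shows "ex n X \<le> ex n Y"
  unfolding ex_def
proof (rule sum_mono)
  fix \<omega> assume "\<omega> \<in> \<Omega> n"
  then show "w n \<omega> * X \<omega> \<le> w n \<omega> * Y \<omega>"
    using assms[of \<omega>] w_nonneg[of \<omega> n] by (cases "w n \<omega> = 0") (auto intro: mult_left_mono)
qed

lemma ex_nonneg: "(\<And>\<omega>. \<omega> \<in> \<Omega> n \<Longrightarrow> X \<omega> \<ge> 0) \<Longrightarrow> ex n X \<ge> 0"
  unfolding ex_def by (intro sum_nonneg mult_nonneg_nonneg w_nonneg)

lemma ex_add: "ex n (\<lambda>\<omega>. X \<omega> + Y \<omega>) = ex n X + ex n Y"
  by (simp add: ex_def algebra_simps sum.distrib)

lemma ex_cmult: "ex n (\<lambda>\<omega>. c * X \<omega>) = c * ex n X"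
  by (simp add: ex_def sum_distrib_left mult_ac)

lemma ex_const: "ex n (\<lambda>\<omega>. c) = c"
  using sum_w[of n] by (simp add: ex_def flip: sum_distrib_right)

lemma pr_mono:
  assumes "\<And>\<omega>. \<omega> \<in> \<Omega> n \<Longrightarrow> w n \<omega> > 0 \<Longrightarrow> P \<omega> \<Longrightarrow> Q \<omega>"
  shows "pr n P \<le> pr n Q"
  unfolding pr_def using assms by (intro ex_mono) auto

lemma pr_disj: "pr n (\<lambda>\<omega>. P \<omega> \<or> Q \<omega>) \<le> pr n P + pr n Q"
  unfolding pr_def ex_add[symmetric] by (intro ex_mono) auto

lemma pr_nonneg: "pr n P \<ge> 0"
  unfolding pr_def by (intro ex_nonneg) auto

lemma markov:
  assumes "t > 0" "\<And>\<omega>. \<omega> \<in> \<Omega> n \<Longrightarrow> X \<omega> \<ge> 0"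
  shows "pr n (\<lambda>\<omega>. X \<omega> > t) \<le> ex n X / t"
proof -
  have "pr n (\<lambda>\<omega>. X \<omega> > t) \<le> ex n (\<lambda>\<omega>. (1 / t) * X \<omega>)"
    unfolding pr_def using assms by (intro ex_mono) (auto simp: of_bool_def)
  then show ?thesis by (simp only: ex_cmult) simp
qed

lemma ex_witness:
  assumes "pr n P < 1"
  obtains \<omega> where "\<omega> \<in> \<Omega> n" "w n \<omega> > 0" "\<not> P \<omega>"
proof -
  have "\<exists>\<omega>\<in>\<Omega> n. w n \<omega> > 0 \<and> \<not> P \<omega>"
  proof (rule ccontr)
    assume "\<not> ?thesis"
    then have "ex n (\<lambda>_. 1) \<le> pr n P" unfolding pr_def by (intro ex_mono) auto
    with assms show False by (simp add: ex_const)
  qed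
  then show ?thesis using that by blast
qed

lemma av_add: "av n \<omega> (\<lambda>x. f x + g x) = av n \<omega> f + av n \<omega> g"
  by (simp add: av_def sum.distrib add_divide_distrib)

lemma av_cmult: "av n \<omega> (\<lambda>x. c * f x) = c * av n \<omega> f"
  by (simp add: av_def flip: sum_distrib_left)

lemma av_mono:
  assumes "\<omega> \<in> \<Omega> n" "\<And>x. x \<ge> 0 \<Longrightarrow> f x \<le> g x"
  shows "av n \<omega> f \<le> av n \<omega> g"
  unfolding av_def using assms lam_nonneg by (intro divide_right_mono sum_mono) auto

lemma av_const: "av n \<omega> (\<lambda>_. c) = c"
  using k_pos[of n] by (simp add: av_def)

lemma av_diff_le: "\<bar>av n \<omega> f - av n \<omega> g\<bar> \<le> av n \<omega> (\<lambda>x. \<bar>f x - g x\<bar>)"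
proof -
  have "av n \<omega> f - av n \<omega> g = (\<Sum>i<k n. f (lam n \<omega> i) - g (lam n \<omega> i)) / real (k n)"
    by (simp add: av_def sum_subtractf diff_divide_distrib)
  then show ?thesis by (simp add: av_def abs_divide divide_right_mono sum_abs)
qed

lemma conv_const: "conv (\<lambda>_. c) c"
  by (simp add: conv_def av_const ex_const)

lemma conv_add:
  assumes "conv f c" "conv g e"
  shows "conv (\<lambda>x. f x + g x) (c + e)"
  unfolding conv_def
proof (rule tendsto_sandwich[of "\<lambda>_. 0"])
  show "\<forall>\<^sub>F n in sequentially. ex n (\<lambda>\<omega>. \<bar>av n \<omega> (\<lambda>x. f x + g x) - (c + e)\<bar>)
     \<le> ex n (\<lambda>\<omega>. \<bar>av n \<omega> f - c\<bar>) + ex n (\<lambda>\<omega>. \<bar>av n \<omega> g - e\<bar>)"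
    unfolding ex_add[symmetric] av_add by (intro always_eventually allI ex_mono) linarith
  show "(\<lambda>n. ex n (\<lambda>\<omega>. \<bar>av n \<omega> f - c\<bar>) + ex n (\<lambda>\<omega>. \<bar>av n \<omega> g - e\<bar>)) \<longlonglongrightarrow> 0"
    using assms tendsto_add[of _ 0 _ _ 0] unfolding conv_def by fastforce
qed (auto intro!: always_eventually ex_nonneg)

lemma conv_cmult:
  assumes "conv f c"
  shows "conv (\<lambda>x. a * f x) (a * c)"
proof -
  have "(\<lambda>n. \<bar>a\<bar> * ex n (\<lambda>\<omega>. \<bar>av n \<omega> f - c\<bar>)) \<longlonglongrightarrow> 0"
    using assms unfolding conv_def by (rule tendsto_mult_right_zero)
  then show ?thesis unfolding conv_def av_cmult by (simp flip: ex_cmult right_diff_distrib abs_mult)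
qed

lemma conv_sum:
  assumes "finite I" "\<And>i. i \<in> I \<Longrightarrow> \<exists>c. conv (f i) c"
  shows "\<exists>c. conv (\<lambda>x. \<Sum>i\<in>I. f i x) c"
  using assms
proof (induction I rule: finite_induct)
  case empty
  then show ?case using conv_const by auto
next
  case (insert i I)
  then show ?case using conv_add by (simp, metis)
qed

lemma conv_diff_le:
  assumes "conv f c" "conv g e" "\<And>n. ex n (\<lambda>\<omega>. av n \<omega> (\<lambda>x. \<bar>f x - g x\<bar>)) \<le> \<delta>"
  shows "\<bar>c - e\<bar> \<le> \<delta>"
proof -
  have "\<bar>c - e\<bar> \<le> ex n (\<lambda>\<omega>. \<bar>av n \<omega> f - c\<bar>) + (ex n (\<lambda>\<omega>. \<bar>av n \<omega> g - e\<bar>) + \<delta>)" for n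
  proof -
    have "\<bar>c - e\<bar> = ex n (\<lambda>_. \<bar>c - e\<bar>)" by (simp add: ex_const)
    also have "\<dots> \<le> ex n (\<lambda>\<omega>. \<bar>av n \<omega> f - c\<bar> + (\<bar>av n \<omega> g - e\<bar> + av n \<omega> (\<lambda>x. \<bar>f x - g x\<bar>)))"
    proof (rule ex_mono)
      fix \<omega> show "\<bar>c - e\<bar> \<le> \<bar>av n \<omega> f - c\<bar> + (\<bar>av n \<omega> g - e\<bar> + av n \<omega> (\<lambda>x. \<bar>f x - g x\<bar>))"
        using av_diff_le[of n \<omega> f g] by linarith
    qed
    finally show ?thesis using assms(3)[of n] by (simp add: ex_add)
  qed
  moreover have "(\<lambda>n. ex n (\<lambda>\<omega>. \<bar>av n \<omega> f - c\<bar>) + (ex n (\<lambda>\<omega>. \<bar>av n \<omega> g - e\<bar>) + \<delta>)) \<longlonglongrightarrow> 0 + (0 + \<delta>)"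
    using assms(1,2) unfolding conv_def by (intro tendsto_intros)
  ultimately show ?thesis by (intro LIMSEQ_le_const[where X = "\<lambda>n. _ n + (_ n + \<delta>)"]) auto
qed

text \<open>The limits belonging to the accuracies \<open>1 / (m + 1)\<close> form a Cauchy
  sequence, by the triangle inequality through \<open>f\<close>; an approximant close to
  \<open>f\<close> whose limit is close to \<open>L\<close> then proves convergence to
  \<open>L\<close>.\<close>

lemma conv_approx:
  assumes approx: "\<And>\<delta>. \<delta> > 0 \<Longrightarrow> \<exists>g c. conv g c \<and> (\<forall>n. ex n (\<lambda>\<omega>. av n \<omega> (\<lambda>x. \<bar>f x - g x\<bar>)) \<le> \<delta>)"
  shows "\<exists>c. conv f c"
proof -
  define \<delta> where "\<delta> m = 1 / real (Suc m)" for m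
  have \<delta>: "\<delta> m > 0" for m by (simp add: \<delta>_def)
  have \<delta>_lim: "\<delta> \<longlonglongrightarrow> 0"
    unfolding \<delta>_def using LIMSEQ_inverse_real_of_nat by (simp add: inverse_eq_divide)
  obtain g c where gc: "\<And>m. conv (g m) (c m)" "\<And>m n. ex n (\<lambda>\<omega>. av n \<omega> (\<lambda>x. \<bar>f x - g m x\<bar>)) \<le> \<delta> m"
    using approx[OF \<delta>] by metis
  have close: "\<bar>c m - c l\<bar> \<le> \<delta> m + \<delta> l" for m l
  proof (rule conv_diff_le[OF gc(1) gc(1)])
    fix n
    have "ex n (\<lambda>\<omega>. av n \<omega> (\<lambda>x. \<bar>g m x - g l x\<bar>)) \<le> ex n (\<lambda>\<omega>. av n \<omega> (\<lambda>x. \<bar>f x - g m x\<bar>) + av n \<omega> (\<lambda>x. \<bar>f x - g l x\<bar>))"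
      unfolding av_add[symmetric] by (intro ex_mono av_mono) auto
    then show "ex n (\<lambda>\<omega>. av n \<omega> (\<lambda>x. \<bar>g m x - g l x\<bar>)) \<le> \<delta> m + \<delta> l"
      using gc(2)[of n m] gc(2)[of n l] by (simp add: ex_add)
  qed
  have "Cauchy c"
  proof (rule metric_CauchyI)
    fix e :: real assume "e > 0"
    then have "\<forall>\<^sub>F m in sequentially. \<delta> m < e / 2"
      using \<delta>_lim by (intro order_tendstoD) auto
    then obtain M where M: "\<And>m. m \<ge> M \<Longrightarrow> \<delta> m < e / 2" by (auto simp: eventually_sequentially)
    have "dist (c m) (c n) < e" if "m \<ge> M" "n \<ge> M" for m n
      using close[of m n] M[OF that(1)] M[OF that(2)] by (simp add: dist_real_def)
    then show "\<exists>M. \<forall>m\<ge>M. \<forall>n\<ge>M. dist (c m) (c n) < e" by blast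
  qed
  then obtain L where L: "c \<longlonglongrightarrow> L" using Cauchy_convergent convergent_def by blast
  have "conv f L"
    unfolding conv_def
  proof (rule LIMSEQ_I)
    fix r :: real assume r: "r > 0"
    have "\<forall>\<^sub>F m in sequentially. \<delta> m < r / 3"
      using \<delta>_lim r by (intro order_tendstoD) auto
    moreover have "\<forall>\<^sub>F m in sequentially. dist (c m) L < r / 3"
      using L r by (intro tendstoD) auto
    ultimately have "\<forall>\<^sub>F m in sequentially. \<delta> m < r / 3 \<and> dist (c m) L < r / 3"
      by (rule eventually_conj)
    then obtain m where m: "\<delta> m < r / 3" "\<bar>c m - L\<bar> < r / 3"
      by (auto simp: eventually_sequentially dist_real_def)
    obtain N where N: "\<And>n. n \<ge> N \<Longrightarrow> \<bar>ex n (\<lambda>\<omega>. \<bar>av n \<omega> (g m) - c m\<bar>)\<bar> < r / 3"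
      using gc(1)[of m] LIMSEQ_D[of _ 0 "r / 3"] r unfolding conv_def by fastforce
    have "norm (ex n (\<lambda>\<omega>. \<bar>av n \<omega> f - L\<bar>) - 0) < r" if "n \<ge> N" for n
    proof -
      have "ex n (\<lambda>\<omega>. \<bar>av n \<omega> f - L\<bar>) \<le> ex n (\<lambda>\<omega>. av n \<omega> (\<lambda>x. \<bar>f x - g m x\<bar>) + (\<bar>av n \<omega> (g m) - c m\<bar> + \<bar>c m - L\<bar>))"
      proof (rule ex_mono)
        fix \<omega> show "\<bar>av n \<omega> f - L\<bar> \<le> av n \<omega> (\<lambda>x. \<bar>f x - g m x\<bar>) + (\<bar>av n \<omega> (g m) - c m\<bar> + \<bar>c m - L\<bar>)"
          using av_diff_le[of n \<omega> f "g m"] by linarith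
      qed
      also have "\<dots> < r"
        unfolding ex_add ex_const using gc(2)[of n m] m N[OF that] by linarith
      finally show ?thesis using ex_nonneg[of n "\<lambda>\<omega>. \<bar>av n \<omega> f - L\<bar>"] by simp
    qed
    then show "\<exists>no. \<forall>n\<ge>no. norm (ex n (\<lambda>\<omega>. \<bar>av n \<omega> f - L\<bar>) - 0) < r" by blast
  qed
  then show ?thesis ..
qed

end

section \<open>From factorial moment bounds to the regularized logarithm\<close>

lemma exp_neg_taylor_bound:
  fixes y :: real
  assumes "y \<ge> 0"
  shows "\<bar>exp (- y) - (\<Sum>i<m. (- y) ^ i / fact i)\<bar> \<le> y ^ m / fact m"
proof (cases "m = 0 \<or> y = 0")
  case True
  then show ?thesis using assms by (cases m) (auto simp: lessThan_Suc_eq_insert_0 sum.reindex)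
next
  case False
  then have "0 < m" "- y < 0" using assms by auto
  then obtain t where t: "- y < t" "t < 0"
    "exp (- y) = (\<Sum>i<m. exp 0 / fact i * (- y) ^ i) + exp t / fact m * (- y) ^ m"
    using Maclaurin_minus[of "- y" m "\<lambda>_. exp" exp] by (auto intro!: derivative_eq_intros)
  have "exp (- y) - (\<Sum>i<m. (- y) ^ i / fact i) = exp t / fact m * (- y) ^ m"
    using t(3) by simp
  moreover have "\<bar>exp t / fact m * (- y) ^ m\<bar> \<le> 1 / fact m * y ^ m"
    unfolding abs_mult using t(2) assms by (intro mult_mono) (auto simp: divide_right_mono power_abs)
  ultimately show ?thesis by simp
qed

locale weighted_spectra_moments = weighted_spectra \<Omega> w k lam
  for \<Omega> :: "nat \<Rightarrow> 'w set" and w k lam +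
  fixes C :: real
  assumes C_pos: "C > 0"
    and conv_power: "\<And>j. \<exists>c. conv (\<lambda>x. x ^ j) c"
    and moment_bound: "\<And>n j. ex n (\<lambda>\<omega>. av n \<omega> (\<lambda>x. x ^ j)) \<le> C ^ j * fact j"
begin

text \<open>For moments of size \<open>C ^ j * fact j\<close> the Taylor remainder of order
  \<open>m\<close> decays like (2 h C)^m, the 2 coming from the binomial coefficient hidden in
  \<open>fact (j + m)\<close>; this step length makes the ratio 1/2.\<close>

definition h :: real where "h = 1 / (4 * C)"

lemma h_pos: "h > 0" using C_pos by (simp add: h_def)

text \<open>Only the factor \<open>exp (- h * x)\<close> is expanded; \<open>exp (- s * x)\<close>
  is kept and bounded by 1 in the remainder. The error is thus independent of \<open>s\<close> and
  the step can be iterated, although the moment bounds would not control an expansion of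
  \<open>exp (- s * x)\<close> itself for large \<open>s\<close>.\<close>

lemma conv_power_exp_step:
  assumes "s \<ge> 0" and IH: "\<And>j. \<exists>c. conv (\<lambda>x. x ^ j * exp (- s * x)) c"
  shows "\<exists>c. conv (\<lambda>x. x ^ j * exp (- (s + h) * x)) c"
proof (rule conv_approx)
  fix \<delta> :: real assume "\<delta> > 0"
  define K where "K = C ^ j * 2 ^ j * fact j"
  have "(\<lambda>m. K * (1 / 2) ^ m) \<longlonglongrightarrow> K * 0"
    by (intro tendsto_intros LIMSEQ_realpow_zero) auto
  then have "\<forall>\<^sub>F m in sequentially. K * (1 / 2) ^ m < \<delta>"
    using \<open>\<delta> > 0\<close> by (intro order_tendstoD(2)) auto
  then obtain m where m: "K * (1 / 2) ^ m < \<delta>" by (auto simp: eventually_sequentially)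
  define g where "g x = (\<Sum>i<m. ((- h) ^ i / fact i) * (x ^ (j + i) * exp (- s * x)))" for x
  have "\<exists>c. conv g c"
    unfolding g_def by (rule conv_sum) (use IH conv_cmult in blast)+
  moreover have "ex n (\<lambda>\<omega>. av n \<omega> (\<lambda>x. \<bar>x ^ j * exp (- (s + h) * x) - g x\<bar>)) \<le> \<delta>" for n
  proof -
    have pt: "\<bar>x ^ j * exp (- (s + h) * x) - g x\<bar> \<le> h ^ m / fact m * x ^ (j + m)" if "x \<ge> 0" for x
    proof -
      have "x ^ j * exp (- (s + h) * x) - g x
         = x ^ j * exp (- s * x) * (exp (- (h * x)) - (\<Sum>i<m. (- (h * x)) ^ i / fact i))"
      proof -
        have "exp (- (s + h) * x) = exp (- s * x) * exp (- (h * x))"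
          by (simp add: algebra_simps flip: exp_add)
        moreover have "(- (h * x)) ^ i = (- h) ^ i * x ^ i" for i
          by (metis mult_minus_left power_mult_distrib)
        ultimately show ?thesis
          by (simp add: g_def right_diff_distrib sum_distrib_left power_add mult_ac)
      qed
      then have "\<bar>x ^ j * exp (- (s + h) * x) - g x\<bar>
         = (x ^ j * exp (- s * x)) * \<bar>exp (- (h * x)) - (\<Sum>i<m. (- (h * x)) ^ i / fact i)\<bar>"
        using that by (simp add: abs_mult)
      also have "\<dots> \<le> (x ^ j * 1) * ((h * x) ^ m / fact m)"
        using that assms(1) h_pos by (intro mult_mono exp_neg_taylor_bound) auto
      also have "\<dots> = h ^ m / fact m * x ^ (j + m)"
        by (simp add: power_mult_distrib power_add)
      finally show ?thesis .
    qed
    have "ex n (\<lambda>\<omega>. av n \<omega> (\<lambda>x. \<bar>x ^ j * exp (- (s + h) * x) - g x\<bar>))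
        \<le> ex n (\<lambda>\<omega>. av n \<omega> (\<lambda>x. h ^ m / fact m * x ^ (j + m)))"
      by (intro ex_mono av_mono pt) auto
    also have "\<dots> = h ^ m / fact m * ex n (\<lambda>\<omega>. av n \<omega> (\<lambda>x. x ^ (j + m)))"
      by (simp only: av_cmult ex_cmult)
    also have "\<dots> \<le> h ^ m / fact m * (C ^ (j + m) * fact (j + m))"
      using h_pos by (intro mult_left_mono moment_bound) auto
    also have "\<dots> = (h * C) ^ m * C ^ j * fact j * real ((j + m) choose j)"
      by (simp add: binomial_fact power_add power_mult_distrib)
    also have "\<dots> \<le> (h * C) ^ m * C ^ j * fact j * 2 ^ (j + m)"
    proof (intro mult_left_mono)
      have "((j + m) choose j) \<le> 2 ^ (j + m)"
        using binomial_le_pow2 by blast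
      then show "real ((j + m) choose j) \<le> 2 ^ (j + m)" by (metis of_nat_le_iff of_nat_numeral of_nat_power)
    qed (use h_pos C_pos in auto)
    also have "\<dots> = K * (h * C * 2) ^ m"
      by (simp add: K_def power_add power_mult_distrib mult_ac)
    also have "h * C * 2 = 1 / 2" using C_pos by (simp add: h_def)
    finally show ?thesis using m by simp
  qed
  ultimately show "\<exists>g c. conv g c \<and> (\<forall>n. ex n (\<lambda>\<omega>. av n \<omega> (\<lambda>x. \<bar>x ^ j * exp (- (s + h) * x) - g x\<bar>)) \<le> \<delta>)"
    by blast
qed

lemma conv_power_exp: "\<exists>c. conv (\<lambda>x. x ^ j * exp (- (real m * h) * x)) c"
proof (induction m arbitrary: j)
  case 0
  then show ?case using conv_power by simp
next
  case (Suc m)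
  have "\<exists>c. conv (\<lambda>x. x ^ j * exp (- (real m * h + h) * x)) c"
    by (rule conv_power_exp_step) (use Suc h_pos in auto)
  then show ?case by (simp add: algebra_simps)
qed

text \<open>In the variable \<open>exp (- h * x)\<close>, which ranges over the unit interval, the
  functions already treated include all polynomials, and these are uniformly dense.\<close>

lemma conv_continuous:
  assumes "continuous_on {0..1} \<phi>"
  shows "\<exists>c. conv (\<lambda>x. \<phi> (exp (- h * x))) c"
proof (rule conv_approx)
  fix \<delta> :: real assume "\<delta> > 0"
  then obtain p where p: "real_polynomial_function p" "\<And>u. u \<in> {0..1} \<Longrightarrow> \<bar>\<phi> u - p u\<bar> < \<delta>"
    using Stone_Weierstrass_real_polynomial_function[OF compact_Icc assms] by metis
  then obtain a m where am: "p = (\<lambda>u. \<Sum>i\<le>m. a i * u ^ i)"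
    using real_polynomial_function_iff_sum by blast
  have "\<exists>c. conv (\<lambda>x. \<Sum>i\<le>m. a i * exp (- (real i * h) * x)) c"
  proof (rule conv_sum)
    fix i
    show "\<exists>c. conv (\<lambda>x. a i * exp (- (real i * h) * x)) c"
      using conv_power_exp[of 0 i] conv_cmult by fastforce
  qed auto
  moreover have "p (exp (- h * x)) = (\<Sum>i\<le>m. a i * exp (- (real i * h) * x))" for x
    unfolding am by (intro sum.cong refl) (simp add: algebra_simps flip: exp_of_nat_mult)
  ultimately have "\<exists>c. conv (\<lambda>x. p (exp (- h * x))) c" by simp
  moreover have "ex n (\<lambda>\<omega>. av n \<omega> (\<lambda>x. \<bar>\<phi> (exp (- h * x)) - p (exp (- h * x))\<bar>)) \<le> \<delta>" for n
  proof -
    have "ex n (\<lambda>\<omega>. av n \<omega> (\<lambda>x. \<bar>\<phi> (exp (- h * x)) - p (exp (- h * x))\<bar>)) \<le> ex n (\<lambda>\<omega>. av n \<omega> (\<lambda>x. \<delta>))"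
      using p(2) h_pos by (intro ex_mono av_mono) (auto intro!: less_imp_le)
    then show ?thesis by (simp add: av_const ex_const)
  qed
  ultimately show "\<exists>g c. conv g c \<and> (\<forall>n. ex n (\<lambda>\<omega>. av n \<omega> (\<lambda>x. \<bar>\<phi> (exp (- h * x)) - g x\<bar>)) \<le> \<delta>)"
    by blast
qed

text \<open>Cut off at \<open>B\<close>, the function is continuous in \<open>exp (- h * x)\<close>
  down to 0. The part beyond \<open>B\<close> is at most the square of \<open>x / B\<close> and is
  absorbed by the second moment.\<close>

lemma conv_ln:
  assumes "\<epsilon> > 0"
  shows "\<exists>c. conv (\<lambda>x. ln (x + \<epsilon>)) c"
proof (rule conv_approx)
  fix \<delta> :: real assume "\<delta> > 0"
  \<comment> \<open>Chosen so that the bound on the second moment divided by \<open>B ^ 2\<close> is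
    exactly \<open>\<delta>\<close>.\<close>
  define B where "B = sqrt (C ^ 2 * fact 2 / \<delta>)"
  have B: "B > 0" "C ^ 2 * fact 2 / B ^ 2 = \<delta>"
    using C_pos \<open>\<delta> > 0\<close> by (simp_all add: B_def)
  \<comment> \<open>Inverts \<open>u = exp (- h * x)\<close>, with \<open>x\<close> cut off at
    \<open>B\<close> so that no logarithm of 0 arises at \<open>u = 0\<close>.\<close>
  define \<phi> where "\<phi> u = ln (- ln (max u (exp (- h * B))) / h + \<epsilon>)" for u
  have "continuous_on {0..1} \<phi>"
    unfolding \<phi>_def
  proof (intro continuous_intros)
    show "\<forall>u\<in>{0..1}. max u (exp (- h * B)) \<noteq> 0"
      by (metis exp_gt_zero max.strict_coboundedI2 order_less_irrefl)
    show "\<forall>u\<in>{0..1}. - ln (max u (exp (- h * B))) / h + \<epsilon> \<noteq> 0"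
    proof
      fix u :: real assume u: "u \<in> {0..1}"
      then have "max u (exp (- h * B)) \<le> 1" using h_pos B by simp
      moreover have "max u (exp (- h * B)) > 0" by (simp add: less_max_iff_disj)
      ultimately have "ln (max u (exp (- h * B))) \<le> 0" by simp
      then have "- ln (max u (exp (- h * B))) / h \<ge> 0" using h_pos by (simp add: divide_nonpos_pos)
      then show "- ln (max u (exp (- h * B))) / h + \<epsilon> \<noteq> 0" using assms by linarith
    qed
  qed (use h_pos in auto)
  from conv_continuous[OF this] obtain c where c: "conv (\<lambda>x. \<phi> (exp (- h * x))) c" by blast
  have "\<phi> (exp (- h * x)) = ln (min x B + \<epsilon>)" for x
  proof -
    have "max (exp (- h * x)) (exp (- h * B)) = exp (- h * min x B)"
      using h_pos by (auto simp: max_def min_def)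
    then show ?thesis using h_pos by (simp add: \<phi>_def)
  qed
  with c have c: "conv (\<lambda>x. ln (min x B + \<epsilon>)) c" by simp
  have "ex n (\<lambda>\<omega>. av n \<omega> (\<lambda>x. \<bar>ln (x + \<epsilon>) - ln (min x B + \<epsilon>)\<bar>)) \<le> \<delta>" for n
  proof -
    have "\<bar>ln (x + \<epsilon>) - ln (min x B + \<epsilon>)\<bar> \<le> 1 / B ^ 2 * x ^ 2" if "x \<ge> 0" for x
    proof (cases "x \<le> B")
      case True
      then show ?thesis by simp
    next
      case False
      then have x: "x > B" by simp
      have "ln (x + \<epsilon>) - ln (B + \<epsilon>) = ln ((x + \<epsilon>) / (B + \<epsilon>))"
        using x B assms by (subst ln_div) auto
      also have "\<dots> \<le> (x + \<epsilon>) / (B + \<epsilon>) - 1"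
        using x B assms by (intro ln_le_minus_one) auto
      also have "\<dots> = (x - B) / (B + \<epsilon>)"
        using B assms by (simp add: field_simps)
      also have "\<dots> \<le> x / B"
        using x B assms by (intro frac_le) auto
      also have "\<dots> \<le> (x / B) ^ 2"
        using x B by (intro self_le_power) auto
      finally have "ln (x + \<epsilon>) - ln (B + \<epsilon>) \<le> (x / B) ^ 2" .
      moreover have "ln (B + \<epsilon>) \<le> ln (x + \<epsilon>)" using x B assms by simp
      ultimately show ?thesis using x by (simp add: power_divide min_def)
    qed
    then have "ex n (\<lambda>\<omega>. av n \<omega> (\<lambda>x. \<bar>ln (x + \<epsilon>) - ln (min x B + \<epsilon>)\<bar>)) \<le> ex n (\<lambda>\<omega>. av n \<omega> (\<lambda>x. 1 / B ^ 2 * x ^ 2))"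
      by (intro ex_mono av_mono)
    also have "\<dots> = 1 / B ^ 2 * ex n (\<lambda>\<omega>. av n \<omega> (\<lambda>x. x ^ 2))"
      by (simp only: av_cmult ex_cmult)
    also have "\<dots> \<le> 1 / B ^ 2 * (C ^ 2 * fact 2)"
      by (intro mult_left_mono moment_bound) auto
    finally show ?thesis using B by simp
  qed
  with c show "\<exists>g c. conv g c \<and> (\<forall>n. ex n (\<lambda>\<omega>. av n \<omega> (\<lambda>x. \<bar>ln (x + \<epsilon>) - g x\<bar>)) \<le> \<delta>)"
    by blast
qed

end

section \<open>Removing the regularization of the logarithm\<close>

context weighted_spectra
begin

lemma conv_imp_pr:
  assumes "conv f c" "t > 0"
  shows "(\<lambda>n. pr n (\<lambda>\<omega>. \<bar>av n \<omega> f - c\<bar> > t)) \<longlonglongrightarrow> 0"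
proof (rule tendsto_sandwich[of "\<lambda>_. 0"])
  show "\<forall>\<^sub>F n in sequentially. pr n (\<lambda>\<omega>. \<bar>av n \<omega> f - c\<bar> > t) \<le> ex n (\<lambda>\<omega>. \<bar>av n \<omega> f - c\<bar>) / t"
    using assms(2) by (intro always_eventually allI markov) auto
  show "(\<lambda>n. ex n (\<lambda>\<omega>. \<bar>av n \<omega> f - c\<bar>) / t) \<longlonglongrightarrow> 0"
    using assms tendsto_divide_zero unfolding conv_def by blast
qed (auto intro!: always_eventually pr_nonneg)

lemma pr_disj_tendsto:
  assumes "(\<lambda>n. pr n (P n)) \<longlonglongrightarrow> 0" "(\<lambda>n. pr n (Q n)) \<longlonglongrightarrow> 0"
    and "\<And>n \<omega>. \<omega> \<in> \<Omega> n \<Longrightarrow> w n \<omega> > 0 \<Longrightarrow> R n \<omega> \<Longrightarrow> P n \<omega> \<or> Q n \<omega>"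
  shows "(\<lambda>n. pr n (R n)) \<longlonglongrightarrow> 0"
proof (rule tendsto_sandwich[of "\<lambda>_. 0"])
  show "\<forall>\<^sub>F n in sequentially. pr n (R n) \<le> pr n (P n) + pr n (Q n)"
    using assms(3) by (intro always_eventually allI order.trans[OF pr_mono pr_disj]) auto
  show "(\<lambda>n. pr n (P n) + pr n (Q n)) \<longlonglongrightarrow> 0"
    using tendsto_add[OF assms(1,2)] by simp
qed (auto intro!: always_eventually pr_nonneg)

lemma pr_tendsto_witness:
  assumes "(\<lambda>n. pr n (P n)) \<longlonglongrightarrow> 0"
  obtains n \<omega> where "\<omega> \<in> \<Omega> n" "w n \<omega> > 0" "\<not> P n \<omega>"
proof -
  have "\<forall>\<^sub>F n in sequentially. pr n (P n) < 1"
    using assms by (intro order_tendstoD) auto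
  then obtain n where "pr n (P n) < 1" by (auto simp: eventually_sequentially)
  then show ?thesis using ex_witness that by blast
qed

text \<open>\<open>R\<close> lies below each regularized average and, up to small probability and a
  small \<open>t\<close>, at most \<open>K * sqrt \<epsilon>\<close> below it. The limits of the
  regularized averages therefore satisfy
  \<open>a \<epsilon> \<le> a \<epsilon>' + K * sqrt \<epsilon>\<close>, and \<open>R\<close>
  concentrates at their infimum.\<close>

theorem pr_tendsto_of_regularization:
  assumes conv: "\<And>\<epsilon>. \<epsilon> > 0 \<Longrightarrow> \<exists>c. conv (\<lambda>x. ln (x + \<epsilon>)) c"
    and le: "\<And>n \<omega> \<epsilon>. \<omega> \<in> \<Omega> n \<Longrightarrow> w n \<omega> > 0 \<Longrightarrow> \<epsilon> > 0 \<Longrightarrow> R n \<omega> \<le> av n \<omega> (\<lambda>x. ln (x + \<epsilon>))"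
    and ge: "\<And>\<epsilon> t. \<epsilon> > 0 \<Longrightarrow> t > 0 \<Longrightarrow>
      (\<lambda>n. pr n (\<lambda>\<omega>. av n \<omega> (\<lambda>x. ln (x + \<epsilon>)) - R n \<omega> > K * sqrt \<epsilon> + t)) \<longlonglongrightarrow> 0"
    and K: "K > 0"
    and lower: "\<And>t. t > 0 \<Longrightarrow> (\<lambda>n. pr n (\<lambda>\<omega>. R n \<omega> < l - t)) \<longlonglongrightarrow> 0"
    and upper: "\<And>n \<omega>. \<omega> \<in> \<Omega> n \<Longrightarrow> w n \<omega> > 0 \<Longrightarrow> R n \<omega> \<le> u"
  obtains c where "l \<le> c" "c \<le> u" "\<And>t. t > 0 \<Longrightarrow> (\<lambda>n. pr n (\<lambda>\<omega>. \<bar>R n \<omega> - c\<bar> > t)) \<longlonglongrightarrow> 0"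
proof -
  define Y where "Y \<epsilon> n \<omega> = av n \<omega> (\<lambda>x. ln (x + \<epsilon>))" for \<epsilon> n \<omega>
  obtain a where a: "\<And>\<epsilon>. \<epsilon> > 0 \<Longrightarrow> conv (\<lambda>x. ln (x + \<epsilon>)) (a \<epsilon>)"
    using conv by metis
  have Ya: "(\<lambda>n. pr n (\<lambda>\<omega>. \<bar>Y \<epsilon> n \<omega> - a \<epsilon>\<bar> > t)) \<longlonglongrightarrow> 0" if "\<epsilon> > 0" "t > 0" for \<epsilon> t
    unfolding Y_def by (rule conv_imp_pr[OF a that(2)]) (rule that)
  have Ra: "(\<lambda>n. pr n (\<lambda>\<omega>. R n \<omega> > a \<epsilon> + t \<or> R n \<omega> < a \<epsilon> - K * sqrt \<epsilon> - t)) \<longlonglongrightarrow> 0"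
    if "\<epsilon> > 0" "t > 0" for \<epsilon> t
  proof (rule pr_disj_tendsto[OF Ya[OF that(1), of "t/2"] ge[OF that(1), of "t/2"]])
    fix n \<omega> assume "\<omega> \<in> \<Omega> n" "w n \<omega> > 0" and *: "R n \<omega> > a \<epsilon> + t \<or> R n \<omega> < a \<epsilon> - K * sqrt \<epsilon> - t"
    then have "R n \<omega> \<le> Y \<epsilon> n \<omega>" using le that by (simp add: Y_def)
    then show "\<bar>Y \<epsilon> n \<omega> - a \<epsilon>\<bar> > t / 2 \<or> av n \<omega> (\<lambda>x. ln (x + \<epsilon>)) - R n \<omega> > K * sqrt \<epsilon> + t / 2"
      using * that unfolding Y_def[symmetric] by (smt (verit) field_sum_of_halves)
  qed (use that in auto)
  have a_le: "a \<epsilon> \<le> a \<epsilon>' + K * sqrt \<epsilon>" if \<epsilon>: "\<epsilon> > 0" "\<epsilon>' > 0" for \<epsilon> \<epsilon>'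
  proof (rule field_le_epsilon)
    fix t :: real assume t: "t > 0"
    \<comment> \<open>Two families of events of vanishing probability miss a common sample at some
      \<open>n\<close>; comparing the two intervals for \<open>R\<close> at this sample relates the
      deterministic limits.\<close>
    obtain n \<omega> where "\<not> ((R n \<omega> > a \<epsilon> + t/2 \<or> R n \<omega> < a \<epsilon> - K * sqrt \<epsilon> - t/2) \<or>
        (R n \<omega> > a \<epsilon>' + t/2 \<or> R n \<omega> < a \<epsilon>' - K * sqrt \<epsilon>' - t/2))"
      by (rule pr_tendsto_witness[OF pr_disj_tendsto[OF Ra[OF \<epsilon>(1), of "t/2"] Ra[OF \<epsilon>(2), of "t/2"], where R = "\<lambda>n \<omega>. (R n \<omega> > a \<epsilon> + t/2 \<or> R n \<omega> < a \<epsilon> - K * sqrt \<epsilon> - t/2) \<or>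
        (R n \<omega> > a \<epsilon>' + t/2 \<or> R n \<omega> < a \<epsilon>' - K * sqrt \<epsilon>' - t/2)"]]) (use t in auto)
    then show "a \<epsilon> \<le> a \<epsilon>' + K * sqrt \<epsilon> + t" by linarith
  qed
  define c where "c = Inf (a ` {0<..})"
  have bdd: "bdd_below (a ` {0<..})"
    by (rule bdd_belowI[of _ "a 1 - K"]) (use a_le[of 1] in fastforce)
  have c_le: "c \<le> a \<epsilon>" if "\<epsilon> > 0" for \<epsilon>
    unfolding c_def by (rule cInf_lower) (use that bdd in auto)
  have le_c: "a \<epsilon> \<le> c + K * sqrt \<epsilon>" if "\<epsilon> > 0" for \<epsilon>
  proof -
    have "a \<epsilon> - K * sqrt \<epsilon> \<le> c"
      unfolding c_def by (rule cInf_greatest) (use a_le[OF that] in \<open>auto simp: algebra_simps intro: exI[of _ 1]\<close>)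
    then show ?thesis by simp
  qed
  have main: "(\<lambda>n. pr n (\<lambda>\<omega>. \<bar>R n \<omega> - c\<bar> > t)) \<longlonglongrightarrow> 0" if t: "t > 0" for t
  proof -
    \<comment> \<open>Makes \<open>K * sqrt \<epsilon>\<close> equal to \<open>t / 4\<close>, which
      together with a fluctuation of \<open>t / 4\<close> stays below \<open>t\<close>.\<close>
    define \<epsilon> where "\<epsilon> = (t / (4 * K))\<^sup>2"
    have \<epsilon>: "\<epsilon> > 0" "K * sqrt \<epsilon> = t / 4" using t K by (simp_all add: \<epsilon>_def)
    show ?thesis
    proof (rule pr_disj_tendsto[OF Ra[OF \<epsilon>(1), of "t/4"] Ra[OF \<epsilon>(1), of "t/4"]])
      fix n \<omega> assume "\<bar>R n \<omega> - c\<bar> > t"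
      then show "(R n \<omega> > a \<epsilon> + t/4 \<or> R n \<omega> < a \<epsilon> - K * sqrt \<epsilon> - t/4) \<or> (R n \<omega> > a \<epsilon> + t/4 \<or> R n \<omega> < a \<epsilon> - K * sqrt \<epsilon> - t/4)"
        using c_le[OF \<epsilon>(1)] le_c[OF \<epsilon>(1)] \<epsilon>(2) t by linarith
    qed (use t in auto)
  qed
  have "l \<le> c"
  proof (rule field_le_epsilon)
    fix t :: real assume t: "t > 0"
    obtain n \<omega> where "\<not> (\<bar>R n \<omega> - c\<bar> > t/2 \<or> R n \<omega> < l - t/2)"
      by (rule pr_tendsto_witness[OF pr_disj_tendsto[OF main[of "t/2"] lower[of "t/2"],
            where R = "\<lambda>n \<omega>. \<bar>R n \<omega> - c\<bar> > t/2 \<or> R n \<omega> < l - t/2"]]) (use t in auto)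
    then show "l \<le> c + t" by linarith
  qed
  moreover have "c \<le> u"
  proof (rule field_le_epsilon)
    fix t :: real assume t: "t > 0"
    obtain n \<omega> where "\<omega> \<in> \<Omega> n" "w n \<omega> > 0" "\<not> (\<bar>R n \<omega> - c\<bar> > t)"
      by (rule pr_tendsto_witness[OF main[OF t]])
    then show "c \<le> u + t" using upper[of \<omega> n] by linarith
  qed
  ultimately show ?thesis using main that by blast
qed

end

section \<open>Tail bounds and limits for the determinantal law\<close>

text \<open>\<open>bases\<close> and \<open>wgt\<close> are restated with explicit \<open>d\<close>
  and \<open>n\<close>, since limits in \<open>n\<close> are taken outside the locale, where
  \<open>n\<close> is fixed.\<close>

definition face_bases :: "nat \<Rightarrow> nat \<Rightarrow> nat set set set" where
  "face_bases d n = {F. F \<subseteq> nsub {1..n} (Suc d) \<and> card F = (n - 1) choose d}"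

definition face_weight :: "nat \<Rightarrow> nat \<Rightarrow> nat set set \<Rightarrow> real" where
  "face_weight d n F = pdet F rgram / real n ^ ((n - 1) choose d)"

definition shifted_pdet :: "nat set set \<Rightarrow> real \<Rightarrow> real" where
  "shifted_pdet F \<epsilon> = pdet F (\<lambda>e f. rgram e f + (if e = f then \<epsilon> else 0))"

lemma sum_power_fact_le_exp:
  fixes x :: real
  assumes "x \<ge> 0"
  shows "(\<Sum>j\<le>m. x ^ j / fact j) \<le> exp x"
proof -
  have "(\<Sum>j\<le>m. inverse (fact j) *\<^sub>R x ^ j) \<le> suminf (\<lambda>j. inverse (fact j) *\<^sub>R x ^ j)"
    using assms by (intro sum_le_suminf summable_exp_generic) auto
  then show ?thesis by (simp add: exp_def divide_inverse mult.commute)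
qed

lemma sum_squares_le_square_sum:
  fixes a :: "'a \<Rightarrow> real"
  assumes "finite I" "\<And>i. i \<in> I \<Longrightarrow> a i \<ge> 0"
  shows "(\<Sum>i\<in>I. (a i)\<^sup>2) \<le> (\<Sum>i\<in>I. a i)\<^sup>2"
proof -
  have "(\<Sum>i\<in>I. (a i)\<^sup>2) \<le> (\<Sum>i\<in>I. a i * (\<Sum>j\<in>I. a j))"
    unfolding power2_eq_square using assms by (intro sum_mono mult_left_mono member_le_sum) auto
  then show ?thesis by (simp add: power2_eq_square flip: sum_distrib_right)
qed

lemma binomial_le_power_div_fact: "real (n choose j) \<le> real n ^ j / fact j"
proof -
  have "(n choose j) * fact j \<le> n ^ j" by (rule binomial_fact_pow)
  then have "real ((n choose j) * fact j) \<le> real (n ^ j)" by (simp only: of_nat_le_iff)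
  then show ?thesis by (simp add: le_divide_eq)
qed

section \<open>Exact sums over bases and the resulting tail bounds\<close>

context hypertree_kernel
begin

lemma bases_eq: "bases = face_bases d n"
  unfolding face_bases_def facets_def[symmetric] rk_def[symmetric] supersets_def by simp

lemma wgt_eq: "wgt F = face_weight d n F"
  unfolding face_weight_def rk_def[symmetric] wgt_def by simp

lemma face_weight_eq: "face_weight d n F = pdet F rgram / real n ^ rk"
  unfolding face_weight_def rk_def ..

lemma finite_face_bases: "finite (face_bases d n)"
  unfolding bases_eq[symmetric] by (rule finite_supersets)

lemma face_weight_nonneg: "F \<in> face_bases d n \<Longrightarrow> face_weight d n F \<ge> 0"
  using wgt_nonneg unfolding bases_eq wgt_eq .

lemma sum_face_weight: "(\<Sum>F\<in>face_bases d n. face_weight d n F) = 1"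
  using sum_wgt unfolding bases_eq wgt_eq .

lemma face_bases_D: "F \<in> face_bases d n \<Longrightarrow> F \<subseteq> facets \<and> card F = rk"
  unfolding face_bases_def facets_def[symmetric] rk_def[symmetric] by simp

text \<open>A binomial coefficient of N over k is at most (e N / k)^k, and
  \<open>card_facets\<close> evaluates N / k as n / (d + 1).\<close>

lemma card_face_bases_le: "real (card (face_bases d n)) \<le> (exp 1 * real n / (real d + 1)) ^ rk"
proof (cases "rk = 0")
  case True
  have "card (face_bases d n) = card facets choose rk"
    using card_supersets_of_card[OF finite_V, of "{}" rk] bases_eq by (simp add: supersets_def)
  then show ?thesis using True by simp
next
  case False
  have "face_bases d n = supersets {} rk" by (rule bases_eq[symmetric])
  then have "card (face_bases d n) = card facets choose rk"
    using card_supersets_of_card[OF finite_V, of "{}" rk] by (simp add: supersets_def)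
  then have "real (card (face_bases d n)) \<le> real (card facets) ^ rk / fact rk"
    using binomial_le_power_div_fact by simp
  also have "\<dots> \<le> real (card facets) ^ rk * (exp (real rk) / real rk ^ rk)"
  proof -
    have "real rk ^ rk / fact rk \<le> (\<Sum>j\<le>rk. real rk ^ j / fact j)"
      by (rule member_le_sum) auto
    also have "\<dots> \<le> exp (real rk)" by (rule sum_power_fact_le_exp) simp
    finally have "1 / fact rk \<le> exp (real rk) / real rk ^ rk"
      using False by (simp add: field_simps)
    then have "real (card facets) ^ rk * (1 / fact rk) \<le> real (card facets) ^ rk * (exp (real rk) / real rk ^ rk)"
      by (rule mult_left_mono) simp
    then show ?thesis by (simp only: times_divide_eq_right mult_1_right)
  qed
  also have "\<dots> = (exp 1 * real (card facets) / real rk) ^ rk"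
    by (simp add: power_mult_distrib power_divide flip: exp_of_nat_mult)
  also have "exp 1 * real (card facets) / real rk = exp 1 * (real (card facets) / real rk)" by simp
  also have "real (card facets) / real rk = real n / (real d + 1)"
    using card_facets False by (simp add: field_simps)
  also have "exp 1 * (real n / (real d + 1)) = exp 1 * real n / (real d + 1)" by simp
  finally show ?thesis .
qed

text \<open>After the exact evaluation by \<open>sum_pdet_add_diag\<close>, the term with
  \<open>j = rk - m\<close> is at most the square of \<open>x ^ j / fact j\<close>. A sum of squares
  of non-negative numbers is at most the square of their sum, and the exponential series bounds the
  latter.\<close>

lemma sum_shifted_pdet_le:
  assumes \<epsilon>: "\<epsilon> > 0"
  shows "(\<Sum>F\<in>face_bases d n. shifted_pdet F \<epsilon>) / real n ^ rk \<le> exp (2 * real rk * sqrt (\<epsilon> / (real d + 1)))"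
proof -
  \<comment> \<open>Comes from \<open>x\<^sup>2 = \<epsilon> * card facets * rk / n\<close>,
    rewritten with \<open>card_facets\<close>.\<close>
  define x where "x = real rk * sqrt (\<epsilon> / (real d + 1))"
  have x: "x \<ge> 0" using \<epsilon> by (simp add: x_def)
  have "(\<Sum>F\<in>face_bases d n. shifted_pdet F \<epsilon>) / real n ^ rk
     = (\<Sum>m\<le>rk. \<epsilon> ^ (rk - m) * real ((card facets - m) choose (rk - m)) * (real n ^ m * real (rk choose m)) / real n ^ rk)"
    unfolding bases_eq[symmetric] shifted_pdet_def sum_pdet_add_diag by (simp add: sum_divide_distrib)
  also have "\<dots> \<le> (\<Sum>m\<le>rk. (x ^ (rk - m) / fact (rk - m))\<^sup>2)"
  proof (rule sum_mono)
    fix m assume "m \<in> {..rk}"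
    then have m: "m \<le> rk" by simp
    define j where "j = rk - m"
    have n_pow: "real n ^ m / real n ^ rk = 1 / real n ^ j"
      using m n_pos by (simp add: j_def power_diff)
    have "\<epsilon> ^ j * real ((card facets - m) choose j) * (real n ^ m * real (rk choose m)) / real n ^ rk
        = \<epsilon> ^ j * real ((card facets - m) choose j) * real (rk choose m) * (real n ^ m / real n ^ rk)"
      by simp
    also have "\<dots> = \<epsilon> ^ j * real ((card facets - m) choose j) * real (rk choose j) * (1 / real n ^ j)"
      unfolding n_pow using binomial_symmetric[OF m] by (simp add: j_def)
    also have "\<dots> \<le> \<epsilon> ^ j * (real (card facets) ^ j / fact j) * (real rk ^ j / fact j) * (1 / real n ^ j)"
    proof (intro mult_right_mono mult_mono mult_left_mono binomial_le_power_div_fact)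
      have "real ((card facets - m) choose j) \<le> real (card facets - m) ^ j / fact j"
        by (rule binomial_le_power_div_fact)
      also have "\<dots> \<le> real (card facets) ^ j / fact j"
        by (intro divide_right_mono power_mono) auto
      finally show "real ((card facets - m) choose j) \<le> real (card facets) ^ j / fact j" .
    qed (use \<epsilon> in auto)
    also have "\<dots> = (\<epsilon> * real (card facets) * real rk / real n) ^ j / (fact j)\<^sup>2"
      by (simp add: power_mult_distrib power_divide power2_eq_square)
    also have "\<epsilon> * real (card facets) * real rk / real n = x\<^sup>2"
    proof -
      have "real (card facets) = real n * real rk / (real d + 1)"
        using card_facets by (simp add: field_simps)
      moreover have "x\<^sup>2 = (real rk)\<^sup>2 * (\<epsilon> / (real d + 1))"
        using \<epsilon> by (simp add: x_def power_mult_distrib)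
      ultimately show ?thesis
        using n_pos by (simp add: power2_eq_square)
    qed
    finally show "\<epsilon> ^ (rk - m) * real ((card facets - m) choose (rk - m)) * (real n ^ m * real (rk choose m)) / real n ^ rk
        \<le> (x ^ (rk - m) / fact (rk - m))\<^sup>2"
      by (simp add: j_def power_divide power_commutes mult.commute flip: power_mult)
  qed
  also have "\<dots> = (\<Sum>j\<le>rk. (x ^ j / fact j)\<^sup>2)"
    by (rule sum.reindex_bij_witness[where i = "\<lambda>j. rk - j" and j = "\<lambda>m. rk - m"]) auto
  also have "\<dots> \<le> (\<Sum>j\<le>rk. x ^ j / fact j)\<^sup>2"
    using x by (intro sum_squares_le_square_sum) auto
  also have "\<dots> \<le> (exp x)\<^sup>2"
    using x by (intro power_mono sum_power_fact_le_exp sum_nonneg) auto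
  also have "\<dots> = exp (2 * real rk * sqrt (\<epsilon> / (real d + 1)))"
    by (simp add: x_def flip: exp_double mult.assoc)
  finally show ?thesis .
qed

text \<open>Markov's inequality for the ratio of shifted to unshifted determinant: the weight
  cancels the denominator, and the mean is bounded by \<open>sum_shifted_pdet_le\<close>. The
  threshold exceeds that bound by the factor \<open>exp (rk * t)\<close>.\<close>

lemma sum_face_weight_ratio_large:
  assumes \<epsilon>: "\<epsilon> > 0"
  shows "(\<Sum>F\<in>face_bases d n. if shifted_pdet F \<epsilon> > exp (real rk * (2 / sqrt (real d + 1) * sqrt \<epsilon> + t)) * pdet F rgram then face_weight d n F else 0)
    \<le> exp (- real rk * t)"
proof -
  define y where "y = exp (real rk * (2 / sqrt (real d + 1) * sqrt \<epsilon> + t))"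
  have nn: "shifted_pdet F \<epsilon> \<ge> 0" if F: "F \<in> face_bases d n" for F
  proof -
    obtain lam where lam: "\<And>i. i < card F \<Longrightarrow> lam i \<ge> 0"
      "\<And>c. pdet F (\<lambda>e f. rgram e f + (if e = f then c else 0)) = (\<Prod>i<card F. lam i + c)"
      "\<And>j. mtrace F rgram j = (\<Sum>i<card F. lam i ^ j)"
    proof (rule rgram_spectrum[of "{1..n}" F d])
      show "F \<subseteq> nsub {1..n} (Suc d)" using face_bases_D[OF F] unfolding facets_def by blast
    qed (simp, rule that)
    show ?thesis unfolding shifted_pdet_def lam(2) using lam(1) \<epsilon> by (intro prod_nonneg) (simp add: add_nonneg_pos less_imp_le)
  qed
  have "(\<Sum>F\<in>face_bases d n. if shifted_pdet F \<epsilon> > y * pdet F rgram then face_weight d n F else 0) \<le> (\<Sum>F\<in>face_bases d n. (1 / y) * (shifted_pdet F \<epsilon> / real n ^ rk))"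
  proof (rule sum_mono)
    fix F assume F: "F \<in> face_bases d n"
    show "(if shifted_pdet F \<epsilon> > y * pdet F rgram then face_weight d n F else 0) \<le> (1 / y) * (shifted_pdet F \<epsilon> / real n ^ rk)"
    proof (cases "shifted_pdet F \<epsilon> > y * pdet F rgram")
      case True
      have "y > 0" by (simp add: y_def)
      then have "pdet F rgram \<le> (1 / y) * shifted_pdet F \<epsilon>" using True by (simp add: field_simps)
      then have "pdet F rgram / real n ^ rk \<le> (1 / y) * shifted_pdet F \<epsilon> / real n ^ rk"
        by (rule divide_right_mono) simp
      then show ?thesis using True by (simp add: face_weight_eq)
    next
      case False
      then show ?thesis using nn[OF F] by (simp add: y_def)
    qed
  qed
  also have "\<dots> = (1 / y) * ((\<Sum>F\<in>face_bases d n. shifted_pdet F \<epsilon>) / real n ^ rk)"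
    by (simp only: sum_distrib_left sum_divide_distrib)
  also have "\<dots> \<le> (1 / y) * exp (2 * real rk * sqrt (\<epsilon> / (real d + 1)))"
    by (intro mult_left_mono sum_shifted_pdet_le \<epsilon>) (simp add: y_def)
  also have "\<dots> = exp (2 * real rk * sqrt (\<epsilon> / (real d + 1)) - real rk * (2 / sqrt (real d + 1) * sqrt \<epsilon> + t))"
    by (simp add: y_def exp_diff)
  also have "2 * real rk * sqrt (\<epsilon> / (real d + 1)) - real rk * (2 / sqrt (real d + 1) * sqrt \<epsilon> + t) = - real rk * t"
    by (simp add: real_sqrt_divide algebra_simps)
  finally show ?thesis unfolding y_def .
qed

text \<open>Every set in question has weight below the threshold divided by \<open>n ^ rk\<close>,
  and \<open>card_face_bases_le\<close> bounds how many sets there are.\<close>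

lemma sum_face_weight_small:
  "(\<Sum>F\<in>face_bases d n. if pdet F rgram < exp (real rk * (ln (real d + 1) - 1 - t)) then face_weight d n F else 0)
    \<le> exp (- real rk * t)"
proof -
  define y where "y = exp (real rk * (ln (real d + 1) - 1 - t))"
  have "(\<Sum>F\<in>face_bases d n. if pdet F rgram < y then face_weight d n F else 0) \<le> (\<Sum>F\<in>face_bases d n. y / real n ^ rk)"
    by (intro sum_mono) (auto simp: face_weight_eq y_def intro!: divide_right_mono)
  also have "\<dots> = real (card (face_bases d n)) * (y / real n ^ rk)" by simp
  also have "\<dots> \<le> (exp 1 * real n / (real d + 1)) ^ rk * (y / real n ^ rk)"
    by (intro mult_right_mono card_face_bases_le) (simp add: y_def)
  also have "\<dots> = (exp 1 / (real d + 1)) ^ rk * y"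
    using n_pos by (simp add: power_mult_distrib power_divide)
  also have "exp 1 / (real d + 1) = exp (1 - ln (real d + 1))"
    by (simp add: exp_diff)
  also have "exp (1 - ln (real d + 1)) ^ rk * y = exp (- real rk * t)"
    unfolding y_def by (simp add: algebra_simps flip: exp_of_nat_mult exp_add)
  finally show ?thesis unfolding y_def .
qed

end

section \<open>Asymptotics of the rank and of the trace statistics\<close>

definition trace_mean :: "nat \<Rightarrow> nat \<Rightarrow> nat \<Rightarrow> real" where
  "trace_mean d m n = (\<Sum>F\<in>face_bases d n. face_weight d n F * mtrace F rgram (Suc m))"

definition trace_var :: "nat \<Rightarrow> nat \<Rightarrow> nat \<Rightarrow> real" where
  "trace_var d m n = (\<Sum>F\<in>face_bases d n. face_weight d n F * (mtrace F rgram (Suc m) - trace_mean d m n)\<^sup>2)"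

lemma rank_div_binomial: "n \<ge> d \<Longrightarrow> n > 0 \<Longrightarrow> real ((n - 1) choose d) = real (n choose d) * (1 - real d / real n)"
proof -
  assume n: "n \<ge> d" "n > 0"
  have "(n - d) * (n choose d) = n * ((n - 1) choose d)" by (rule binomial_absorb_comp)
  then have "real ((n - d) * (n choose d)) = real (n * ((n - 1) choose d))" by (rule arg_cong)
  then show ?thesis using n by (simp add: of_nat_diff field_simps)
qed

lemma rank_div_binomial_lim: "(\<lambda>n. real ((n - 1) choose d) / real (n choose d)) \<longlonglongrightarrow> 1"
proof -
  have 1: "(\<lambda>n. 1 - real d / real n) \<longlonglongrightarrow> 1 - 0"
    by (intro tendsto_intros lim_const_over_n)
  have 2: "\<forall>\<^sub>F n in sequentially. 1 - real d / real n = real ((n - 1) choose d) / real (n choose d)"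
  proof (rule eventually_sequentiallyI[of "d + 1"])
    fix n assume "d + 1 \<le> n"
    then have n: "n \<ge> d" "n > 0" by auto
    then have "real (n choose d) > 0" by simp
    then show "1 - real d / real n = real ((n - 1) choose d) / real (n choose d)"
      using rank_div_binomial[OF n] by simp
  qed
  show ?thesis using Lim_transform_eventually[OF 1 2] by simp
qed

lemma rank_div_power_lim: "(\<lambda>n. real ((n - 1) choose d) / real n ^ d) \<longlonglongrightarrow> 1 / fact d"
proof -
  have 1: "(\<lambda>n. real ((n - 1) choose d) / real (n choose d) * (real (n choose d) / real n ^ d)) \<longlonglongrightarrow> 1 * (1 / fact d)"
    by (intro tendsto_mult rank_div_binomial_lim binomial_div_power_lim)
  have 2: "\<forall>\<^sub>F n in sequentially. real ((n - 1) choose d) / real (n choose d) * (real (n choose d) / real n ^ d)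
      = real ((n - 1) choose d) / real n ^ d"
  proof (rule eventually_sequentiallyI[of d])
    fix n assume "d \<le> n"
    then have "real (n choose d) > 0" by simp
    then show "real ((n - 1) choose d) / real (n choose d) * (real (n choose d) / real n ^ d) = real ((n - 1) choose d) / real n ^ d" by simp
  qed
  show ?thesis using Lim_transform_eventually[OF 1 2] by simp
qed

lemma power_div_rank_lim: "(\<lambda>n. real n ^ d / real ((n - 1) choose d)) \<longlonglongrightarrow> fact d"
  using tendsto_inverse[OF rank_div_power_lim[of d]] by (simp add: inverse_eq_divide)

lemma inverse_rank_lim: "d > 0 \<Longrightarrow> (\<lambda>n. 1 / real ((n - 1) choose d)) \<longlonglongrightarrow> 0"
proof -
  assume d: "d > 0"
  have "(\<lambda>n. (1 / real n) ^ d * (real n ^ d / real ((n - 1) choose d))) \<longlonglongrightarrow> 0 ^ d * fact d"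
    by (intro tendsto_mult tendsto_power lim_const_over_n power_div_rank_lim)
  moreover have "\<forall>\<^sub>F n in sequentially. (1 / real n) ^ d * (real n ^ d / real ((n - 1) choose d)) = 1 / real ((n - 1) choose d)"
    by (rule eventually_sequentiallyI[of 1]) (simp add: power_divide)
  ultimately have "(\<lambda>n. 1 / real ((n - 1) choose d)) \<longlonglongrightarrow> 0 ^ d * fact d"
    by (rule Lim_transform_eventually)
  then show "(\<lambda>n. 1 / real ((n - 1) choose d)) \<longlonglongrightarrow> 0" using d by (simp add: power_0_left)
qed

lemma trace_mean_lim:
  obtains c where "(\<lambda>n. trace_mean d m n / real ((n - 1) choose d)) \<longlonglongrightarrow> c"
proof -
  define M where "M n = (\<Sum>L\<in>lists_of (nsub {1..n} (Suc d)) (Suc m).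
    (closed_walk_weight rgram L * pdet (set L) rgram) / real n ^ card (set L))" for n
  obtain a where a: "(\<lambda>n. M n / real n ^ d) \<longlonglongrightarrow> a"
    using convergent_closed_walk_weight_sum[of "Suc m" d] unfolding M_def convergent_def by auto
  have "(\<lambda>n. M n / real n ^ d * (real n ^ d / real ((n - 1) choose d))) \<longlonglongrightarrow> a * fact d"
    by (intro tendsto_mult a power_div_rank_lim)
  moreover have "\<forall>\<^sub>F n in sequentially. M n / real n ^ d * (real n ^ d / real ((n - 1) choose d)) = trace_mean d m n / real ((n - 1) choose d)"
  proof (rule eventually_sequentiallyI[of 1])
    fix n :: nat assume n: "1 \<le> n"
    then interpret hypertree_kernel d n by unfold_locales simp
    have "trace_mean d m n = mean m"
      unfolding trace_mean_def mean_def bases_eq wgt_eq ..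
    also have "\<dots> = M n" unfolding M_def facets_def[symmetric] by (rule mean_eq')
    finally show "M n / real n ^ d * (real n ^ d / real ((n - 1) choose d)) = trace_mean d m n / real ((n - 1) choose d)"
      using n by simp
  qed
  ultimately have "(\<lambda>n. trace_mean d m n / real ((n - 1) choose d)) \<longlonglongrightarrow> a * fact d"
    by (rule Lim_transform_eventually)
  then show ?thesis by (rule that)
qed

text \<open>The variance is at most of order \<open>n ^ d\<close> by the sum over linked pairs,
  while the squared rank grows like \<open>n ^ (2 * d)\<close>.\<close>

lemma trace_var_lim:
  assumes d: "d > 0"
  shows "(\<lambda>n. trace_var d m n / (real ((n - 1) choose d))\<^sup>2) \<longlonglongrightarrow> 0"
proof -
  define U where "U n = (\<Sum>L\<in>lists_of (nsub {1..n} (Suc d)) (Suc m). \<Sum>L'\<in>lists_of (nsub {1..n} (Suc d)) (Suc m).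
    pair_weight L L' / real n ^ card (set L \<union> set L'))" for n
  obtain a where a: "(\<lambda>n. U n / real n ^ d) \<longlonglongrightarrow> a"
    using convergent_pair_sum[of "Suc m" d] unfolding U_def convergent_def by auto
  have lim: "(\<lambda>n. U n / real n ^ d * (real n ^ d / real ((n - 1) choose d)) * (1 / real ((n - 1) choose d))) \<longlonglongrightarrow> a * fact d * 0"
    by (intro tendsto_mult a power_div_rank_lim inverse_rank_lim d)
  have bnd: "trace_var d m n \<ge> 0 \<and> trace_var d m n \<le> U n" if n: "n \<ge> 1" for n
  proof -
    from n interpret hypertree_kernel d n by unfold_locales simp
    have "trace_mean d m n = mean m"
      unfolding trace_mean_def mean_def bases_eq wgt_eq ..
    then have "trace_var d m n = (\<Sum>T\<in>bases. wgt T * (mtrace T rgram (Suc m) - mean m)\<^sup>2)"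
      unfolding trace_var_def bases_eq wgt_eq by simp
    then have "trace_var d m n \<le> U n"
      using variance_le[of m] unfolding U_def facets_def[symmetric] by simp
    moreover have "trace_var d m n \<ge> 0"
      unfolding trace_var_def by (intro sum_nonneg mult_nonneg_nonneg face_weight_nonneg) auto
    ultimately show ?thesis by simp
  qed
  show ?thesis
  proof (rule tendsto_sandwich[of "\<lambda>_. 0"])
    show "\<forall>\<^sub>F n in sequentially. 0 \<le> trace_var d m n / (real ((n - 1) choose d))\<^sup>2"
      using bnd by (intro eventually_sequentiallyI[of 1]) simp
    show "\<forall>\<^sub>F n in sequentially. trace_var d m n / (real ((n - 1) choose d))\<^sup>2
       \<le> U n / real n ^ d * (real n ^ d / real ((n - 1) choose d)) * (1 / real ((n - 1) choose d))"
    proof (rule eventually_sequentiallyI[of 1])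
      fix n :: nat assume n: "1 \<le> n"
      have "trace_var d m n / (real ((n - 1) choose d))\<^sup>2 \<le> U n / (real ((n - 1) choose d))\<^sup>2"
        using bnd[OF n] by (intro divide_right_mono) auto
      also have "\<dots> = U n / real n ^ d * (real n ^ d / real ((n - 1) choose d)) * (1 / real ((n - 1) choose d))"
        using n by (simp add: power2_eq_square)
      finally show "trace_var d m n / (real ((n - 1) choose d))\<^sup>2
        \<le> U n / real n ^ d * (real n ^ d / real ((n - 1) choose d)) * (1 / real ((n - 1) choose d))" .
    qed
  qed (use lim in auto)
qed

section \<open>The limit theorem\<close>

definition hrank :: "nat \<Rightarrow> nat \<Rightarrow> nat" where
  "hrank d n = (n - 1) choose d"

text \<open>A fixed choice, so that the eigenvalues are a function of \<open>F\<close> and can serve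
  as the spectra in \<open>weighted_spectra\<close>.\<close>

definition eigenvalue_seq :: "nat set set \<Rightarrow> nat \<Rightarrow> real" where
  "eigenvalue_seq F = (SOME lam. (\<forall>i<card F. lam i \<ge> 0) \<and> (\<forall>c. shifted_pdet F c = (\<Prod>i<card F. lam i + c)) \<and>
    (\<forall>j. mtrace F rgram j = (\<Sum>i<card F. lam i ^ j)))"

lemma eigenvalue_seq:
  assumes "F \<in> face_bases d n"
  shows "\<And>i. i < hrank d n \<Longrightarrow> eigenvalue_seq F i \<ge> 0"
    and "\<And>c. shifted_pdet F c = (\<Prod>i<hrank d n. eigenvalue_seq F i + c)"
    and "\<And>j. mtrace F rgram j = (\<Sum>i<hrank d n. eigenvalue_seq F i ^ j)"
proof -
  have F: "F \<subseteq> nsub {1..n} (Suc d)" "card F = hrank d n"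
    using assms by (simp_all add: face_bases_def hrank_def)
  have "\<exists>lam. (\<forall>i<card F. lam i \<ge> 0) \<and> (\<forall>c. shifted_pdet F c = (\<Prod>i<card F. lam i + c)) \<and>
    (\<forall>j. mtrace F rgram j = (\<Sum>i<card F. lam i ^ j))"
    by (rule rgram_spectrum[OF finite_atLeastAtMost F(1)], unfold shifted_pdet_def) blast
  then have "(\<forall>i<card F. eigenvalue_seq F i \<ge> 0) \<and> (\<forall>c. shifted_pdet F c = (\<Prod>i<card F. eigenvalue_seq F i + c)) \<and>
    (\<forall>j. mtrace F rgram j = (\<Sum>i<card F. eigenvalue_seq F i ^ j))"
    unfolding eigenvalue_seq_def by (rule someI_ex)
  note this[unfolded F(2)]
  then show "\<And>i. i < hrank d n \<Longrightarrow> eigenvalue_seq F i \<ge> 0"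
    and "\<And>c. shifted_pdet F c = (\<Prod>i<hrank d n. eigenvalue_seq F i + c)"
    and "\<And>j. mtrace F rgram j = (\<Sum>i<hrank d n. eigenvalue_seq F i ^ j)"
    by blast+
qed

lemma shifted_pdet_0: "shifted_pdet F 0 = pdet F rgram"
  by (simp add: shifted_pdet_def)

lemma hrank_pos: "d + 1 \<le> n \<Longrightarrow> hrank d n > 0"
  by (simp add: hrank_def)

lemma exp_rank_lim:
  assumes "d > 0" "t > 0"
  shows "(\<lambda>n. exp (- real (hrank d n) * t)) \<longlonglongrightarrow> 0"
proof (rule tendsto_sandwich[of "\<lambda>_. 0"])
  show "\<forall>\<^sub>F n in sequentially. exp (- real (hrank d n) * t) \<le> 1 / t * (1 / real (hrank d n))"
  proof (rule eventually_sequentiallyI[of "d + 1"])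
    fix n assume "d + 1 \<le> n"
    then have "real (hrank d n) * t > 0" using hrank_pos assms(2) by simp
    moreover have "real (hrank d n) * t \<le> exp (real (hrank d n) * t)"
      using exp_ge_add_one_self[of "real (hrank d n) * t"] by linarith
    ultimately have "inverse (exp (real (hrank d n) * t)) \<le> inverse (real (hrank d n) * t)"
      by (intro le_imp_inverse_le)
    then show "exp (- real (hrank d n) * t) \<le> 1 / t * (1 / real (hrank d n))"
      by (simp add: exp_minus inverse_eq_divide mult.commute)
  qed
  show "(\<lambda>n. 1 / t * (1 / real (hrank d n))) \<longlonglongrightarrow> 0"
    using tendsto_mult_right_zero[OF inverse_rank_lim[OF assms(1)]] unfolding hrank_def .
qed auto

text \<open>The variance of \<open>\<bar>X\<bar>\<close> is non-negative.\<close>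

lemma (in weighted_spectra) ex_abs_le: "ex n (\<lambda>\<omega>. \<bar>X \<omega>\<bar>) \<le> sqrt (ex n (\<lambda>\<omega>. (X \<omega>)\<^sup>2))"
proof (rule real_le_rsqrt)
  define a where "a = ex n (\<lambda>\<omega>. \<bar>X \<omega>\<bar>)"
  have "0 \<le> ex n (\<lambda>\<omega>. (\<bar>X \<omega>\<bar> - a)\<^sup>2)" by (intro ex_nonneg) auto
  also have "(\<lambda>\<omega>. (\<bar>X \<omega>\<bar> - a)\<^sup>2) = (\<lambda>\<omega>. (X \<omega>)\<^sup>2 + ((- 2 * a) * \<bar>X \<omega>\<bar> + a\<^sup>2))"
    by (simp add: power2_eq_square algebra_simps abs_mult_self_eq)
  also have "ex n (\<lambda>\<omega>. (X \<omega>)\<^sup>2 + ((- 2 * a) * \<bar>X \<omega>\<bar> + a\<^sup>2)) = ex n (\<lambda>\<omega>. (X \<omega>)\<^sup>2) + ((- 2 * a) * a + a\<^sup>2)"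
    unfolding ex_add ex_cmult ex_const a_def ..
  finally show "(ex n (\<lambda>\<omega>. \<bar>X \<omega>\<bar>))\<^sup>2 \<le> ex n (\<lambda>\<omega>. (X \<omega>)\<^sup>2)"
    by (simp add: power2_eq_square a_def)
qed

lemma log_det_concentration:
  assumes d: "d > 0"
  obtains c where "ln (real d + 1) - 1 \<le> c" "c \<le> ln (real d + 1)"
    "\<And>t. t > 0 \<Longrightarrow> (\<lambda>n. \<Sum>F\<in>face_bases d n. if \<bar>ln (pdet F rgram) / real (hrank d n) - c\<bar> > t then face_weight d n F else 0) \<longlonglongrightarrow> 0"
proof -
  \<comment> \<open>\<open>weighted_spectra\<close> demands a positive rank at every index, which
    needs at least \<open>d + 1\<close> vertices; the shift is undone at the end by
    \<open>LIMSEQ_offset\<close>.\<close>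
  define N where "N n = n + (d + 1)" for n
  have N: "d + 1 \<le> N n" "N n > 0" for n by (simp_all add: N_def)
  have hk: "hypertree_kernel (N n)" for n by unfold_locales (rule N)
  have shiftN: "(\<lambda>n. f (N n)) \<longlonglongrightarrow> l" if "f \<longlonglongrightarrow> l" for f :: "nat \<Rightarrow> real" and l
    unfolding N_def using that by (rule LIMSEQ_ignore_initial_segment)
  have rk: "hypertree_kernel.rk d (N n) = hrank d (N n)" for n
    unfolding hypertree_kernel.rk_def[OF hk] hrank_def ..
  interpret ws: weighted_spectra "\<lambda>n. face_bases d (N n)" "\<lambda>n. face_weight d (N n)" "\<lambda>n. hrank d (N n)" "\<lambda>_. eigenvalue_seq"
  proof
    fix n
    show "finite (face_bases d (N n))" by (rule hypertree_kernel.finite_face_bases[OF hk])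
    show "(\<Sum>F\<in>face_bases d (N n). face_weight d (N n) F) = 1" by (rule hypertree_kernel.sum_face_weight[OF hk])
    show "hrank d (N n) > 0" using N(1) by (rule hrank_pos)
    fix F assume F: "F \<in> face_bases d (N n)"
    show "face_weight d (N n) F \<ge> 0" using F by (rule hypertree_kernel.face_weight_nonneg[OF hk])
    show "eigenvalue_seq F i \<ge> 0" if "i < hrank d (N n)" for i using eigenvalue_seq(1)[OF F that] .
  qed
  have av_power: "ws.av n F (\<lambda>x. x ^ j) = mtrace F rgram j / real (hrank d (N n))" if "F \<in> face_bases d (N n)" for n F j
    unfolding ws.av_def eigenvalue_seq(3)[OF that] ..
  have conv_power: "\<exists>c. ws.conv (\<lambda>x. x ^ j) c" for j
  proof (cases j)
    case 0
    then show ?thesis using ws.conv_const[of 1] by auto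
  next
    case (Suc m)
    obtain c where c: "(\<lambda>n. trace_mean d m n / real (hrank d n)) \<longlonglongrightarrow> c"
      using trace_mean_lim[of d m] unfolding hrank_def by blast
    have "ws.conv (\<lambda>x. x ^ j) c"
      unfolding ws.conv_def
    proof (rule tendsto_sandwich[of "\<lambda>_. 0"])
      have v: "(\<lambda>n. sqrt (trace_var d m n / (real (hrank d n))\<^sup>2)) \<longlonglongrightarrow> sqrt 0"
        using trace_var_lim[OF d, of m] unfolding hrank_def by (rule tendsto_real_sqrt)
      have "(\<lambda>n. sqrt (trace_var d m n / (real (hrank d n))\<^sup>2) + \<bar>trace_mean d m n / real (hrank d n) - c\<bar>) \<longlonglongrightarrow> sqrt 0 + \<bar>c - c\<bar>"
        by (intro tendsto_add v tendsto_rabs tendsto_diff c tendsto_const)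
      from shiftN[OF this] show "(\<lambda>n. sqrt (trace_var d m (N n) / (real (hrank d (N n)))\<^sup>2) + \<bar>trace_mean d m (N n) / real (hrank d (N n)) - c\<bar>) \<longlonglongrightarrow> 0"
        by simp
      have "ws.ex n (\<lambda>\<omega>. \<bar>ws.av n \<omega> (\<lambda>x. x ^ j) - c\<bar>)
         \<le> sqrt (trace_var d m (N n) / (real (hrank d (N n)))\<^sup>2) + \<bar>trace_mean d m (N n) / real (hrank d (N n)) - c\<bar>" for n
      proof -
        \<comment> \<open>The deviation from \<open>c\<close> is split into the fluctuation about
          the mean, controlled by the variance, and the distance of the mean from its limit.\<close>
        define \<mu> where "\<mu> = trace_mean d m (N n) / real (hrank d (N n))"
        have "ws.ex n (\<lambda>\<omega>. \<bar>ws.av n \<omega> (\<lambda>x. x ^ j) - c\<bar>) \<le> ws.ex n (\<lambda>\<omega>. \<bar>ws.av n \<omega> (\<lambda>x. x ^ j) - \<mu>\<bar> + \<bar>\<mu> - c\<bar>)"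
          by (rule ws.ex_mono) linarith
        also have "\<dots> = ws.ex n (\<lambda>\<omega>. \<bar>ws.av n \<omega> (\<lambda>x. x ^ j) - \<mu>\<bar>) + \<bar>\<mu> - c\<bar>"
          by (simp add: ws.ex_add ws.ex_const)
        also have "ws.ex n (\<lambda>\<omega>. \<bar>ws.av n \<omega> (\<lambda>x. x ^ j) - \<mu>\<bar>) \<le> sqrt (ws.ex n (\<lambda>\<omega>. (ws.av n \<omega> (\<lambda>x. x ^ j) - \<mu>)\<^sup>2))"
          by (rule ws.ex_abs_le)
        also have "ws.ex n (\<lambda>\<omega>. (ws.av n \<omega> (\<lambda>x. x ^ j) - \<mu>)\<^sup>2) = trace_var d m (N n) / (real (hrank d (N n)))\<^sup>2"
          unfolding ws.ex_def trace_var_def sum_divide_distrib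
        proof (rule sum.cong[OF refl])
          fix F assume F: "F \<in> face_bases d (N n)"
          have "ws.av n F (\<lambda>x. x ^ j) - \<mu> = (mtrace F rgram (Suc m) - trace_mean d m (N n)) / real (hrank d (N n))"
            unfolding av_power[OF F] \<mu>_def Suc by (rule diff_divide_distrib[symmetric])
          then show "face_weight d (N n) F * (ws.av n F (\<lambda>x. x ^ j) - \<mu>)\<^sup>2
              = face_weight d (N n) F * (mtrace F rgram (Suc m) - trace_mean d m (N n))\<^sup>2 / (real (hrank d (N n)))\<^sup>2"
            by (simp add: power_divide)
        qed
        finally show ?thesis by (simp add: \<mu>_def)
      qed
      then show "\<forall>\<^sub>F n in sequentially. ws.ex n (\<lambda>\<omega>. \<bar>ws.av n \<omega> (\<lambda>x. x ^ j) - c\<bar>)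
         \<le> sqrt (trace_var d m (N n) / (real (hrank d (N n)))\<^sup>2) + \<bar>trace_mean d m (N n) / real (hrank d (N n)) - c\<bar>"
        by (intro always_eventually allI)
    qed (auto intro!: always_eventually ws.ex_nonneg)
    then show ?thesis ..
  qed
  \<comment> \<open>The growth constant of \<open>mean_le\<close>; dividing by the rank leaves a
    bound independent of \<open>n\<close>.\<close>
  define C where "C = (real d + 1) * (1 + (real d + 1)\<^sup>2)"
  have moment: "ws.ex n (\<lambda>\<omega>. ws.av n \<omega> (\<lambda>x. x ^ j)) \<le> C ^ j * fact j" for n j
  proof (cases j)
    case 0
    have "ws.ex n (\<lambda>\<omega>. ws.av n \<omega> (\<lambda>x. x ^ 0)) = 1" by (simp add: ws.av_const ws.ex_const)
    then show ?thesis using 0 by simp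
  next
    case (Suc m)
    have "ws.ex n (\<lambda>\<omega>. ws.av n \<omega> (\<lambda>x. x ^ j)) = trace_mean d m (N n) / real (hrank d (N n))"
      unfolding ws.ex_def trace_mean_def sum_divide_distrib
      by (intro sum.cong refl) (simp only: av_power Suc times_divide_eq_right)
    also have "\<dots> \<le> (real (hrank d (N n)) * C ^ Suc m * fact (Suc m)) / real (hrank d (N n))"
    proof (rule divide_right_mono)
      interpret hypertree_kernel d "N n" by (rule hk)
      have "trace_mean d m (N n) = mean m"
        unfolding trace_mean_def mean_def bases_eq wgt_eq ..
      also have "\<dots> \<le> real rk * C ^ Suc m * fact (Suc m)" unfolding C_def by (rule mean_le)
      finally show "trace_mean d m (N n) \<le> real (hrank d (N n)) * C ^ Suc m * fact (Suc m)"
        unfolding rk_def hrank_def .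
    qed simp
    also have "\<dots> = C ^ j * fact j" using ws.k_pos[of n] Suc by simp
    finally show ?thesis .
  qed
  have "C > 0" unfolding C_def by (intro mult_pos_pos add_pos_nonneg) (use d in auto)
  interpret wm: weighted_spectra_moments "\<lambda>n. face_bases d (N n)" "\<lambda>n. face_weight d (N n)" "\<lambda>n. hrank d (N n)" "\<lambda>_. eigenvalue_seq" C
    by unfold_locales (fact \<open>C > 0\<close> conv_power moment)+

  define R where "R n F = ln (pdet F rgram) / real (hrank d (N n))" for n F
  have det_pos: "pdet F rgram > 0" if "face_weight d (N n) F > 0" for n F
    using that by (simp add: face_weight_def zero_less_divide_iff)
  have det_le_shifted_pdet: "pdet F rgram \<le> shifted_pdet F \<epsilon>" if F: "F \<in> face_bases d (N n)" and "\<epsilon> > 0" for n F \<epsilon>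
    unfolding shifted_pdet_0[symmetric] eigenvalue_seq(2)[OF F] using eigenvalue_seq(1)[OF F] that(2) by (intro prod_mono) auto
  have av_ln: "ws.av n F (\<lambda>x. ln (x + \<epsilon>)) = ln (shifted_pdet F \<epsilon>) / real (hrank d (N n))"
    if F: "F \<in> face_bases d (N n)" and "\<epsilon> > 0" for n F \<epsilon>
  proof -
    have "eigenvalue_seq F i + \<epsilon> \<noteq> 0 \<and> eigenvalue_seq F i + \<epsilon> > 0" if "i < hrank d (N n)" for i
      using eigenvalue_seq(1)[OF F that] \<open>\<epsilon> > 0\<close> by linarith
    then have "ln (shifted_pdet F \<epsilon>) = (\<Sum>i<hrank d (N n). ln (eigenvalue_seq F i + \<epsilon>))"
      unfolding eigenvalue_seq(2)[OF F] by (intro ln_prod) auto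
    then show ?thesis by (simp add: ws.av_def)
  qed
  have pr_eq: "ws.pr n P = (\<Sum>F\<in>face_bases d (N n). if P F then face_weight d (N n) F else 0)" for n P
    unfolding ws.pr_def ws.ex_def by (intro sum.cong refl) simp
  have pr_exp: "(\<lambda>n. ws.pr n (P n)) \<longlonglongrightarrow> 0" if "t > 0" "\<And>n. ws.pr n (P n) \<le> exp (- real (hrank d (N n)) * t)" for P t
  proof (rule tendsto_sandwich[of "\<lambda>_. 0"])
    show "(\<lambda>n. exp (- real (hrank d (N n)) * t)) \<longlonglongrightarrow> 0"
      by (rule shiftN[OF exp_rank_lim[OF d that(1)]])
  qed (use that ws.pr_nonneg in \<open>auto intro!: always_eventually\<close>)

  \<comment> \<open>The exponent \<open>2 * rk * sqrt (\<epsilon> / (d + 1))\<close> of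
    \<open>sum_shifted_pdet_le\<close>, per eigenvalue and without
    \<open>sqrt \<epsilon>\<close>.\<close>
  define K where "K = 2 / sqrt (real d + 1)"
  obtain c where c: "ln (real d + 1) - 1 \<le> c" "c \<le> ln (real d + 1)"
    "\<And>t. t > 0 \<Longrightarrow> (\<lambda>n. ws.pr n (\<lambda>F. \<bar>R n F - c\<bar> > t)) \<longlonglongrightarrow> 0"
  proof (rule ws.pr_tendsto_of_regularization[where R = R and K = K and l = "ln (real d + 1) - 1" and u = "ln (real d + 1)"])
    show "\<exists>c. ws.conv (\<lambda>x. ln (x + \<epsilon>)) c" if "\<epsilon> > 0" for \<epsilon> by (rule wm.conv_ln[OF that])
    show "K > 0" by (simp add: K_def add_nonneg_pos)
    show "R n F \<le> ws.av n F (\<lambda>x. ln (x + \<epsilon>))" if "F \<in> face_bases d (N n)" "face_weight d (N n) F > 0" "\<epsilon> > 0" for n F \<epsilon>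
      unfolding av_ln[OF that(1,3)] R_def
      using det_le_shifted_pdet[OF that(1,3)] det_pos[OF that(2)] by (intro divide_right_mono) auto
    show "(\<lambda>n. ws.pr n (\<lambda>F. ws.av n F (\<lambda>x. ln (x + \<epsilon>)) - R n F > K * sqrt \<epsilon> + t)) \<longlonglongrightarrow> 0"
      if \<epsilon>: "\<epsilon> > 0" and t: "t > 0" for \<epsilon> t
    proof (rule pr_exp[OF t])
      fix n
      have "ws.pr n (\<lambda>F. ws.av n F (\<lambda>x. ln (x + \<epsilon>)) - R n F > K * sqrt \<epsilon> + t)
         \<le> ws.pr n (\<lambda>F. shifted_pdet F \<epsilon> > exp (real (hrank d (N n)) * (K * sqrt \<epsilon> + t)) * pdet F rgram)"
      proof (rule ws.pr_mono)
        fix F assume F: "F \<in> face_bases d (N n)" "face_weight d (N n) F > 0"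
          and *: "ws.av n F (\<lambda>x. ln (x + \<epsilon>)) - R n F > K * sqrt \<epsilon> + t"
        have pos: "pdet F rgram > 0" by (rule det_pos[OF F(2)])
        have pos': "shifted_pdet F \<epsilon> > 0" using det_le_shifted_pdet[OF F(1) \<epsilon>] pos by linarith
        have "(ln (shifted_pdet F \<epsilon>) - ln (pdet F rgram)) / real (hrank d (N n)) > K * sqrt \<epsilon> + t"
          using * unfolding av_ln[OF F(1) \<epsilon>] R_def diff_divide_distrib .
        then have "real (hrank d (N n)) * (K * sqrt \<epsilon> + t) < ln (shifted_pdet F \<epsilon>) - ln (pdet F rgram)"
          using ws.k_pos[of n] by (simp add: less_divide_eq mult.commute)
        then have "exp (real (hrank d (N n)) * (K * sqrt \<epsilon> + t)) < exp (ln (shifted_pdet F \<epsilon>) - ln (pdet F rgram))"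
          by (simp only: exp_less_cancel_iff)
        also have "\<dots> = shifted_pdet F \<epsilon> / pdet F rgram" using pos pos' by (simp add: exp_diff)
        finally show "shifted_pdet F \<epsilon> > exp (real (hrank d (N n)) * (K * sqrt \<epsilon> + t)) * pdet F rgram"
          using pos by (simp add: less_divide_eq)
      qed
      also have "\<dots> \<le> exp (- real (hrank d (N n)) * t)"
        unfolding pr_eq using hypertree_kernel.sum_face_weight_ratio_large[OF hk \<epsilon>, of d n t] unfolding rk K_def .
      finally show "ws.pr n (\<lambda>F. ws.av n F (\<lambda>x. ln (x + \<epsilon>)) - R n F > K * sqrt \<epsilon> + t) \<le> exp (- real (hrank d (N n)) * t)" .
    qed
    show "(\<lambda>n. ws.pr n (\<lambda>F. R n F < ln (real d + 1) - 1 - t)) \<longlonglongrightarrow> 0" if t: "t > 0" for t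
    proof (rule pr_exp[OF t])
      fix n
      have "ws.pr n (\<lambda>F. R n F < ln (real d + 1) - 1 - t)
         \<le> ws.pr n (\<lambda>F. pdet F rgram < exp (real (hrank d (N n)) * (ln (real d + 1) - 1 - t)))"
      proof (rule ws.pr_mono)
        fix F assume F: "F \<in> face_bases d (N n)" "face_weight d (N n) F > 0" and *: "R n F < ln (real d + 1) - 1 - t"
        have pos: "pdet F rgram > 0" by (rule det_pos[OF F(2)])
        have "ln (pdet F rgram) < real (hrank d (N n)) * (ln (real d + 1) - 1 - t)"
          using * ws.k_pos[of n] unfolding R_def by (simp add: divide_less_eq mult.commute)
        then have "exp (ln (pdet F rgram)) < exp (real (hrank d (N n)) * (ln (real d + 1) - 1 - t))"
          by (simp only: exp_less_cancel_iff)
        then show "pdet F rgram < exp (real (hrank d (N n)) * (ln (real d + 1) - 1 - t))"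
          using pos by simp
      qed
      also have "\<dots> \<le> exp (- real (hrank d (N n)) * t)"
        unfolding pr_eq using hypertree_kernel.sum_face_weight_small[OF hk, of d n t] unfolding rk .
      finally show "ws.pr n (\<lambda>F. R n F < ln (real d + 1) - 1 - t) \<le> exp (- real (hrank d (N n)) * t)" .
    qed
    show "R n F \<le> ln (real d + 1)" if F: "F \<in> face_bases d (N n)" "face_weight d (N n) F > 0" for n F
    proof -
      have "F \<subseteq> nsub {1..N n} (Suc d)" "card F = hrank d (N n)" using F by (simp_all add: face_bases_def hrank_def)
      then have "pdet F rgram \<le> (real d + 1) ^ hrank d (N n)"
        using rgram_pdet_bounds(2)[of "{1..N n}" F d] by simp
      then have "ln (pdet F rgram) \<le> ln ((real d + 1) ^ hrank d (N n))"
        using det_pos[OF F(2)] by (subst ln_le_cancel_iff) auto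
      also have "\<dots> = real (hrank d (N n)) * ln (real d + 1)" by (rule ln_realpow)
      finally show ?thesis using ws.k_pos[of n] unfolding R_def by (simp add: divide_le_eq mult.commute)
    qed
  qed (rule that)
  have "(\<lambda>n. \<Sum>F\<in>face_bases d n. if \<bar>ln (pdet F rgram) / real (hrank d n) - c\<bar> > t then face_weight d n F else 0) \<longlonglongrightarrow> 0"
    if t: "t > 0" for t
  proof (rule LIMSEQ_offset[where k = "d + 1"])
    show "(\<lambda>n. \<Sum>F\<in>face_bases d (n + (d + 1)). if \<bar>ln (pdet F rgram) / real (hrank d (n + (d + 1))) - c\<bar> > t then face_weight d (n + (d + 1)) F else 0) \<longlonglongrightarrow> 0"
      using c(3)[OF t] unfolding pr_eq R_def unfolding N_def .
  qed
  with c(1,2) show ?thesis by (rule that)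
qed

text \<open>This disposes of the logarithm of the deterministic factor: the quotient of the binomial
  coefficients is at most \<open>d / n\<close>.\<close>

lemma binomial_ln_div_lim:
  assumes d: "d > 0"
  shows "(\<lambda>n. real ((n - 2) choose (d - 1)) * ln (real n) / real (n choose d)) \<longlonglongrightarrow> 0"
proof (rule tendsto_sandwich[of "\<lambda>_. 0"])
  show "\<forall>\<^sub>F n in sequentially. real ((n - 2) choose (d - 1)) * ln (real n) / real (n choose d) \<le> real d * (ln (real n) / real n)"
  proof (rule eventually_sequentiallyI[of "d + 1"])
    fix n assume n: "d + 1 \<le> n"
    have "Suc (d - 1) * (n choose Suc (d - 1)) = n * ((n - 1) choose (d - 1))"
      by (rule binomial_absorption)
    then have "d * (n choose d) = n * ((n - 1) choose (d - 1))" using d by simp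
    moreover have "(n - 2) choose (d - 1) \<le> (n - 1) choose (d - 1)" by (rule binomial_right_mono) simp
    ultimately have "n * ((n - 2) choose (d - 1)) \<le> d * (n choose d)" by simp
    then have "real (n * ((n - 2) choose (d - 1))) \<le> real (d * (n choose d))" by (simp only: of_nat_le_iff)
    moreover have "real (n choose d) > 0" using n by simp
    ultimately have "real ((n - 2) choose (d - 1)) / real (n choose d) \<le> real d / real n"
      using n by (simp add: field_simps)
    then have "real ((n - 2) choose (d - 1)) / real (n choose d) * ln (real n) \<le> real d / real n * ln (real n)"
      using n by (intro mult_right_mono) auto
    then show "real ((n - 2) choose (d - 1)) * ln (real n) / real (n choose d) \<le> real d * (ln (real n) / real n)"
      by simp
  qed
  show "(\<lambda>n. real d * (ln (real n) / real n)) \<longlonglongrightarrow> 0"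
    by (rule tendsto_mult_right_zero) (rule lim_ln_over_n)
  show "\<forall>\<^sub>F n in sequentially. 0 \<le> real ((n - 2) choose (d - 1)) * ln (real n) / real (n choose d)"
    by (rule eventually_sequentiallyI[of 1]) simp
qed auto

lemma if_le: "(P \<Longrightarrow> Q) \<Longrightarrow> (0::real) \<le> w \<Longrightarrow> (if P then w else 0) \<le> (if Q then w else 0)"
  by auto

theorem theorem1p1:
  fixes d :: nat
  assumes "d \<ge> 2"
  shows "\<exists>c::real.
    (\<forall>T :: nat \<Rightarrow> nat set set pmf.
       (\<forall>n\<ge>d+1. determinantal_hypertree d n (T n)) \<longrightarrow>
       (\<forall>\<epsilon>>0. (\<lambda>n. measure_pmf.prob (T n)
          {S. \<bar>ln (real (Coset.order (simplicial_homology S (d - 1)))) / real (n choose d) - c\<bar> > \<epsilon>})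
          \<longlonglongrightarrow> 0)) \<and>
    1 / 2 * ln ((real d + 1) / exp 1) \<le> c \<and> c \<le> 1 / 2 * ln (real d + 1)"
proof -
  have d: "d > 0" using assms by simp
  obtain c where c: "ln (real d + 1) - 1 \<le> c" "c \<le> ln (real d + 1)"
    "\<And>t. t > 0 \<Longrightarrow> (\<lambda>n. \<Sum>F\<in>face_bases d n. if \<bar>ln (pdet F rgram) / real (hrank d n) - c\<bar> > t then face_weight d n F else 0) \<longlonglongrightarrow> 0"
    using log_det_concentration[OF d] by blast
  \<comment> \<open>The limit is halved because the order is, up to the deterministic factor, the
    square root of the determinant.\<close>
  have "(\<lambda>n. measure_pmf.prob (T n)
          {S. \<bar>ln (real (Coset.order (simplicial_homology S (d - 1)))) / real (n choose d) - c / 2\<bar> > \<epsilon>}) \<longlonglongrightarrow> 0"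
    if T: "\<forall>n\<ge>d+1. determinantal_hypertree d n (T n)" and \<epsilon>: "\<epsilon> > 0" for T :: "nat \<Rightarrow> nat set set pmf" and \<epsilon>
  proof (rule tendsto_sandwich[of "\<lambda>_. 0"])
    \<comment> \<open>Collects the deterministic errors: normalization by \<open>n choose d\<close>
      instead of the rank, and the power of \<open>n\<close> contained in the determinant.\<close>
    define \<delta> where "\<delta> n = \<bar>c\<bar> * \<bar>real (hrank d n) / real (n choose d) - 1\<bar> + real ((n - 2) choose (d - 1)) * ln (real n) / real (n choose d)" for n
    have "\<delta> \<longlonglongrightarrow> \<bar>c\<bar> * \<bar>1 - 1\<bar> + 0"
      unfolding \<delta>_def hrank_def
      by (intro tendsto_add tendsto_mult tendsto_const tendsto_rabs tendsto_diff rank_div_binomial_lim binomial_ln_div_lim d)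
    then have "\<forall>\<^sub>F n in sequentially. \<delta> n < \<epsilon>" using \<epsilon> by (intro order_tendstoD(2)) auto
    moreover have "\<forall>\<^sub>F n in sequentially. n \<ge> d + 1" by (rule eventually_ge_at_top)
    ultimately show "\<forall>\<^sub>F n in sequentially. measure_pmf.prob (T n)
          {S. \<bar>ln (real (Coset.order (simplicial_homology S (d - 1)))) / real (n choose d) - c / 2\<bar> > \<epsilon>}
       \<le> (\<Sum>F\<in>face_bases d n. if \<bar>ln (pdet F rgram) / real (hrank d n) - c\<bar> > \<epsilon> then face_weight d n F else 0)"
    proof eventually_elim
      case (elim n)
      define B where "B = real (n choose d)"
      define k where "k = real (hrank d n)"
      define b where "b = real ((n - 2) choose (d - 1))"
      have n: "n > 0" "n \<ge> d" using elim by auto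
      interpret hypertree_kernel d n by unfold_locales (rule n(1))
      have B: "B > 0" using n by (simp add: B_def)
      have k: "k > 0" unfolding k_def using hrank_pos[OF elim(2)] by simp
      have kB: "k \<le> B"
        unfolding k_def B_def hrank_def of_nat_le_iff by (rule binomial_right_mono) simp
      have rk: "(n - 1) choose d = ((n - 2) choose d) + ((n - 2) choose (d - 1))"
      proof -
        have "n = Suc (Suc (n - 2))" "d = Suc (d - 1)" using elim(2) assms by simp_all
        then obtain m j where "n = Suc (Suc m)" "d = Suc j" by (rule that)
        then show ?thesis by simp
      qed
      have Tn: "determinantal_hypertree d n (T n)" using T elim(2) by blast
      have prob: "measure_pmf.prob (T n) {S. \<bar>ln (real (Coset.order (simplicial_homology S (d - 1)))) / real (n choose d) - c / 2\<bar> > \<epsilon>}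
        = (\<Sum>F\<in>face_bases d n. if \<bar>ln (sqrt (face_weight d n F * real n ^ ((n - 2) choose d))) / real (n choose d) - c / 2\<bar> > \<epsilon> then face_weight d n F else 0)"
        by (rule prob_determinantal_hypertree[OF assms elim(2) Tn, unfolded bases_eq wgt_eq,
              where P = "\<lambda>q. \<bar>ln q / real (n choose d) - c / 2\<bar> > \<epsilon>"])
      show ?case
        unfolding prob
      proof (rule sum_mono)
        fix F assume F: "F \<in> face_bases d n"
        show "(if \<bar>ln (sqrt (face_weight d n F * real n ^ ((n - 2) choose d))) / real (n choose d) - c / 2\<bar> > \<epsilon> then face_weight d n F else 0)
           \<le> (if \<bar>ln (pdet F rgram) / real (hrank d n) - c\<bar> > \<epsilon> then face_weight d n F else 0)"
        proof (cases "face_weight d n F = 0")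
          \<comment> \<open>Sets of weight 0 contribute nothing; on the others the determinant is
            positive, so the logarithm of the quotient splits.\<close>
          case False
          then have "face_weight d n F > 0" using face_weight_nonneg[OF F] by linarith
          then have pos: "pdet F rgram > 0" by (simp add: face_weight_def zero_less_divide_iff)
          define r where "r = ln (pdet F rgram) / k"
          have "face_weight d n F * real n ^ ((n - 2) choose d) = pdet F rgram / real n ^ ((n - 2) choose (d - 1))"
            unfolding face_weight_def rk using n by (simp add: power_add)
          then have ln_eq: "ln (sqrt (face_weight d n F * real n ^ ((n - 2) choose d))) = (k * r - b * ln (real n)) / 2"
            using pos n k by (simp add: ln_sqrt ln_div ln_realpow r_def b_def)
          \<comment> \<open>Separates the random deviation, damped by \<open>k / B \<le> 1\<close>,
            from the two deterministic errors. Because of the factor 1/2, the former may be as large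
            as \<open>\<epsilon>\<close> while the latter together stay below
            \<open>\<epsilon>\<close>.\<close>
          have eq: "ln (sqrt (face_weight d n F * real n ^ ((n - 2) choose d))) / B - c / 2
             = (k / B * (r - c) + c * (k / B - 1) - b * ln (real n) / B) / 2"
            unfolding ln_eq using B by (simp add: field_simps)
          have "\<not> \<bar>ln (sqrt (face_weight d n F * real n ^ ((n - 2) choose d))) / B - c / 2\<bar> > \<epsilon>" if "\<not> \<bar>r - c\<bar> > \<epsilon>"
          proof -
            have "\<bar>k / B * (r - c)\<bar> \<le> 1 * \<epsilon>"
              unfolding abs_mult using that k B kB by (intro mult_mono) auto
            moreover have "\<bar>c * (k / B - 1)\<bar> + b * ln (real n) / B < \<epsilon>"
              using elim(1) unfolding \<delta>_def k_def B_def b_def abs_mult .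
            moreover have "b * ln (real n) / B \<ge> 0" using B n by (simp add: b_def)
            moreover have "\<bar>(x + y - z) / 2\<bar> \<le> \<epsilon>" if "\<bar>x\<bar> \<le> 1 * \<epsilon>" "\<bar>y\<bar> + z < \<epsilon>" "z \<ge> 0" for x y z :: real
            proof -
              have "x + y - z \<le> 2 * \<epsilon>" "- (2 * \<epsilon>) \<le> x + y - z"
                using that abs_ge_self[of x] abs_ge_minus_self[of x] abs_ge_self[of y] abs_ge_minus_self[of y]
                by linarith+
              then show ?thesis by (simp add: abs_le_iff)
            qed
            ultimately show ?thesis unfolding eq not_less by blast
          qed
          then have "\<bar>ln (pdet F rgram) / real (hrank d n) - c\<bar> > \<epsilon>"
            if "\<bar>ln (sqrt (face_weight d n F * real n ^ ((n - 2) choose d))) / real (n choose d) - c / 2\<bar> > \<epsilon>"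
            using that unfolding B_def r_def k_def by argo
          then show ?thesis by (rule if_le) (assumption, rule face_weight_nonneg[OF F])
        qed simp
      qed
    qed
    show "(\<lambda>n. \<Sum>F\<in>face_bases d n. if \<bar>ln (pdet F rgram) / real (hrank d n) - c\<bar> > \<epsilon> then face_weight d n F else 0) \<longlonglongrightarrow> 0"
      by (rule c(3)[OF \<epsilon>])
  qed (auto intro!: always_eventually)
  moreover have "1 / 2 * ln ((real d + 1) / exp 1) \<le> c / 2"
    using c(1) by (simp add: ln_div)
  moreover have "c / 2 \<le> 1 / 2 * ln (real d + 1)"
    using c(2) by simp
  ultimately show ?thesis by blast
qed

end
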